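(* Let $d\ge 3$ and $2\le k\le d-1$ be integers, put $t_k=\binom{k+1}{2}$, and define \[ \beta_{d,k}=\begin{cases}\dfrac{d+k}{2}-\dfrac{k-1}{k+1}, & d-k \text{ even},\\[2mm] \dfrac{d+k-1}{2}, & d-k\text{ odd}.\end{cases} \] There are constants $C_{d,k},c_{d,k}>0$, depending only on $d$ and $k$, such that for every odd prime power $q$, every nondegenerate quadratic form $Q$ on $\mathbb F_q^d$, and every set $E\subset\mathbb F_q^d$ with \[ |E|\ge C_{d,k}\,q^{\beta_{d,k}}, \] one has \[ |\mathcal T^{d,\mathrm{nd}}_{k,Q}(E)|\ge c_{d,k}\,q^{t_k}. \] Moreover, if $d-k$ is odd, then the exponent $\beta_{d,k}=(d+k-1)/2$ is optimal: for every $\alpha<\beta_{d,k}$ there are no constants $C,c>0$ independent of $q$, $Q$ and $E$ such that, for all odd prime powers $q$, all nondegenerate quadratic forms $Q$ on $\mathbb F_q^d$ and all $E\subset\mathbb F_q^d$, $|E|\ge Cq^{\alpha}$ implies $|\mathcal T^{d,\mathrm{nd}}_{k,Q}(E)|\ge c\,q^{t_k}$.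
   Context: For a nondegenerate quadratic form $Q$ on $V=\mathbb F_q^d$ ($q$ odd), $B(u,v)=\frac12(Q(u+v)-Q(u)-Q(v))$ is the associated symmetric bilinear form and $\operatorname O(Q)$ is the orthogonal group of $(V,Q)$. An ordered $k$-simplex in $E\subset V$ is a tuple $\mathbf x=(x_0,\dots,x_k)\in E^{k+1}$. Two ordered simplices $\mathbf x,\mathbf x'$ are congruent if there are $z\in V$ and $\theta\in\operatorname O(Q)$ with $x_i'=z+\theta x_i$ for all $0\le i\le k$. The edge Gram matrix of $\mathbf x$ is $G(\mathbf x)=(B(x_i-x_0,x_j-x_0))_{1\le i,j\le k}$, and $\mathbf x$ is nondegenerate if $\det G(\mathbf x)\ne 0$. $\mathcal T^{d,\mathrm{nd}}_{k,Q}(E)$ denotes the set of congruence classes of nondegenerate ordered $k$-simplices with all vertices in $E$. *)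

theory Defs
  imports
    Complex_Main
    "HOL-Combinatorics.Permutations"
    "HOL-Number_Theory.Prime_Powers"
    "HOL-Algebra.Module"
    "HOL-Algebra.QuotRing"
    "HOL-Algebra.Weak_Morphisms"
    "HOL-Algebra.Bij"
begin

text \<open>
  Constants that are uniform in \<open>q\<close> require quantifying over finite fields inside a formula. A
  finite field is therefore a HOL-Algebra ring with carrier in \<open>int\<close>; by the next lemma every
  finite field occurs, up to isomorphism.
\<close>

lemma finite_field_copy_on_int:
  assumes "field R" "finite (carrier R)"
  shows "\<exists>S :: int ring. field S \<and> R \<simeq> S"
proof -
  obtain f :: "'a \<Rightarrow> nat" where "inj_on f (carrier R)"
    using assms(2) by (meson finite_imp_inj_to_nat_seg)
  then have inj: "inj_on (int \<circ> f) (carrier R)"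
    by (simp add: comp_inj_on inj_on_def)
  have "field (image_ring (int \<circ> f) R)"
    using field.inj_imp_image_ring_is_field[OF assms(1) inj] .
  moreover have "R \<simeq> image_ring (int \<circ> f) R"
    using inj_imp_image_ring_iso[OF inj]
    by (auto simp: is_ring_iso_def)
  ultimately show ?thesis by blast
qed

text \<open>
  The space \<open>R\<^sup>d\<close>. The fields \<open>mult\<close> and \<open>one\<close> of a module record play no role.
\<close>

definition coord_space :: "('a, 'm) ring_scheme \<Rightarrow> nat \<Rightarrow> ('a, nat \<Rightarrow> 'a) module" where
  "coord_space R d =
    \<lparr>carrier = {..<d} \<rightarrow>\<^sub>E carrier R,
     monoid.mult = undefined, one = undefined,
     zero = (\<lambda>i\<in>{..<d}. \<zero>\<^bsub>R\<^esub>),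
     add = (\<lambda>u v. \<lambda>i\<in>{..<d}. u i \<oplus>\<^bsub>R\<^esub> v i),
     smult = (\<lambda>a v. \<lambda>i\<in>{..<d}. a \<otimes>\<^bsub>R\<^esub> v i)\<rparr>"

lemma coord_space_module:
  assumes "cring R"
  shows "module R (coord_space R d)"
proof -
  interpret cring R by fact
  show ?thesis
  proof (rule moduleI)
    show "abelian_group (coord_space R d)"
    proof (rule abelian_groupI)
      fix x assume x: "x \<in> carrier (coord_space R d)"
      show "\<exists>y\<in>carrier (coord_space R d).
              y \<oplus>\<^bsub>coord_space R d\<^esub> x = \<zero>\<^bsub>coord_space R d\<^esub>"
        by (rule bexI[of _ "\<lambda>i\<in>{..<d}. \<ominus>\<^bsub>R\<^esub> x i"])
           (use x in \<open>auto simp: coord_space_def PiE_iff l_neg\<close>)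
    qed (auto simp: coord_space_def PiE_iff extensional_def a_ac fun_eq_iff)
  qed (auto simp: coord_space_def PiE_iff extensional_def fun_eq_iff l_distr r_distr m_assoc
        intro: assms)
qed

definition polar_form ::
  "('a, 'm) ring_scheme \<Rightarrow> ('a, 'v, 'n) module_scheme \<Rightarrow> ('v \<Rightarrow> 'a) \<Rightarrow> 'v \<Rightarrow> 'v \<Rightarrow> 'a" where
  "polar_form R V Q u v =
    inv\<^bsub>R\<^esub> (\<one>\<^bsub>R\<^esub> \<oplus>\<^bsub>R\<^esub> \<one>\<^bsub>R\<^esub>) \<otimes>\<^bsub>R\<^esub> (Q (u \<oplus>\<^bsub>V\<^esub> v) \<ominus>\<^bsub>R\<^esub> Q u \<ominus>\<^bsub>R\<^esub> Q v)"

definition bilinear_form ::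
  "('a, 'm) ring_scheme \<Rightarrow> ('a, 'v, 'n) module_scheme \<Rightarrow> ('v \<Rightarrow> 'v \<Rightarrow> 'a) \<Rightarrow> bool" where
  "bilinear_form R V B \<longleftrightarrow>
    (\<forall>u\<in>carrier V. \<forall>v\<in>carrier V. B u v \<in> carrier R) \<and>
    (\<forall>a\<in>carrier R. \<forall>u\<in>carrier V. \<forall>v\<in>carrier V. \<forall>w\<in>carrier V.
      B (a \<odot>\<^bsub>V\<^esub> u \<oplus>\<^bsub>V\<^esub> v) w = a \<otimes>\<^bsub>R\<^esub> B u w \<oplus>\<^bsub>R\<^esub> B v w \<and>
      B w (a \<odot>\<^bsub>V\<^esub> u \<oplus>\<^bsub>V\<^esub> v) = a \<otimes>\<^bsub>R\<^esub> B w u \<oplus>\<^bsub>R\<^esub> B w v)"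

definition quadratic_form ::
  "('a, 'm) ring_scheme \<Rightarrow> ('a, 'v, 'n) module_scheme \<Rightarrow> ('v \<Rightarrow> 'a) \<Rightarrow> bool" where
  "quadratic_form R V Q \<longleftrightarrow>
    Q \<in> carrier V \<rightarrow> carrier R \<and>
    (\<forall>a\<in>carrier R. \<forall>v\<in>carrier V. Q (a \<odot>\<^bsub>V\<^esub> v) = a \<otimes>\<^bsub>R\<^esub> a \<otimes>\<^bsub>R\<^esub> Q v) \<and>
    bilinear_form R V (polar_form R V Q)"

definition nondegenerate_form ::
  "('a, 'm) ring_scheme \<Rightarrow> ('a, 'v, 'n) module_scheme \<Rightarrow> ('v \<Rightarrow> 'a) \<Rightarrow> bool" where
  "nondegenerate_form R V Q \<longleftrightarrow>
    (\<forall>u\<in>carrier V. (\<forall>v\<in>carrier V. polar_form R V Q u v = \<zero>\<^bsub>R\<^esub>) \<longrightarrow> u = \<zero>\<^bsub>V\<^esub>)"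

definition orthogonal_maps ::
  "('a, 'm) ring_scheme \<Rightarrow> ('a, 'v, 'n) module_scheme \<Rightarrow> ('v \<Rightarrow> 'a) \<Rightarrow> ('v \<Rightarrow> 'v) set" where
  "orthogonal_maps R V Q =
    {\<theta> \<in> Bij (carrier V).
      (\<forall>u\<in>carrier V. \<forall>v\<in>carrier V. \<theta> (u \<oplus>\<^bsub>V\<^esub> v) = \<theta> u \<oplus>\<^bsub>V\<^esub> \<theta> v) \<and>
      (\<forall>a\<in>carrier R. \<forall>v\<in>carrier V. \<theta> (a \<odot>\<^bsub>V\<^esub> v) = a \<odot>\<^bsub>V\<^esub> \<theta> v) \<and>
      (\<forall>v\<in>carrier V. Q (\<theta> v) = Q v)}"

text \<open>The determinant, by the Leibniz formula, of a square matrix indexed by a finite set \<open>I\<close>.\<close>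

definition det_on :: "('a, 'm) ring_scheme \<Rightarrow> 'i set \<Rightarrow> ('i \<Rightarrow> 'i \<Rightarrow> 'a) \<Rightarrow> 'a" where
  "det_on R I A =
    (\<Oplus>\<^bsub>R\<^esub>p \<in> {p. p permutes I}.
      (if evenperm p then \<one>\<^bsub>R\<^esub> else \<ominus>\<^bsub>R\<^esub> \<one>\<^bsub>R\<^esub>) \<otimes>\<^bsub>R\<^esub> (\<Otimes>\<^bsub>R\<^esub>i \<in> I. A i (p i)))"

definition simplices :: "nat \<Rightarrow> 'v set \<Rightarrow> (nat \<Rightarrow> 'v) set" where
  "simplices k E = {0..k} \<rightarrow>\<^sub>E E"

definition congruence_rel ::
  "('a, 'm) ring_scheme \<Rightarrow> ('a, 'v, 'n) module_scheme \<Rightarrow> ('v \<Rightarrow> 'a) \<Rightarrow> nat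
    \<Rightarrow> ((nat \<Rightarrow> 'v) \<times> (nat \<Rightarrow> 'v)) set" where
  "congruence_rel R V Q k =
    {(x, x'). x \<in> simplices k (carrier V) \<and> x' \<in> simplices k (carrier V) \<and>
      (\<exists>z\<in>carrier V. \<exists>\<theta>\<in>orthogonal_maps R V Q. \<forall>i\<in>{0..k}. x' i = z \<oplus>\<^bsub>V\<^esub> \<theta> (x i))}"

definition edge_gram ::
  "('a, 'm) ring_scheme \<Rightarrow> ('a, 'v, 'n) module_scheme \<Rightarrow> ('v \<Rightarrow> 'a)
    \<Rightarrow> (nat \<Rightarrow> 'v) \<Rightarrow> nat \<Rightarrow> nat \<Rightarrow> 'a" where
  "edge_gram R V Q x i j = polar_form R V Q (x i \<ominus>\<^bsub>V\<^esub> x 0) (x j \<ominus>\<^bsub>V\<^esub> x 0)"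

definition nd_simplices ::
  "('a, 'm) ring_scheme \<Rightarrow> ('a, 'v, 'n) module_scheme \<Rightarrow> ('v \<Rightarrow> 'a) \<Rightarrow> nat
    \<Rightarrow> 'v set \<Rightarrow> (nat \<Rightarrow> 'v) set" where
  "nd_simplices R V Q k E = {x \<in> simplices k E. det_on R {1..k} (edge_gram R V Q x) \<noteq> \<zero>\<^bsub>R\<^esub>}"

text \<open>
  A congruence class is a subset of the simplices of the whole space; those classes are taken
  that have a nondegenerate representative with all vertices in \<open>E\<close>.
\<close>

definition nd_congruence_classes ::
  "('a, 'm) ring_scheme \<Rightarrow> ('a, 'v, 'n) module_scheme \<Rightarrow> ('v \<Rightarrow> 'a) \<Rightarrow> nat
    \<Rightarrow> 'v set \<Rightarrow> (nat \<Rightarrow> 'v) set set" where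
  "nd_congruence_classes R V Q k E = nd_simplices R V Q k E // congruence_rel R V Q k"

definition beta :: "nat \<Rightarrow> nat \<Rightarrow> real" where
  "beta d k =
    (if even (int d - int k) then (real d + real k) / 2 - (real k - 1) / (real k + 1)
     else (real d + real k - 1) / 2)"

end

theory Submission
  imports
    "Jordan_Normal_Form.Determinant"
    "HOL-Library.Function_Algebras"
    "HOL-Algebra.IntRing"
    "HOL-Algebra.Multiplicative_Group"
    "HOL-Number_Theory.Residues"
    Defs
begin

text \<open>
  Congruent simplices have equal edge Gram matrices, so it suffices to find many nonsingular Gram
  matrices of simplices in \<open>E\<close>.

  If \<open>n\<close> is isotropic, the orthogonal projection of a slice \<open>{x \<in> E. B x n = c}\<close> to a nondegenerate
  space of dimension \<open>d - 2\<close> complementing \<open>n\<close> and an isotropic partner of \<open>n\<close> preserves Gram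
  matrices. A Fourier estimate, averaged over \<open>n\<close>, yields a slice whose image has about \<open>card E / q\<close>
  points. Iterating this, the cases \<open>d = k + 1\<close> and \<open>d = k\<close> remain.

  For \<open>d = k + 1\<close>, vertices are added one at a time. Two candidates \<open>y\<close>, \<open>y'\<close> have the same distances to
  \<open>x\<^sub>1, \<dots>, x\<^sub>j\<close> exactly if all \<open>x\<^sub>i\<close> lie on the bisecting hyperplane of \<open>y\<close> and \<open>y'\<close>, so these coincidences are
  controlled by a second moment of hyperplane sections. At the last vertex a factor \<open>q\<close> is gained because
  \<open>y - y'\<close> is not isotropic, being orthogonal to a nondegenerate subspace of codimension one.

  For \<open>d = k\<close>, pairs of congruent simplices are counted by the \<open>(d + 1)\<close>-st moment of the number of
  \<open>v \<in> E\<close> with \<open>z + \<theta> v \<in> E\<close>, over all isometries \<open>\<theta>\<close> and translations \<open>z\<close>. Its variance is bounded by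
  Plancherel and the number of isometries that take one given nonzero vector to another.

  The exponent for odd \<open>d - k\<close> is attained by \<open>W\<^sup>\<bottom>\<close> for a totally isotropic \<open>W\<close> of dimension
  \<open>(d - k + 1) / 2\<close>: Gram matrices of simplices in it have rank at most \<open>k - 1\<close>.
\<close>

section \<open>Quadratic spaces over a finite field\<close>

text \<open>Both exponents are points where an error term meets the main term; write
  \<open>N\<close> for \<open>card E\<close>. For \<open>d = k + 1\<close>, the candidates for the
  last vertex give a deviation of order \<open>N ^ k * q ^ d\<close> against an expected
  \<open>N ^ (k + 2) / q ^ k\<close>. These would balance only at
  \<open>N ^ 2 = q ^ (2 * k + 1)\<close>; the factor gained from nonisotropic normals lowers this to
  \<open>N = q ^ k\<close>. For \<open>d = k\<close>, at most about
  \<open>q ^ ((d - 1) choose 2)\<close> isometries take one given nonzero vector to another, and the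
  resulting variance balances at \<open>N ^ (d + 1) = q ^ (d * d + 1)\<close>, which is
  \<open>N = q powr beta d d\<close>. Each descent lowers the dimension by two and costs a factor
  \<open>q\<close> in \<open>N\<close>, so the exponent grows by one. The average over
  \<open>n\<close> guards against sets \<open>E\<close> made of lines in one isotropic direction,
  for which the projection along that direction would lose a further factor \<open>q\<close>.
  Nondegeneracy is imposed on the simplices from the start: they are a positive proportion of all
  tuples once \<open>N\<close> is at least \<open>4 * q ^ (d - 1)\<close>. Both base cases rest on
  it, one for the orthogonality at the last vertex, the other for recovering an isometry from a Gram
  matrix.\<close>

text \<open>
  The field is the ideal \<open>K\<close> generated by an idempotent \<open>e\<close> of an ambient commutative ring, because the
  fields in the theorem are not types. Thus \<open>e\<close> is the unit of \<open>K\<close>, while \<open>1\<close> need not lie in \<open>K\<close>.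
\<close>

locale idem_field =
  fixes e :: "'a::comm_ring_1"
  assumes idem: "e * e = e"
    and e_nz: "e \<noteq> 0"
    and fin: "finite {x. e * x = x}"
    and inverse_ex: "\<And>x. e * x = x \<Longrightarrow> x \<noteq> 0 \<Longrightarrow> \<exists>y. e * y = y \<and> x * y = e"
    and half_ex: "\<exists>h. e * h = h \<and> h + h = e"
begin

definition K :: "'a set" where "K = {x. e * x = x}"

definition q :: nat where "q = card K"

lemma K_iff: "x \<in> K \<longleftrightarrow> e * x = x" by (simp add: K_def)

lemma finite_K [simp]: "finite K" using fin by (simp add: K_def)

lemma K_closed [simp, intro]:
  "0 \<in> K" "e \<in> K"
  "x \<in> K \<Longrightarrow> y \<in> K \<Longrightarrow> x + y \<in> K" "x \<in> K \<Longrightarrow> y \<in> K \<Longrightarrow> x - y \<in> K"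
  "x \<in> K \<Longrightarrow> - x \<in> K" "x \<in> K \<Longrightarrow> x * z \<in> K" "x \<in> K \<Longrightarrow> z * x \<in> K"
  using idem by (auto simp: K_iff algebra_simps) (metis mult.assoc mult.commute)+

lemma K_unit: "x \<in> K \<Longrightarrow> e * x = x" "x \<in> K \<Longrightarrow> x * e = x"
  by (auto simp: K_iff mult.commute)

lemma K_inverse: "x \<in> K \<Longrightarrow> x \<noteq> 0 \<Longrightarrow> \<exists>y\<in>K. x * y = e"
  using inverse_ex[of x] unfolding Bex_def K_iff by blast

lemma K_no_zero_div: "x \<in> K \<Longrightarrow> y \<in> K \<Longrightarrow> x * y = 0 \<longleftrightarrow> x = 0 \<or> y = 0"
proof
  assume xy: "x \<in> K" "y \<in> K" and xy0: "x * y = 0"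
  show "x = 0 \<or> y = 0"
  proof (rule disjCI)
    assume "y \<noteq> 0"
    then obtain z where "y * z = e" using K_inverse[OF xy(2)] by blast
    then have "x = x * y * z" using K_unit(2)[OF xy(1)] by (simp add: mult.assoc)
    then show "x = 0" using xy0 by simp
  qed
qed auto

lemma K_half: obtains h where "h \<in> K" "h + h = e" "h \<noteq> 0"
  using half_ex e_nz unfolding K_iff by (metis add.right_neutral)

lemma K_double: "x \<in> K \<Longrightarrow> x + x = 0 \<longleftrightarrow> x = 0"
proof
  assume x: "x \<in> K" "x + x = 0"
  obtain h where "h + h = e" using K_half by blast
  then have "x = h * (x + x)" using K_unit(1)[OF x(1)] by (metis distrib_left distrib_right)
  then show "x = 0" using x(2) by simp
qed simp

lemma K_double': "x \<in> K \<Longrightarrow> 2 * x = 0 \<longleftrightarrow> x = 0"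
  unfolding mult_2 by (rule K_double)

lemma q_ge_3: "q \<ge> 3"
proof -
  have "e \<noteq> - e" using K_double[of e] e_nz by (metis K_closed(2) add.right_inverse)
  then have "card {0, e, - e} = 3" using e_nz by auto
  moreover have "{0, e, - e} \<subseteq> K" by auto
  ultimately show ?thesis unfolding q_def by (metis card_mono finite_K)
qed

lemma q_pos [simp]: "q > 0" using q_ge_3 by simp

end

text \<open>The axioms hold for all scalars of the ambient ring and all vectors of the type, so
  calculations carry no membership conditions. The vector space over \<open>K\<close> consists of
  the vectors called \<open>unital\<close> below, and \<open>B\<close> takes values in
  \<open>K\<close> as soon as one argument is of this kind.\<close>

locale form_space = idem_field e for e :: "'a::comm_ring_1" +
  fixes sc :: "'a \<Rightarrow> 'v::ab_group_add \<Rightarrow> 'v" (infixr "\<star>" 75)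
    and B :: "'v \<Rightarrow> 'v \<Rightarrow> 'a"
  assumes sc_add_right: "a \<star> (u + v) = a \<star> u + a \<star> v"
    and sc_add_left: "(a + b) \<star> u = a \<star> u + b \<star> u"
    and sc_mult: "(a * b) \<star> u = a \<star> (b \<star> u)"
    and sc_one: "1 \<star> u = u"
    and B_add_left: "B (u + v) w = B u w + B v w"
    and B_sc_left: "B (a \<star> u) w = a * B u w"
    and B_commute: "B u v = B v u"
begin

abbreviation Q :: "'v \<Rightarrow> 'a" where "Q u \<equiv> B u u"

lemma B_add_right: "B w (u + v) = B w u + B w v"
  by (metis B_add_left B_commute)

lemma B_sc_right: "B w (a \<star> u) = a * B w u"
  by (metis B_sc_left B_commute)

lemma sc_zero_right [simp]: "a \<star> 0 = 0"
  using sc_add_right[of a 0 0] by simp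

lemma sc_zero_left [simp]: "0 \<star> u = 0"
  using sc_add_left[of 0 0 u] by simp

lemma sc_minus_right: "a \<star> (- u) = - (a \<star> u)"
  using sc_add_right[of a u "- u"] by (simp add: eq_neg_iff_add_eq_0 add.commute)

lemma sc_minus_left: "(- a) \<star> u = - (a \<star> u)"
  using sc_add_left[of a "- a" u] by (simp add: eq_neg_iff_add_eq_0 add.commute)

lemma sc_diff_right: "a \<star> (u - v) = a \<star> u - a \<star> v"
  using sc_add_right[of a u "- v"] by (simp add: sc_minus_right)

lemma sc_diff_left: "(a - b) \<star> u = a \<star> u - b \<star> u"
  using sc_add_left[of a "- b" u] by (simp add: sc_minus_left)

lemma B_zero [simp]: "B 0 w = 0" "B w 0 = 0"
  using B_add_left[of 0 0 w] B_add_right[of w 0 0] by auto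

lemma B_minus: "B (- u) w = - B u w" "B w (- u) = - B w u"
  using B_add_left[of u "- u" w] B_add_right[of w u "- u"]
  by (auto simp: eq_neg_iff_add_eq_0 add.commute)

lemma B_diff: "B (u - v) w = B u w - B v w" "B w (u - v) = B w u - B w v"
  using B_add_left[of u "- v" w] B_add_right[of w u "- v"] by (auto simp: B_minus)

lemma B_sum_right: "B w (sum f I) = (\<Sum>i\<in>I. B w (f i))"
  by (induction I rule: infinite_finite_induct) (auto simp: B_add_right)

lemma sc_sum: "a \<star> sum f I = (\<Sum>i\<in>I. a \<star> f i)"
  by (induction I rule: infinite_finite_induct) (auto simp: sc_add_right)

lemmas sc_simps = sc_add_right sc_add_left sc_diff_right sc_diff_left sc_minus_right sc_minus_left
lemmas B_simps = B_add_left B_add_right B_sc_left B_sc_right B_minus B_diff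

lemma sc_sc: "a \<star> (b \<star> u) = (a * b) \<star> u" by (simp add: sc_mult)

lemma Q_add: "Q (u + v) = Q u + Q v + 2 * B u v"
  by (simp add: B_simps B_commute[of v u] algebra_simps)

lemma Q_diff: "Q (u - v) = Q u + Q v - 2 * B u v"
  by (simp add: B_simps B_commute[of v u] algebra_simps)

definition unital :: "'v \<Rightarrow> bool" where "unital u \<longleftrightarrow> e \<star> u = u"

lemma unital_simps [simp, intro]:
  "unital 0" "unital u \<Longrightarrow> unital v \<Longrightarrow> unital (u + v)" "unital u \<Longrightarrow> unital v \<Longrightarrow> unital (u - v)"
  "unital u \<Longrightarrow> unital (- u)" "unital u \<Longrightarrow> unital (a \<star> u)"
  by (auto simp: unital_def sc_simps sc_sc mult.commute[of e]) (metis sc_mult)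

lemma unital_sum: "(\<And>i. i \<in> I \<Longrightarrow> unital (f i)) \<Longrightarrow> unital (sum f I)"
  by (simp add: unital_def sc_sum)

lemma B_in_K [intro]: "unital u \<Longrightarrow> B u v \<in> K" "unital u \<Longrightarrow> B v u \<in> K"
  by (metis B_sc_left K_iff unital_def, metis B_sc_right K_iff unital_def)

lemma sc_eq_0: "a \<in> K \<Longrightarrow> unital u \<Longrightarrow> a \<star> u = 0 \<longleftrightarrow> a = 0 \<or> u = 0"
proof
  assume a: "a \<in> K" "unital u" "a \<star> u = 0"
  have "u = 0" if "a \<noteq> 0"
  proof -
    from that
    obtain z where "z * a = e" using K_inverse[OF a(1)] by (metis mult.commute)
    then have "u = z \<star> (a \<star> u)" using a(2) by (simp add: sc_sc unital_def)
    then show "u = 0" using a(3) by simp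
  qed
  then show "a = 0 \<or> u = 0" by blast
qed auto

text \<open>Closure under every ambient scalar is the same as closure under \<open>K\<close>: on a
  unital vector \<open>a\<close> acts as \<open>a * e\<close>, which lies in
  \<open>K\<close>.\<close>

definition subsp :: "'v set \<Rightarrow> bool" where
  "subsp U \<longleftrightarrow> 0 \<in> U \<and> (\<forall>u\<in>U. \<forall>v\<in>U. u + v \<in> U) \<and> (\<forall>a. \<forall>u\<in>U. a \<star> u \<in> U) \<and> (\<forall>u\<in>U. unital u)"

lemma subspD:
  assumes "subsp U"
  shows "0 \<in> U" "u \<in> U \<Longrightarrow> v \<in> U \<Longrightarrow> u + v \<in> U" "u \<in> U \<Longrightarrow> a \<star> u \<in> U" "u \<in> U \<Longrightarrow> unital u"
    "u \<in> U \<Longrightarrow> v \<in> U \<Longrightarrow> u - v \<in> U" "u \<in> U \<Longrightarrow> - u \<in> U"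
proof -
  show "0 \<in> U" "u \<in> U \<Longrightarrow> v \<in> U \<Longrightarrow> u + v \<in> U" "u \<in> U \<Longrightarrow> a \<star> u \<in> U" "u \<in> U \<Longrightarrow> unital u"
    using assms by (auto simp: subsp_def)
  have m: "- v = (- 1) \<star> v" for v by (simp add: sc_minus_left sc_one)
  show "u \<in> U \<Longrightarrow> - u \<in> U" using assms unfolding m by (auto simp: subsp_def)
  show "u \<in> U \<Longrightarrow> v \<in> U \<Longrightarrow> u - v \<in> U"
    using assms unfolding diff_conv_add_uminus m[of v] by (auto simp: subsp_def)
qed

lemma subsp_sum: "subsp U \<Longrightarrow> (\<And>i. i \<in> I \<Longrightarrow> f i \<in> U) \<Longrightarrow> sum f I \<in> U"
  by (induction I rule: infinite_finite_induct) (auto dest: subspD(1,2))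

text \<open>The dimension \<open>d\<close> is recorded by the cardinality.\<close>

definition nd_space :: "nat \<Rightarrow> 'v set \<Rightarrow> bool" where
  "nd_space d U \<longleftrightarrow> subsp U \<and> finite U \<and> card U = q ^ d \<and> (\<forall>u\<in>U. (\<forall>v\<in>U. B u v = 0) \<longrightarrow> u = 0)"

lemma nd_spaceD:
  assumes "nd_space d U"
  shows "subsp U" "finite U" "card U = q ^ d" "u \<in> U \<Longrightarrow> (\<And>v. v \<in> U \<Longrightarrow> B u v = 0) \<Longrightarrow> u = 0"
  using assms by (auto simp: nd_space_def)

definition perp :: "'v set \<Rightarrow> 'v set \<Rightarrow> 'v set" where
  "perp U A = {u \<in> U. \<forall>a\<in>A. B u a = 0}"

lemma subsp_perp: "subsp U \<Longrightarrow> subsp (perp U A)"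
  by (auto simp: subsp_def perp_def B_simps)

lemma nd_dual:
  assumes "nd_space d U" "\<xi> \<in> U" "\<xi> \<noteq> 0"
  obtains \<zeta> where "\<zeta> \<in> U" "B \<xi> \<zeta> = e"
proof -
  obtain v where v: "v \<in> U" "B \<xi> v \<noteq> 0" using assms nd_spaceD(4) by blast
  then obtain y where "y \<in> K" "B \<xi> v * y = e"
    using K_inverse B_in_K subspD(4)[OF nd_spaceD(1)[OF assms(1)]] by meson
  then show ?thesis using that[of "y \<star> v"] v subspD(3)[OF nd_spaceD(1)[OF assms(1)]]
    by (auto simp: B_simps mult.commute)
qed

text \<open>Double counting of the pairs \<open>(s, t)\<close> for which
  \<open>s + t \<star> w\<close> satisfies \<open>P\<close>: translation by
  \<open>t \<star> w\<close> permutes \<open>S\<close>, so every \<open>t\<close> contributes the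
  same number, while every \<open>s\<close> contributes at most \<open>m\<close>.\<close>

lemma line_count:
  assumes "finite S" "\<And>s t. s \<in> S \<Longrightarrow> t \<in> K \<Longrightarrow> s + t \<star> w \<in> S"
    and "\<And>s. s \<in> S \<Longrightarrow> card {t \<in> K. P (s + t \<star> w)} \<le> m"
  shows "q * card {s \<in> S. P s} \<le> m * card S"
proof -
  have eq: "card {s \<in> S. P (s + t \<star> w)} = card {s \<in> S. P s}" if "t \<in> K" for t
  proof (rule bij_betw_same_card[of "\<lambda>s. s + t \<star> w"], rule bij_betw_byWitness[where f' = "\<lambda>s. s + (- t) \<star> w"])
    show "(\<lambda>s. s + t \<star> w) ` {s \<in> S. P (s + t \<star> w)} \<subseteq> {s \<in> S. P s}"
      using assms(2) that by auto
    show "(\<lambda>s. s + - t \<star> w) ` {s \<in> S. P s} \<subseteq> {s \<in> S. P (s + t \<star> w)}"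
      using assms(2)[of _ "- t"] that by (auto simp: sc_minus_left)
  qed (auto simp: sc_minus_left)
  have "q * card {s \<in> S. P s} = (\<Sum>t\<in>K. card {s \<in> S. P (s + t \<star> w)})"
    by (simp add: eq q_def)
  also have "\<dots> = (\<Sum>t\<in>K. \<Sum>s\<in>S. if P (s + t \<star> w) then 1 else 0)"
    using assms(1) by (simp add: sum.If_cases Int_def)
  also have "\<dots> = (\<Sum>s\<in>S. \<Sum>t\<in>K. if P (s + t \<star> w) then 1 else 0)"
    by (rule sum.swap)
  also have "\<dots> = (\<Sum>s\<in>S. card {t \<in> K. P (s + t \<star> w)})"
    by (simp add: sum.If_cases Int_def)
  also have "\<dots> \<le> (\<Sum>s\<in>S. m)" by (rule sum_mono) (use assms(3) in auto)
  finally show ?thesis by (simp add: mult.commute)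
qed

text \<open>The value is a quadratic polynomial in \<open>t\<close> with leading coefficient
  \<open>Q w\<close>. Two distinct roots have a prescribed sum, so one root \<open>t1\<close>
  determines any other.\<close>

lemma quadratic_roots:
  assumes "unital w" "Q w \<noteq> 0"
  shows "card {t \<in> K. Q (s + t \<star> w) = c} \<le> 2"
proof -
  let ?A = "{t \<in> K. Q (s + t \<star> w) = c}"
  have fin: "finite ?A" by simp
  have Qw: "Q w \<in> K" and Bw: "B s w \<in> K" using assms by auto
  have key: "2 * B s w + (t + t') * Q w = 0" if "t \<in> ?A" "t' \<in> ?A" "t \<noteq> t'" for t t'
  proof -
    have "Q (s + t \<star> w) = Q (s + t' \<star> w)" using that by auto
    then have "(t - t') * (2 * B s w + (t + t') * Q w) = 0"
      by (simp add: B_simps B_commute[of w s] algebra_simps)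
    moreover have "2 * B s w + (t + t') * Q w \<in> K" "t - t' \<in> K" using Qw Bw that by auto
    ultimately show ?thesis using K_no_zero_div that(3) by auto
  qed
  show ?thesis
  proof (cases "?A = {}")
    case False
    then obtain t1 where t1: "t1 \<in> ?A" by auto
    have uniq: "t = t'" if "t \<in> ?A - {t1}" "t' \<in> ?A - {t1}" for t t'
    proof -
      have "2 * B s w + (t1 + t) * Q w = 0" "2 * B s w + (t1 + t') * Q w = 0"
        using key[of t1 t] key[of t1 t'] that t1 by blast+
      moreover have "(t - t') * Q w = (2 * B s w + (t1 + t) * Q w) - (2 * B s w + (t1 + t') * Q w)"
        by (simp add: algebra_simps)
      ultimately have "(t - t') * Q w = 0" by simp
      moreover have "t - t' \<in> K" using that by auto
      ultimately show ?thesis using K_no_zero_div[of "t - t'" "Q w"] Qw assms(2) by auto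
    qed
    have "finite (?A - {t1})" using fin by (rule finite_Diff)
    from card_le_Suc0_iff_eq[OF this] have "card (?A - {t1}) \<le> Suc 0" using uniq by blast
    then show ?thesis unfolding card_Diff_singleton[OF t1] by simp
  next
    case True
    show ?thesis unfolding True by simp
  qed
qed

lemma quadratic_zero_count:
  assumes "finite S" "\<And>s t. s \<in> S \<Longrightarrow> t \<in> K \<Longrightarrow> s + t \<star> w \<in> S" "unital w" "Q w \<noteq> 0"
  shows "q * card {s \<in> S. Q s = c} \<le> 2 * card S"
  using line_count[OF assms(1,2), where P = "\<lambda>s. Q s = c" and m = 2] quadratic_roots[OF assms(3,4)] by blast

text \<open>Translation by multiples of \<open>w\<close>, on which \<open>f\<close> takes the value
  \<open>e\<close>, carries each fibre of \<open>f\<close> bijectively to any other.\<close>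

lemma linear_fibre:
  assumes "subsp U" "finite U" "\<And>u v. f (u + v) = f u + f v" "\<And>a u. f (a \<star> u) = a * f u"
    "w \<in> U" "f w = e" "c \<in> K"
  shows "q * card {u \<in> U. f u = c} = card U"
proof -
  have fK: "f u \<in> K" if "u \<in> U" for u
    using assms(4)[of e u] subspD(4)[OF assms(1) that] by (simp add: unital_def K_iff)
  have mns: "f (- u) = - f u" for u using assms(3)[of u "- u"] assms(4)[of 0 0]
    by (simp add: eq_neg_iff_add_eq_0 add.commute)
  have "card U = (\<Sum>a\<in>K. card {u \<in> U. f u = a})"
  proof -
    have "U = (\<Union>a\<in>K. {u \<in> U. f u = a})" using fK by auto
    then show ?thesis using card_UN_disjoint[of K "\<lambda>a. {u \<in> U. f u = a}"] assms(2) by auto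
  qed
  also have "\<dots> = (\<Sum>a\<in>K. card {u \<in> U. f u = c})"
  proof (rule sum.cong[OF refl])
    fix a assume a: "a \<in> K"
    show "card {u \<in> U. f u = a} = card {u \<in> U. f u = c}"
    proof (rule bij_betw_same_card, rule bij_betw_byWitness)
      show "(\<lambda>u. u + (c - a) \<star> w) ` {u \<in> U. f u = a} \<subseteq> {u \<in> U. f u = c}"
        "(\<lambda>u. u + (a - c) \<star> w) ` {u \<in> U. f u = c} \<subseteq> {u \<in> U. f u = a}"
        using assms(7) a subspD[OF assms(1)] assms(5)
        by (auto simp: assms(3,4,6) K_unit left_diff_distrib)
    qed (auto simp: sc_add_left[symmetric])
  qed
  finally show ?thesis by (simp add: q_def)
qed

lemma card_hyperplane:
  assumes "nd_space d U" "\<xi> \<in> U" "\<xi> \<noteq> 0" "c \<in> K"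
  shows "q * card {u \<in> U. B \<xi> u = c} = q ^ d"
proof -
  obtain \<zeta> where "\<zeta> \<in> U" "B \<xi> \<zeta> = e" using nd_dual[OF assms(1-3)] .
  then show ?thesis
    using linear_fibre[OF nd_spaceD(1,2)[OF assms(1)], of "B \<xi>" \<zeta> c] assms(4) nd_spaceD(3)[OF assms(1)]
    by (simp add: B_simps)
qed

lemma isotropic_imp_zero_form:
  assumes "subsp W" "\<And>w. w \<in> W \<Longrightarrow> Q w = 0" "u \<in> W" "v \<in> W"
  shows "B u v = 0"
proof -
  have "Q (u + v) = 0" using assms(2) subspD(2)[OF assms(1,3,4)] by blast
  then have "2 * B u v = 0" using assms by (simp add: Q_add)
  moreover have "B u v \<in> K" using assms subspD(4) by blast
  ultimately show ?thesis using K_double' by blast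
qed

end

section \<open>Tuples with nonsingular Gram matrix\<close>

context form_space
begin

definition lincomb :: "nat \<Rightarrow> (nat \<Rightarrow> 'a) \<Rightarrow> (nat \<Rightarrow> 'v) \<Rightarrow> 'v" where
  "lincomb j c v = (\<Sum>i<j. c i \<star> v i)"

text \<open>This is injectivity of the Gram matrix on coefficient vectors over \<open>K\<close>,
  stated without a determinant; \<open>nonsingular_det\<close> makes the link to the
  determinant.\<close>

definition nonsingular :: "nat \<Rightarrow> (nat \<Rightarrow> 'v) \<Rightarrow> bool" where
  "nonsingular j v \<longleftrightarrow> (\<forall>c. (\<forall>i<j. c i \<in> K) \<longrightarrow> (\<forall>i<j. B (v i) (lincomb j c v) = 0) \<longrightarrow> (\<forall>i<j. c i = 0))"

lemma nonsingularD: "nonsingular j v \<Longrightarrow> (\<And>i. i < j \<Longrightarrow> c i \<in> K) \<Longrightarrow> (\<And>i. i < j \<Longrightarrow> B (v i) (lincomb j c v) = 0)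
    \<Longrightarrow> i < j \<Longrightarrow> c i = 0"
  unfolding nonsingular_def by blast

lemma lincomb_cong: "(\<And>i. i < j \<Longrightarrow> c i = c' i) \<Longrightarrow> (\<And>i. i < j \<Longrightarrow> v i = v' i) \<Longrightarrow> lincomb j c v = lincomb j c' v'"
  by (simp add: lincomb_def)

lemma nonsingular_cong: "(\<And>i. i < j \<Longrightarrow> v i = v' i) \<Longrightarrow> nonsingular j v \<longleftrightarrow> nonsingular j v'"
proof -
  assume a: "\<And>i. i < j \<Longrightarrow> v i = v' i"
  have "lincomb j c v = lincomb j c v'" for c by (rule lincomb_cong) (use a in auto)
  then show ?thesis unfolding nonsingular_def using a by auto
qed

lemma lincomb_diff: "lincomb j (\<lambda>i. c i - c' i) v = lincomb j c v - lincomb j c' v"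
  by (simp add: lincomb_def sc_diff_left sum_subtractf)

lemma lincomb_add: "lincomb j (\<lambda>i. c i + c' i) v = lincomb j c v + lincomb j c' v"
  by (simp add: lincomb_def sc_add_left sum.distrib)

lemma lincomb_scale: "lincomb j (\<lambda>i. a * c i) v = a \<star> lincomb j c v"
  by (simp add: lincomb_def sc_sc sc_sum)

lemma lincomb_Suc: "lincomb (Suc j) c v = lincomb j c v + c j \<star> v j"
  by (simp add: lincomb_def)

lemma lincomb_upd: "lincomb j c (v(j := u)) = lincomb j c v"
  by (rule lincomb_cong) auto

lemma B_lincomb: "B u (lincomb j c v) = (\<Sum>i<j. c i * B u (v i))"
  by (simp add: lincomb_def B_sum_right B_sc_right)

lemma B_lincomb_lincomb: "B (lincomb j c v) (lincomb j c' v) = (\<Sum>i<j. c' i * (\<Sum>l<j. c l * B (v i) (v l)))"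
  unfolding B_lincomb by (simp add: B_commute[of "lincomb j c v"] B_lincomb)

lemma lincomb_in: "subsp U \<Longrightarrow> (\<And>i. i < j \<Longrightarrow> v i \<in> U) \<Longrightarrow> lincomb j c v \<in> U"
  unfolding lincomb_def by (rule subsp_sum) (auto dest: subspD(3))

lemma lincomb_unital: "(\<And>i. i < j \<Longrightarrow> unital (v i)) \<Longrightarrow> unital (lincomb j c v)"
  unfolding lincomb_def by (rule unital_sum) auto

lemma B_lincomb_orth: "(\<And>i. i < j \<Longrightarrow> B (v i) p = 0) \<Longrightarrow> B p (lincomb j c v) = 0"
  unfolding B_lincomb by (rule sum.neutral) (simp add: B_commute[of p])

lemma nonsingular_inj:
  assumes "nonsingular j v"
    and "\<And>i. i < j \<Longrightarrow> c i \<in> K" "\<And>i. i < j \<Longrightarrow> c' i \<in> K"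
    and "\<And>i. i < j \<Longrightarrow> B (v i) (lincomb j c v) = B (v i) (lincomb j c' v)"
    and "i < j"
  shows "c i = c' i"
proof -
  have "c i - c' i = 0"
    by (rule nonsingularD[OF assms(1) _ _ assms(5)]) (use assms(2,3,4) in \<open>auto simp: lincomb_diff B_diff\<close>)
  then show ?thesis by simp
qed

text \<open>The Gram matrix acts injectively on the finite set of coefficient vectors, hence
  surjectively. This takes the place of inverting it.\<close>

lemma gram_solve:
  assumes "nonsingular j v" "\<And>i. i < j \<Longrightarrow> unital (v i)" "\<And>i. i < j \<Longrightarrow> g i \<in> K"
  obtains c where "\<And>i. i < j \<Longrightarrow> c i \<in> K" "\<And>i. i < j \<Longrightarrow> B (v i) (lincomb j c v) = g i"
proof -
  let ?P = "{..<j} \<rightarrow>\<^sub>E K"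
  define F where "F c = (\<lambda>i\<in>{..<j}. B (v i) (lincomb j c v))" for c
  have "F ` ?P = ?P"
  proof (rule endo_inj_surj)
    show "finite ?P" by (rule finite_PiE) auto
    show "F ` ?P \<subseteq> ?P" using B_in_K(1)[OF assms(2)] by (auto simp: F_def)
    show "inj_on F ?P"
    proof (rule inj_onI)
      fix c c' assume c: "c \<in> ?P" "c' \<in> ?P" and eq: "F c = F c'"
      show "c = c'"
      proof (rule PiE_ext[OF c])
        fix i assume "i \<in> {..<j}"
        then have i: "i < j" by simp
        show "c i = c' i"
        proof (rule nonsingular_inj[OF assms(1) _ _ _ i])
          show "c l \<in> K" "c' l \<in> K" if "l < j" for l using c that by auto
          show "B (v l) (lincomb j c v) = B (v l) (lincomb j c' v)" if "l < j" for l
            using fun_cong[OF eq, of l] that by (simp add: F_def)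
        qed
      qed
    qed
  qed
  moreover have "restrict g {..<j} \<in> ?P" using assms(3) by auto
  ultimately have "restrict g {..<j} \<in> F ` ?P" by (simp only:)
  then obtain c where c: "c \<in> ?P" "F c = restrict g {..<j}" by (elim imageE) (rule that, auto)
  show ?thesis
  proof (rule that[of c])
    show "c i \<in> K" if "i < j" for i using c(1) that by auto
    show "B (v i) (lincomb j c v) = g i" if "i < j" for i
      using fun_cong[OF c(2), of i] that by (simp add: F_def)
  qed
qed

lemma nonsingular_project:
  assumes "nonsingular j v" "\<And>i. i < j \<Longrightarrow> unital (v i)" "unital u"
  obtains c where "\<And>i. i < j \<Longrightarrow> c i \<in> K" "\<And>i. i < j \<Longrightarrow> B (v i) (u - lincomb j c v) = 0"
proof -
  have "B (v i) u \<in> K" if "i < j" for i using assms(2)[OF that] by blast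
  then obtain c where "\<And>i. i < j \<Longrightarrow> c i \<in> K" "\<And>i. i < j \<Longrightarrow> B (v i) (lincomb j c v) = B (v i) u"
    using gram_solve[OF assms(1,2), of "\<lambda>i. B (v i) u"] by blast
  then show ?thesis using that[of c] by (simp add: B_diff)
qed

lemma finite_coeffs: "finite ({..<j::nat} \<rightarrow>\<^sub>E K)" "card ({..<j::nat} \<rightarrow>\<^sub>E K) = q ^ j"
  by (auto intro: finite_PiE simp: card_PiE q_def)

text \<open>Suppose the orthogonal complement \<open>W\<close> of the tuple contains only isotropic
  vectors. By polarisation \<open>B\<close> vanishes on \<open>W\<close>, and \<open>W\<close> is
  orthogonal to the span as well, so \<open>W\<close> lies in the radical and is zero. Then
  \<open>j < d\<close> vectors span \<open>U\<close>, against its cardinality.\<close>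

lemma nonsingular_direction:
  assumes U: "nd_space d U" and v: "nonsingular j v" "\<And>i. i < j \<Longrightarrow> v i \<in> U" and "j < d"
  obtains w where "w \<in> U" "Q w \<noteq> 0" "\<And>i. i < j \<Longrightarrow> B (v i) w = 0"
proof (rule ccontr)
  note sU = nd_spaceD(1)[OF U]
  assume "\<not> thesis"
  with that have iso: "Q w = 0" if "w \<in> U" "\<And>i. i < j \<Longrightarrow> B (v i) w = 0" for w
    using that by blast
  define W where "W = perp U (v ` {..<j})"
  have W: "w \<in> W \<longleftrightarrow> w \<in> U \<and> (\<forall>i<j. B (v i) w = 0)" for w
    by (auto simp: W_def perp_def B_commute[of w])
  have sW: "subsp W" unfolding W_def by (rule subsp_perp[OF sU])
  have isoW: "Q w = 0" if "w \<in> W" for w using iso that unfolding W by blast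
  have decomp: "\<exists>c. (\<forall>i<j. c i \<in> K) \<and> u - lincomb j c v \<in> W" if u: "u \<in> U" for u
  proof -
    obtain c where "\<And>i. i < j \<Longrightarrow> c i \<in> K" "\<And>i. i < j \<Longrightarrow> B (v i) (u - lincomb j c v) = 0"
      using nonsingular_project[OF v(1) subspD(4)[OF sU v(2)] subspD(4)[OF sU u]] by blast
    moreover have "u - lincomb j c v \<in> U" by (rule subspD(5)[OF sU u lincomb_in[OF sU v(2)]])
    ultimately show ?thesis unfolding W by blast
  qed
  have W0: "w = 0" if w: "w \<in> W" for w
  proof (rule nd_spaceD(4)[OF U])
    show "w \<in> U" using w W by blast
    fix u assume "u \<in> U"
    then obtain c where c: "u - lincomb j c v \<in> W" using decomp by blast
    have "B w (u - lincomb j c v) = 0" using isotropic_imp_zero_form[OF sW isoW w c] .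
    moreover have "B w (lincomb j c v) = 0" by (rule B_lincomb_orth) (use w W in blast)
    ultimately show "B w u = 0" by (simp add: B_diff)
  qed
  have "U \<subseteq> (\<lambda>c. lincomb j c v) ` ({..<j} \<rightarrow>\<^sub>E K)"
  proof
    fix u assume "u \<in> U"
    then obtain c where c: "\<forall>i<j. c i \<in> K" "u - lincomb j c v \<in> W" using decomp by blast
    have "lincomb j c v = lincomb j (restrict c {..<j}) v" by (rule lincomb_cong) auto
    then have "u = lincomb j (restrict c {..<j}) v" using W0[OF c(2)] by simp
    moreover have "restrict c {..<j} \<in> {..<j} \<rightarrow>\<^sub>E K" using c(1) by auto
    ultimately show "u \<in> (\<lambda>c. lincomb j c v) ` ({..<j} \<rightarrow>\<^sub>E K)" by (rule image_eqI)
  qed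
  then have "card U \<le> q ^ j"
    using surj_card_le[OF finite_coeffs(1)[of j]] by (simp add: finite_coeffs(2))
  moreover have "q ^ j < q ^ d" using q_ge_3 assms(4) by simp
  ultimately show False using nd_spaceD(3)[OF U] by simp
qed

text \<open>Replacing the new vector by its component \<open>p\<close> orthogonal to the old ones is
  a unipotent change of basis, after which the Gram matrix is block diagonal with the nonzero new
  entry \<open>Q p\<close>. In the proof \<open>b\<close> holds the old coefficients after this
  change.\<close>

lemma nonsingular_extend:
  assumes "nonsingular j v" "\<And>i. i < j \<Longrightarrow> c i \<in> K" "\<And>i. i < j \<Longrightarrow> unital (v i)" "unital p"
    "\<And>i. i < j \<Longrightarrow> B (v i) p = 0" "Q p \<noteq> 0"
  shows "nonsingular (Suc j) (v(j := lincomb j c v + p))"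
  unfolding nonsingular_def
proof (intro allI impI)
  fix a i
  let ?v = "v(j := lincomb j c v + p)"
  assume a: "\<forall>i<Suc j. a i \<in> K" and orth: "\<forall>i<Suc j. B (?v i) (lincomb (Suc j) a ?v) = 0" and i: "i < Suc j"
  define b where "b l = a l + a j * c l" for l
  have x: "lincomb (Suc j) a ?v = lincomb j b v + a j \<star> p"
    unfolding lincomb_Suc b_def lincomb_add lincomb_scale by (simp add: lincomb_upd sc_add_right add.assoc)
  have b0: "b l = 0" if l: "l < j" for l
  proof (rule nonsingularD[OF assms(1) _ _ l])
    show "b i \<in> K" if "i < j" for i using a assms(2) that by (auto simp: b_def)
    show "B (v i) (lincomb j b v) = 0" if i: "i < j" for i
    proof -
      have "B (?v i) (lincomb (Suc j) a ?v) = 0" using orth i by (meson less_SucI)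
      moreover have "?v i = v i" using i by simp
      ultimately show ?thesis unfolding x using assms(5)[OF i] by (simp add: B_simps)
    qed
  qed
  have cb: "lincomb j b v = 0" unfolding lincomb_def by (rule sum.neutral) (simp add: b0)
  have "B (lincomb j c v + p) (a j \<star> p) = 0" using orth unfolding x cb by auto
  moreover have "B (lincomb j c v) p = 0" using B_lincomb_orth[of j v p c] assms(5) B_commute[of p] by simp
  ultimately have "a j * Q p = 0" by (simp add: B_simps)
  then have aj: "a j = 0" using K_no_zero_div[of "a j" "Q p"] a assms(4,6) by auto
  show "a i = 0"
  proof (cases "i = j")
    case False
    then show ?thesis using b0[of i] i aj by (simp add: b_def)
  qed (simp add: aj)
qed

text \<open>Along a line in a nonisotropic direction \<open>w\<close> orthogonal to the tuple, the
  orthogonal component is \<open>p + t \<star> w\<close>. Its norm is quadratic in \<open>t\<close>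
  with leading coefficient \<open>Q w\<close>, so at most two of the \<open>q\<close> points are
  bad.\<close>

lemma nonsingular_bad_count:
  assumes U: "nd_space d U" and v: "nonsingular j v" "\<And>i. i < j \<Longrightarrow> v i \<in> U" and "j < d"
  shows "q * card {u \<in> U. \<not> nonsingular (Suc j) (v(j := u))} \<le> 2 * q ^ d"
proof -
  note sU = nd_spaceD(1)[OF U]
  obtain w where w: "w \<in> U" "Q w \<noteq> 0" "\<And>i. i < j \<Longrightarrow> B (v i) w = 0" using nonsingular_direction[OF assms] by blast
  have uv: "unital (v i)" if "i < j" for i using subspD(4)[OF sU v(2)[OF that]] .
  have "q * card {u \<in> U. \<not> nonsingular (Suc j) (v(j := u))} \<le> 2 * card U"
  proof (rule line_count[where w = w])
    show "finite U" using nd_spaceD(2)[OF U] .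
    show "s + t \<star> w \<in> U" if "s \<in> U" for s t using subspD(2,3)[OF sU] that w(1) by blast
    fix s assume s: "s \<in> U"
    obtain c where c: "\<And>i. i < j \<Longrightarrow> c i \<in> K" "\<And>i. i < j \<Longrightarrow> B (v i) (s - lincomb j c v) = 0"
      using nonsingular_project[OF v(1) uv subspD(4)[OF sU s]] by blast
    define p where "p = s - lincomb j c v"
    have sp: "s = lincomb j c v + p" and lift_vec: "unital p"
      using subspD(4)[OF sU s] lincomb_unital[of j v c] uv by (auto simp: p_def)
    have "{t \<in> K. \<not> nonsingular (Suc j) (v(j := s + t \<star> w))} \<subseteq> {t \<in> K. Q (p + t \<star> w) = 0}"
    proof clarify
      fix t assume t: "t \<in> K" "\<not> nonsingular (Suc j) (v(j := s + t \<star> w))"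
      show "Q (p + t \<star> w) = 0"
      proof (rule ccontr)
        assume "Q (p + t \<star> w) \<noteq> 0"
        then have "nonsingular (Suc j) (v(j := lincomb j c v + (p + t \<star> w)))"
          using c(2) w(3) lift_vec subspD(4)[OF sU w(1)]
          by (intro nonsingular_extend[OF v(1) c(1) uv]) (auto simp: B_simps p_def[symmetric])
        then show False using t(2) by (simp add: sp add.assoc)
      qed
    qed
    then have "card {t \<in> K. \<not> nonsingular (Suc j) (v(j := s + t \<star> w))} \<le> card {t \<in> K. Q (p + t \<star> w) = 0}"
      by (intro card_mono) auto
    also have "\<dots> \<le> 2" by (rule quadratic_roots[OF subspD(4)[OF sU w(1)] w(2)])
    finally show "card {t \<in> K. \<not> nonsingular (Suc j) (v(j := s + t \<star> w))} \<le> 2" .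
  qed
  then show ?thesis using nd_spaceD(3)[OF U] by simp
qed

text \<open>Distinct coefficient vectors give distinct combinations, and there are
  \<open>q ^ d\<close> of them, as many as elements of \<open>U\<close>.\<close>

lemma nonsingular_basis:
  assumes U: "nd_space d U" and v: "nonsingular d v" "\<And>i. i < d \<Longrightarrow> v i \<in> U" and u: "u \<in> U"
  obtains c where "\<And>i. i < d \<Longrightarrow> c i \<in> K" "u = lincomb d c v"
proof -
  let ?P = "{..<d} \<rightarrow>\<^sub>E K"
  have "inj_on (\<lambda>c. lincomb d c v) ?P"
  proof (rule inj_onI)
    fix c c' assume c: "c \<in> ?P" "c' \<in> ?P" and eq: "lincomb d c v = lincomb d c' v"
    show "c = c'"
    proof (rule PiE_ext[OF c])
      fix i assume "i \<in> {..<d}"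
      then have i: "i < d" by simp
      show "c i = c' i" by (rule nonsingular_inj[OF v(1) _ _ _ i]) (use c eq in auto)
    qed
  qed
  then have "card ((\<lambda>c. lincomb d c v) ` ?P) = q ^ d" by (simp add: card_image finite_coeffs)
  moreover have "(\<lambda>c. lincomb d c v) ` ?P \<subseteq> U"
    by (rule image_subsetI) (rule lincomb_in[OF nd_spaceD(1)[OF U] v(2)])
  ultimately have "(\<lambda>c. lincomb d c v) ` ?P = U"
    using card_subset_eq[OF nd_spaceD(2)[OF U]] nd_spaceD(3)[OF U] by simp
  then obtain c where c: "c \<in> ?P" "u = lincomb d c v" using u by blast
  show ?thesis
  proof (rule that[of c])
    show "c i \<in> K" if "i < d" for i using c(1) that by auto
  qed (rule c(2))
qed

text \<open>Adjoining a nonisotropic \<open>w\<close> orthogonal to all \<open>v i\<close> gives a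
  basis of \<open>U\<close>. In it \<open>n\<close> is a multiple of \<open>w\<close>, because it is
  orthogonal to the nonsingular tuple, and a nonzero multiple of \<open>w\<close> is not
  isotropic.\<close>

lemma anisotropic_line:
  assumes U: "nd_space (Suc k) U" and v: "nonsingular k v" "\<And>i. i < k \<Longrightarrow> v i \<in> U"
    and n: "n \<in> U" "\<And>i. i < k \<Longrightarrow> B (v i) n = 0" "Q n = 0"
  shows "n = 0"
proof -
  note sU = nd_spaceD(1)[OF U]
  obtain w where w: "w \<in> U" "Q w \<noteq> 0" "\<And>i. i < k \<Longrightarrow> B (v i) w = 0"
    using nonsingular_direction[OF U v lessI] by blast
  have "lincomb k (\<lambda>_. 0) v = 0" by (simp add: lincomb_def)
  then have "nonsingular (Suc k) (v(k := w))"
    using nonsingular_extend[OF v(1), of "\<lambda>_. 0" w] w subspD(4)[OF sU] v(2) by simp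
  moreover have "(v(k := w)) i \<in> U" if "i < Suc k" for i using that v(2) w(1) by (auto simp: less_Suc_eq)
  ultimately obtain c where c: "\<And>i. i < Suc k \<Longrightarrow> c i \<in> K" "n = lincomb (Suc k) c (v(k := w))"
    using nonsingular_basis[OF U _ _ n(1), of "v(k := w)"] by blast
  have nn: "n = lincomb k c v + c k \<star> w" using c(2) by (simp add: lincomb_Suc lincomb_upd)
  have c0: "c i = 0" if i: "i < k" for i
  proof (rule nonsingularD[OF v(1) _ _ i])
    show "c i \<in> K" if "i < k" for i using c(1) that by simp
    show "B (v i) (lincomb k c v) = 0" if "i < k" for i
      using n(2)[OF that] w(3)[OF that] unfolding nn by (simp add: B_simps)
  qed
  have "lincomb k c v = 0" unfolding lincomb_def by (rule sum.neutral) (simp add: c0)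
  then have nw: "n = c k \<star> w" using nn by simp
  then have "c k * (c k * Q w) = 0" using n(3) by (simp add: B_simps)
  then have "c k = 0"
    using K_no_zero_div[of "c k" "c k * Q w"] K_no_zero_div[of "c k" "Q w"] c(1)[of k] w(2)
      subspD(4)[OF sU w(1)] by auto
  then show ?thesis using nw by simp
qed

text \<open>The shift by one makes \<open>0, ..., k - 1\<close> the index range of the edges,
  whereas \<open>edge_gram\<close> uses \<open>1, ..., k\<close>; the conversion happens in the
  transfer to a given field.\<close>

definition edges :: "(nat \<Rightarrow> 'v) \<Rightarrow> nat \<Rightarrow> 'v" where
  "edges x i = x (Suc i) - x 0"

definition nonsingular_simplices :: "nat \<Rightarrow> 'v set \<Rightarrow> (nat \<Rightarrow> 'v) set" where
  "nonsingular_simplices k E = {x \<in> {0..k} \<rightarrow>\<^sub>E E. nonsingular k (edges x)}"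

lemma finite_nonsingular_simplices: "finite E \<Longrightarrow> finite (nonsingular_simplices k E)"
  unfolding nonsingular_simplices_def by (rule finite_subset[of _ "{0..k} \<rightarrow>\<^sub>E E"]) (auto intro: finite_PiE)

text \<open>For each simplex at most \<open>2 * q ^ (d - 1)\<close> positions of the next vertex are
  bad. The size condition makes this at most half of \<open>E\<close>.\<close>

lemma nonsingular_simplices_Suc_count:
  assumes U: "nd_space d U" and E: "E \<subseteq> U" and large: "4 * q ^ d \<le> q * card E" and "k < d"
  shows "card E * card (nonsingular_simplices k E) \<le> 2 * card (nonsingular_simplices (Suc k) E)"
proof -
  note sU = nd_spaceD(1)[OF U]
  have fE: "finite E" using finite_subset[OF E nd_spaceD(2)[OF U]] .
  define Y where "Y x = {y \<in> E. nonsingular (Suc k) ((edges x)(k := y - x 0))}" for x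
  have half: "card E \<le> 2 * card (Y x)" if x: "x \<in> nonsingular_simplices k E" for x
  proof -
    have xE: "x i \<in> U" if "i \<le> k" for i using x E that by (auto simp: nonsingular_simplices_def PiE_iff)
    let ?b = "{u \<in> U. \<not> nonsingular (Suc k) ((edges x)(k := u))}"
    have v: "nonsingular k (edges x)" "\<And>i. i < k \<Longrightarrow> edges x i \<in> U"
      using x subspD(5)[OF sU xE xE] by (auto simp: nonsingular_simplices_def edges_def)
    have b: "q * card ?b \<le> 2 * q ^ d" by (rule nonsingular_bad_count[OF U v assms(4)])
    have "card (E - Y x) \<le> card ?b"
    proof (rule card_inj_on_le[where f = "\<lambda>y. y - x 0"])
      show "(\<lambda>y. y - x 0) ` (E - Y x) \<subseteq> ?b"
        using E subspD(5)[OF sU _ xE[of 0]] by (auto simp: Y_def)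
    qed (use nd_spaceD(2)[OF U] in \<open>auto intro: inj_onI\<close>)
    then have "q * card (E - Y x) \<le> 2 * q ^ d" using b by (meson le_trans mult_le_mono2)
    then have "q * (2 * card (E - Y x)) \<le> q * card E" using large by linarith
    then have "2 * card (E - Y x) \<le> card E" by simp
    moreover have "card (E - Y x) = card E - card (Y x)" "card (Y x) \<le> card E"
      using fE by (auto simp: Y_def intro: card_Diff_subset card_mono)
    ultimately show ?thesis by linarith
  qed
  let ?S = "Sigma (nonsingular_simplices k E) Y" and ?f = "\<lambda>(x, y). x(Suc k := y)"
  have inj: "inj_on ?f ?S"
  proof (rule inj_onI, clarify)
    fix x y x' y'
    assume xs: "x \<in> nonsingular_simplices k E" "x' \<in> nonsingular_simplices k E" and eq: "x(Suc k := y) = x'(Suc k := y')"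
    have "y = y'" using fun_cong[OF eq, of "Suc k"] by simp
    moreover have "x = x'"
    proof (rule PiE_ext)
      show "x \<in> {0..k} \<rightarrow>\<^sub>E E" "x' \<in> {0..k} \<rightarrow>\<^sub>E E" using xs by (auto simp: nonsingular_simplices_def)
      fix i assume "i \<in> {0..k}"
      then show "x i = x' i" using fun_cong[OF eq, of i] by simp
    qed
    ultimately show "x = x' \<and> y = y'" by simp
  qed
  have sub: "?f ` ?S \<subseteq> nonsingular_simplices (Suc k) E"
  proof clarify
    fix x y assume x: "x \<in> nonsingular_simplices k E" and y: "y \<in> Y x"
    have "nonsingular (Suc k) (edges (x(Suc k := y)))"
    proof (subst nonsingular_cong)
      show "nonsingular (Suc k) ((edges x)(k := y - x 0))" using y by (simp add: Y_def)
    qed (auto simp: edges_def)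
    moreover have "x(Suc k := y) \<in> {0..Suc k} \<rightarrow>\<^sub>E E"
      using x y by (auto simp: nonsingular_simplices_def Y_def PiE_iff extensional_def)
    ultimately show "x(Suc k := y) \<in> nonsingular_simplices (Suc k) E" by (simp add: nonsingular_simplices_def)
  qed
  have "card E * card (nonsingular_simplices k E) = (\<Sum>x\<in>nonsingular_simplices k E. card E)" by simp
  also have "\<dots> \<le> (\<Sum>x\<in>nonsingular_simplices k E. 2 * card (Y x))" by (rule sum_mono) (rule half)
  also have "\<dots> = 2 * card ?S"
    using fE by (subst card_SigmaI) (auto simp: finite_nonsingular_simplices Y_def sum_distrib_left)
  also have "card ?S = card (?f ` ?S)" by (rule card_image[OF inj, symmetric])
  also have "\<dots> \<le> card (nonsingular_simplices (Suc k) E)" by (rule card_mono[OF finite_nonsingular_simplices[OF fE] sub])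
  finally show ?thesis by simp
qed

lemma nonsingular_simplices_count:
  assumes "nd_space d U" "E \<subseteq> U" "4 * q ^ d \<le> q * card E" "k \<le> d"
  shows "card E ^ Suc k \<le> 2 ^ k * card (nonsingular_simplices k E)"
  using assms(4)
proof (induction k)
  case 0
  have "nonsingular_simplices 0 E = {0..0} \<rightarrow>\<^sub>E E" by (auto simp: nonsingular_simplices_def nonsingular_def)
  then show ?case by (simp add: card_PiE)
next
  case (Suc k)
  have "card E ^ Suc (Suc k) \<le> card E * (2 ^ k * card (nonsingular_simplices k E))" using Suc by simp
  also have "\<dots> = 2 ^ k * (card E * card (nonsingular_simplices k E))" by simp
  also have "\<dots> \<le> 2 ^ k * (2 * card (nonsingular_simplices (Suc k) E))"
    using nonsingular_simplices_Suc_count[OF assms(1-3), of k] Suc.prems by (intro mult_le_mono2) simp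
  finally show ?case by simp
qed

end

section \<open>Pinned tuples\<close>

lemma fibre_squares:
  assumes "finite A" "finite C" "f ` A \<subseteq> C"
  shows "(\<Sum>c\<in>C. (card {x \<in> A. f x = c})\<^sup>2) = card {(x, x') \<in> A \<times> A. f x = f x'}"
proof -
  have "{(x, x') \<in> A \<times> A. f x = f x'} = (\<Union>c\<in>C. {x \<in> A. f x = c} \<times> {x \<in> A. f x = c})"
    using assms(3) by auto
  also have "card \<dots> = (\<Sum>c\<in>C. card ({x \<in> A. f x = c} \<times> {x \<in> A. f x = c}))"
    by (rule card_UN_disjoint) (use assms in auto)
  finally show ?thesis by (simp add: card_cartesian_product power2_eq_square)
qed

lemma fibre_sum:
  assumes "finite A" "finite C" "f ` A \<subseteq> C"
  shows "(\<Sum>c\<in>C. card {x \<in> A. f x = c}) = card A"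
proof -
  have "A = (\<Union>c\<in>C. {x \<in> A. f x = c})" using assms(3) by auto
  also have "card \<dots> = (\<Sum>c\<in>C. card {x \<in> A. f x = c})"
    by (rule card_UN_disjoint) (use assms in auto)
  finally show ?thesis by simp
qed

lemma fibre_variance:
  assumes "finite A" "finite C" "C \<noteq> {}" "f ` A \<subseteq> C"
  shows "(\<Sum>c\<in>C. (real (card {x \<in> A. f x = c}) - card A / card C)\<^sup>2)
    = real (card {(x, x') \<in> A \<times> A. f x = f x'}) - (card A)\<^sup>2 / card C"
proof -
  let ?m = "\<lambda>c. real (card {x \<in> A. f x = c})" and ?\<mu> = "card A / card C :: real"
  have C: "real (card C) \<noteq> 0" using assms by simp
  have s1: "(\<Sum>c\<in>C. ?m c) = card A" using fibre_sum[OF assms(1,2,4)] by (simp flip: of_nat_sum)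
  have s2: "(\<Sum>c\<in>C. (?m c)\<^sup>2) = card {(x, x') \<in> A \<times> A. f x = f x'}"
    using fibre_squares[OF assms(1,2,4)] by (simp flip: of_nat_sum of_nat_power)
  have "(\<Sum>c\<in>C. (?m c - ?\<mu>)\<^sup>2) = (\<Sum>c\<in>C. (?m c)\<^sup>2) - 2 * ?\<mu> * (\<Sum>c\<in>C. ?m c) + card C * ?\<mu>\<^sup>2"
    by (simp add: power2_diff sum.distrib sum_subtractf sum_distrib_left algebra_simps)
  also have "\<dots> = real (card {(x, x') \<in> A \<times> A. f x = f x'}) - (card A)\<^sup>2 / card C"
    unfolding s1 s2 using C by (simp add: field_simps power2_eq_square)
  finally show ?thesis .
qed

text \<open>Cauchy-Schwarz, read off from the nonnegativity of the variance of the fibre sizes: few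
  coincidences force many values.\<close>

lemma card_image_ge:
  assumes "finite A"
  shows "(real (card A))\<^sup>2 \<le> card (f ` A) * real (card {(x, x') \<in> A \<times> A. f x = f x'})"
proof (cases "A = {}")
  case False
  let ?P = "real (card {(x, x') \<in> A \<times> A. f x = f x'})"
  have "0 \<le> (\<Sum>c\<in>f ` A. (real (card {x \<in> A. f x = c}) - card A / card (f ` A))\<^sup>2)"
    by (rule sum_nonneg) simp
  then have "(real (card A))\<^sup>2 / card (f ` A) \<le> ?P"
    using fibre_variance[of A "f ` A" f] assms False by simp
  then show ?thesis using assms False by (simp add: field_simps card_gt_0_iff)
qed simp

lemma sum_fibre_le:
  fixes F :: "'b \<Rightarrow> real"
  assumes "finite P" "finite R" "g ` P \<subseteq> R" "\<And>r. r \<in> R \<Longrightarrow> card {p \<in> P. g p = r} \<le> M"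
    "\<And>r. r \<in> R \<Longrightarrow> F r \<ge> 0"
  shows "(\<Sum>p\<in>P. F (g p)) \<le> M * (\<Sum>r\<in>R. F r)"
proof -
  have "(\<Sum>p\<in>P. F (g p)) = (\<Sum>r\<in>R. \<Sum>p\<in>{p \<in> P. g p = r}. F (g p))"
    by (rule sum.group[OF assms(1-3), symmetric])
  also have "\<dots> = (\<Sum>r\<in>R. real (card {p \<in> P. g p = r}) * F r)"
    by (rule sum.cong) auto
  also have "\<dots> \<le> (\<Sum>r\<in>R. M * F r)"
    by (rule sum_mono) (use assms(4,5) in \<open>auto intro!: mult_right_mono\<close>)
  finally show ?thesis by (simp add: sum_distrib_left)
qed

lemma card_image_le_image:
  assumes "finite T" "\<And>x y. x \<in> T \<Longrightarrow> y \<in> T \<Longrightarrow> g x = g y \<Longrightarrow> f x = f y"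
  shows "card (f ` T) \<le> card (g ` T)"
proof (rule surj_card_le)
  show "finite (g ` T)" using assms(1) by simp
  show "f ` T \<subseteq> (\<lambda>z. f (SOME x. x \<in> T \<and> g x = z)) ` (g ` T)"
  proof clarify
    fix x assume x: "x \<in> T"
    let ?y = "SOME y. y \<in> T \<and> g y = g x"
    have "?y \<in> T \<and> g ?y = g x" by (rule someI[of _ x]) (use x in simp)
    then have "f x = f ?y" using assms(2)[OF x, of ?y] by simp
    then show "f x \<in> (\<lambda>z. f (SOME x. x \<in> T \<and> g x = z)) ` (g ` T)" using x by (intro image_eqI[of _ _ "g x"]) auto
  qed
qed

text \<open>The head of a list is the vertex added last. The result is the triangular array of
  pairwise values, and dropping the head drops exactly one row.\<close>

primrec distance_lists :: "('v \<Rightarrow> 'v \<Rightarrow> 'c) \<Rightarrow> 'v list \<Rightarrow> 'c list list" where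
  "distance_lists D [] = []"
| "distance_lists D (y # xs) = map (D y) xs # distance_lists D xs"

definition tuples :: "'v set \<Rightarrow> nat \<Rightarrow> 'v list set" where
  "tuples E j = {xs. set xs \<subseteq> E \<and> length xs = j}"

lemma tuples_finite: "finite E \<Longrightarrow> finite (tuples E j)" "finite E \<Longrightarrow> card (tuples E j) = card E ^ j"
  by (auto simp: tuples_def finite_lists_length_eq card_lists_length_eq)

definition collisions :: "('v \<Rightarrow> 'v \<Rightarrow> 'c) \<Rightarrow> 'v list set \<Rightarrow> ('v list \<times> 'v \<times> 'v) set" where
  "collisions D S = {(xs, y, y'). y # xs \<in> S \<and> y' # xs \<in> S \<and> map (D y) xs = map (D y') xs}"

lemma collisions_subset: "S \<subseteq> tuples E (Suc j) \<Longrightarrow> collisions D S \<subseteq> tuples E j \<times> E \<times> E"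
  by (force simp: collisions_def tuples_def)

lemma collisions_mono: "S \<subseteq> T \<Longrightarrow> collisions D S \<subseteq> collisions D T"
  by (auto simp: collisions_def)

lemma collisions_finite: "finite E \<Longrightarrow> S \<subseteq> tuples E (Suc j) \<Longrightarrow> finite (collisions D S)"
  by (rule finite_subset[OF collisions_subset]) (auto simp: tuples_finite)

text \<open>By an averaging argument many tails have at least \<open>\<delta> / 2 * N\<close>
  extensions, and by Markov's inequality few tails have too many collisions. For the tails with both
  properties Cauchy-Schwarz yields many distance rows.\<close>

lemma pinned_step:
  fixes q \<delta> A :: real
  assumes "finite E" "E \<noteq> {}" "S \<subseteq> tuples E (Suc j)" "\<delta> * card E ^ Suc j \<le> card S" "\<delta> > 0" "A > 0" "q > 0"
    and col: "card (collisions D S) \<le> A * card E ^ (j + 2) / q ^ j"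
  obtains S' where "S' \<subseteq> tuples E j" "\<delta> / 4 * card E ^ j \<le> card S'"
    "\<And>xs. xs \<in> S' \<Longrightarrow> \<delta> ^ 3 / (16 * A) * q ^ j \<le> card ((\<lambda>y. map (D y) xs) ` {y. y # xs \<in> S})"
proof -
  define N where "N = real (card E)"
  have N: "N > 0" using assms(1,2) by (simp add: N_def card_gt_0_iff)
  define Y where "Y xs = {y. y # xs \<in> S}" for xs
  define Z where "Z xs = {(y, y') \<in> Y xs \<times> Y xs. map (D y) xs = map (D y') xs}" for xs
  have YE: "Y xs \<subseteq> E" for xs using assms(3) by (auto simp: Y_def tuples_def)
  have finY: "finite (Y xs)" for xs using finite_subset[OF YE assms(1)] .
  have finZ: "finite (Z xs)" for xs by (rule finite_subset[of _ "Y xs \<times> Y xs"]) (auto simp: Z_def finY)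
  have YN: "card (Y xs) \<le> N" for xs using card_mono[OF assms(1) YE[of xs]] by (simp add: N_def)
  let ?T = "tuples E j"
  have fT: "finite ?T" "real (card ?T) = N ^ j" using assms(1) by (auto simp: tuples_finite N_def)
  have sumY: "real (card S) = (\<Sum>xs\<in>?T. real (card (Y xs)))"
  proof -
    have S_eq: "S = (\<lambda>(xs, y). y # xs) ` Sigma ?T Y"
    proof (rule subset_antisym; rule subsetI)
      fix zs assume zs: "zs \<in> S"
      then have t: "set zs \<subseteq> E" "length zs = Suc j" using assms(3) by (auto simp: tuples_def)
      then obtain y xs where "zs = y # xs" by (cases zs) auto
      then show "zs \<in> (\<lambda>(xs, y). y # xs) ` Sigma ?T Y"
        using zs t by (auto simp: Y_def tuples_def intro!: image_eqI[of _ _ "(xs, y)"])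
    qed (auto simp: Y_def)
    have "card S = card (Sigma ?T Y)"
      unfolding S_eq by (rule card_image) (auto intro!: inj_onI)
    then show ?thesis using fT finY by (simp add: card_SigmaI)
  qed
  have sumZ: "real (card (collisions D S)) = (\<Sum>xs\<in>?T. real (card (Z xs)))"
  proof -
    have "collisions D S = Sigma ?T Z"
      using collisions_subset[OF assms(3), of D] by (auto simp: collisions_def Z_def Y_def)
    then show ?thesis using fT finZ by (simp add: card_SigmaI)
  qed
  define G where "G = {xs \<in> ?T. \<delta> / 2 * N \<le> card (Y xs)}"
  \<comment> \<open>The threshold is chosen so that at most \<open>\<delta> / 4 * N ^ j\<close>
    tails exceed it, half of the lower bound for \<open>G\<close>. With \<open>\<delta> / 2\<close>
    from \<open>G\<close> it gives the ratio \<open>(\<delta> / 2) ^ 2 / (4 * A / \<delta>) =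
    \<delta> ^ 3 / (16 * A)\<close>.\<close>
  define Bd where "Bd = {xs \<in> ?T. 4 * A / \<delta> * N\<^sup>2 / q ^ j < card (Z xs)}"
  have fG: "finite G" "finite Bd" using fT by (auto simp: G_def Bd_def)
  have "\<delta> * N ^ Suc j \<le> (\<Sum>xs\<in>?T. real (card (Y xs)))" using assms(4) sumY by (simp add: N_def)
  also have "\<dots> \<le> (\<Sum>xs\<in>?T. \<delta> / 2 * N + (if xs \<in> G then N else 0))"
  proof (rule sum_mono)
    fix xs assume xs: "xs \<in> ?T"
    have "0 \<le> \<delta> / 2 * N" using assms(5) N by simp
    then show "real (card (Y xs)) \<le> \<delta> / 2 * N + (if xs \<in> G then N else 0)"
      using YN[of xs] xs by (cases "xs \<in> G") (auto simp: G_def)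
  qed
  also have "\<dots> = \<delta> / 2 * N * N ^ j + card G * N"
  proof -
    have "?T \<inter> {xs. xs \<in> G} = G" by (auto simp: G_def)
    then show ?thesis using fT by (simp add: sum.distrib sum.If_cases)
  qed
  finally have "\<delta> / 2 * N ^ j * N \<le> card G * N" by (simp add: field_simps)
  then have cG: "\<delta> / 2 * N ^ j \<le> card G" using N by simp
  have "card Bd * (4 * A / \<delta> * N\<^sup>2 / q ^ j) = (\<Sum>xs\<in>Bd. 4 * A / \<delta> * N\<^sup>2 / q ^ j)" by simp
  also have "\<dots> \<le> (\<Sum>xs\<in>Bd. real (card (Z xs)))" by (rule sum_mono) (auto simp: Bd_def)
  also have "\<dots> \<le> (\<Sum>xs\<in>?T. real (card (Z xs)))" by (rule sum_mono2) (use fT in \<open>auto simp: Bd_def\<close>)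
  also have "\<dots> \<le> A * N ^ (j + 2) / q ^ j" using col sumZ by (simp add: N_def)
  also have "\<dots> = (\<delta> / 4 * N ^ j) * (4 * A / \<delta> * N\<^sup>2 / q ^ j)"
    using assms(5) by (simp add: power_add power2_eq_square)
  finally have cB: "card Bd \<le> \<delta> / 4 * N ^ j"
    using N assms(5-7) by (simp only: mult_le_cancel_right) (auto simp: zero_less_divide_iff)
  show ?thesis
  proof (rule that[of "G - Bd"])
    show "G - Bd \<subseteq> ?T" by (auto simp: G_def)
    have "real (card G) - card Bd \<le> card (G - Bd)"
      using diff_card_le_card_Diff[OF fG(2), of G] by linarith
    then show "\<delta> / 4 * card E ^ j \<le> card (G - Bd)" using cG cB by (simp add: N_def)
    fix xs assume xs: "xs \<in> G - Bd"
    let ?I = "real (card ((\<lambda>y. map (D y) xs) ` Y xs))"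
    have "(\<delta> / 2 * N)\<^sup>2 \<le> (real (card (Y xs)))\<^sup>2"
      using xs assms(5) N by (intro power_mono) (auto simp: G_def)
    also have "\<dots> \<le> ?I * real (card (Z xs))" unfolding Z_def by (rule card_image_ge[OF finY])
    also have "\<dots> \<le> ?I * (4 * A / \<delta> * N\<^sup>2 / q ^ j)"
      using xs by (intro mult_left_mono) (auto simp: G_def Bd_def not_less)
    finally have "(\<delta> / 2)\<^sup>2 * N\<^sup>2 \<le> ?I * (4 * A / \<delta> / q ^ j) * N\<^sup>2"
      by (simp add: power_mult_distrib power_divide)
    then have "(\<delta> / 2)\<^sup>2 \<le> ?I * (4 * A / \<delta> / q ^ j)" using N by (simp only: mult_le_cancel_right) auto
    then show "\<delta> ^ 3 / (16 * A) * q ^ j \<le> card ((\<lambda>y. map (D y) xs) ` {y. y # xs \<in> S})"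
      unfolding Y_def using assms(5-7) by (simp add: field_simps power2_eq_square power3_eq_cube)
  qed
qed

text \<open>Each step contributes the factor of \<open>pinned_step\<close> and passes on a set of
  tails whose density is only a quarter of the previous one.\<close>

primrec pinned_const :: "nat \<Rightarrow> real \<Rightarrow> real \<Rightarrow> real" where
  "pinned_const 0 \<delta> A = 1"
| "pinned_const (Suc j) \<delta> A = \<delta> ^ 3 / (16 * A) * pinned_const j (\<delta> / 4) A"

lemma pinned_const_pos: "\<delta> > 0 \<Longrightarrow> A > 0 \<Longrightarrow> pinned_const j \<delta> A > 0"
  by (induction j arbitrary: \<delta>) auto

text \<open>Only the top level uses the special structure of \<open>S\<close>. After one step the
  set of tails is merely some set of tuples, and its collisions are bounded by those of all tuples.
  The row lengths \<open>j, j - 1, ..., 1\<close> add up to the exponent.\<close>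

lemma pinned:
  fixes q \<delta> A :: real
  assumes "finite E" "E \<noteq> {}" "A > 0" "q > 0"
    and "S \<subseteq> tuples E (Suc j)" "\<delta> * card E ^ Suc j \<le> card S" "\<delta> > 0"
    and "card (collisions D S) \<le> A * card E ^ (j + 2) / q ^ j"
    and "\<And>i. i < j \<Longrightarrow> card (collisions D (tuples E (Suc i))) \<le> A * card E ^ (i + 2) / q ^ i"
  shows "pinned_const j \<delta> A * q ^ (Suc j choose 2) \<le> card (distance_lists D ` S)"
  using assms(5-9)
proof (induction j arbitrary: S \<delta>)
  case 0
  have "real (card E) > 0" using assms(1,2) by (simp add: card_gt_0_iff)
  then have "\<delta> * card E > 0" using 0 by simp
  then have "card S > 0" using 0 by simp
  then have "distance_lists D ` S \<noteq> {}" "finite (distance_lists D ` S)" by (auto simp: card_gt_0_iff)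
  then have "card (distance_lists D ` S) \<ge> 1" by (simp add: Suc_le_eq card_gt_0_iff)
  moreover have "Suc 0 choose 2 = 0" by (simp add: numeral_2_eq_2)
  ultimately show ?case by (simp only: pinned_const.simps power_0)
next
  case (Suc j)
  obtain S' where S': "S' \<subseteq> tuples E (Suc j)" "\<delta> / 4 * card E ^ Suc j \<le> card S'"
    "\<And>xs. xs \<in> S' \<Longrightarrow> \<delta> ^ 3 / (16 * A) * q ^ Suc j \<le> card ((\<lambda>y. map (D y) xs) ` {y. y # xs \<in> S})"
    using pinned_step[OF assms(1,2) Suc.prems(1-3) assms(3,4) Suc.prems(4)] by blast
  have finS: "finite S" "finite S'"
    using finite_subset[OF Suc.prems(1)] finite_subset[OF S'(1)] tuples_finite(1)[OF assms(1)] by blast+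
  have "card (collisions D S') \<le> card (collisions D (tuples E (Suc j)))"
    by (rule card_mono[OF collisions_finite[OF assms(1)] collisions_mono[OF S'(1)]]) auto
  then have "card (collisions D S') \<le> A * card E ^ (j + 2) / q ^ j"
    using Suc.prems(5)[of j] by linarith
  then have IH: "pinned_const j (\<delta> / 4) A * q ^ (Suc j choose 2) \<le> card (distance_lists D ` S')"
    using Suc.IH[OF S'(1,2)] Suc.prems(3,5) by simp
  \<comment> \<open>One tail is fixed for each distance array \<open>g\<close>. Rows above different
    tails with the same array may coincide, but rows above one fixed tail give distinct
    arrays.\<close>
  define r where "r g = (SOME xs. xs \<in> S' \<and> distance_lists D xs = g)" for g
  have r: "r g \<in> S'" "distance_lists D (r g) = g" if "g \<in> distance_lists D ` S'" for g
  proof -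
    have "r g \<in> S' \<and> distance_lists D (r g) = g" unfolding r_def by (rule someI_ex) (use that in auto)
    then show "r g \<in> S'" "distance_lists D (r g) = g" by auto
  qed
  define R where "R g = (\<lambda>y. map (D y) (r g)) ` {y. y # r g \<in> S}" for g
  have finR: "finite (R g)" for g
  proof -
    have "finite {y. y # r g \<in> S}" by (rule finite_subset[of _ "hd ` S"]) (use finS in force)+
    then show ?thesis by (simp add: R_def)
  qed
  have "(\<delta> ^ 3 / (16 * A) * q ^ Suc j) * (pinned_const j (\<delta> / 4) A * q ^ (Suc j choose 2))
      \<le> (\<delta> ^ 3 / (16 * A) * q ^ Suc j) * card (distance_lists D ` S')"
    using IH Suc.prems(3) assms(3,4) by (intro mult_left_mono) auto
  also have "\<dots> = (\<Sum>g\<in>distance_lists D ` S'. \<delta> ^ 3 / (16 * A) * q ^ Suc j)" by simp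
  also have "\<dots> \<le> (\<Sum>g\<in>distance_lists D ` S'. real (card (R g)))"
    unfolding R_def by (rule sum_mono) (rule S'(3)[OF r(1)])
  also have "\<dots> = card (Sigma (distance_lists D ` S') R)"
    using finS finR by (simp add: card_SigmaI)
  also have "\<dots> = card ((\<lambda>(g, a). a # g) ` Sigma (distance_lists D ` S') R)"
    by (subst card_image) (auto intro!: inj_onI)
  also have "\<dots> \<le> card (distance_lists D ` S)"
  proof (rule of_nat_mono, rule card_mono)
    show "finite (distance_lists D ` S)" using finS by simp
    show "(\<lambda>(g, a). a # g) ` Sigma (distance_lists D ` S') R \<subseteq> distance_lists D ` S"
    proof clarify
      fix xs a assume xs: "xs \<in> S'" and a: "a \<in> R (distance_lists D xs)"
      then obtain y where y: "y # r (distance_lists D xs) \<in> S" "a = map (D y) (r (distance_lists D xs))" by (auto simp: R_def)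
      have "distance_lists D (y # r (distance_lists D xs)) = a # distance_lists D xs" using r(2)[of "distance_lists D xs"] xs y(2) by simp
      then show "a # distance_lists D xs \<in> distance_lists D ` S" using y(1) by (metis imageI)
    qed
  qed
  finally show ?case
    by (simp add: power_add mult_ac numeral_2_eq_2 binomial_Suc_Suc)
qed

section \<open>Bisecting hyperplanes\<close>

text \<open>Beyond \<open>2 * \<mu>\<close> one has \<open>h \<le> 2 * (h - \<mu>)\<close>, so two
  factors are charged to the deviation and the remaining ones to the trivial bound \<open>N\<close>.
  A variance bound thus controls all higher moments.\<close>

lemma power_le_deviation:
  fixes h \<mu> N :: real
  assumes "0 \<le> h" "h \<le> N" "0 < \<mu>"
  shows "h ^ (i + 2) \<le> 2 ^ (i + 2) * \<mu> ^ (i + 2) + 4 * (h - \<mu>)\<^sup>2 * N ^ i"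
proof (cases "h \<le> 2 * \<mu>")
  case True
  then have "h ^ (i + 2) \<le> (2 * \<mu>) ^ (i + 2)" using assms by (intro power_mono) auto
  also have "\<dots> = 2 ^ (i + 2) * \<mu> ^ (i + 2)" by (rule power_mult_distrib)
  finally show ?thesis using assms by (simp add: add_increasing2)
next
  case False
  have "h ^ (i + 2) = h\<^sup>2 * h ^ i" by (simp add: power_add power2_eq_square)
  also have "\<dots> \<le> (2 * (h - \<mu>))\<^sup>2 * N ^ i"
    using assms False by (intro mult_mono power_mono) auto
  also have "\<dots> = 4 * (h - \<mu>)\<^sup>2 * N ^ i" by (simp add: power2_eq_square algebra_simps)
  finally show ?thesis using assms by (simp add: add_increasing)
qed

context form_space
begin

definition gram :: "nat \<Rightarrow> (nat \<Rightarrow> 'v) \<Rightarrow> nat \<times> nat \<Rightarrow> 'a" where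
  "gram k x = (\<lambda>(i, l)\<in>{..<k} \<times> {..<k}. B (edges x i) (edges x l))"

lemma gramD: "gram k x = gram k x' \<Longrightarrow> i < k \<Longrightarrow> l < k \<Longrightarrow> B (edges x i) (edges x l) = B (edges x' i) (edges x' l)"
proof -
  assume a: "gram k x = gram k x'" "i < k" "l < k"
  have "gram k x (i, l) = gram k x' (i, l)" by (simp only: a(1))
  then show ?thesis using a(2,3) by (simp add: gram_def)
qed

lemma gram_distance:
  assumes "gram k x = gram k x'" "i \<le> k" "l \<le> k"
  shows "Q (x i - x l) = Q (x' i - x' l)"
proof -
  \<comment> \<open>\<open>f z i\<close> is the position of vertex \<open>i\<close> relative to
    vertex \<open>0\<close>, so every difference of vertices becomes a difference of edges or of an
    edge and zero.\<close>
  define f where "f z i = (case i of 0 \<Rightarrow> 0 | Suc m \<Rightarrow> edges z m)" for z :: "nat \<Rightarrow> 'v" and i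
  have f: "z i - z l = f z i - f z l" for z i l
    by (auto simp: f_def edges_def split: nat.splits)
  have g: "B (f x i) (f x l) = B (f x' i) (f x' l)" if "i \<le> k" "l \<le> k" for i l
    using gramD[OF assms(1)] that by (auto simp: f_def split: nat.splits)
  have "Q (f x i - f x l) = Q (f x' i - f x' l)"
    unfolding Q_diff using g[OF assms(2,2)] g[OF assms(3,3)] g[OF assms(2,3)] by simp
  then show ?thesis by (simp only: f[of x i l] f[of x' i l])
qed

definition half :: 'a where "half = (SOME h. h \<in> K \<and> h + h = e)"

lemma half: "half \<in> K" "half + half = e" "half \<noteq> 0"
proof -
  have "half \<in> K \<and> half + half = e" unfolding half_def by (rule someI_ex) (use K_half in blast)
  then show "half \<in> K" "half + half = e" "half \<noteq> 0" using e_nz by auto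
qed

lemma half_cancel: "a \<in> K \<Longrightarrow> half * (a + a) = a"
  by (metis half(2) K_unit(1) distrib_left distrib_right)

lemma half_double_iff: assumes "a \<in> K" "b \<in> K" shows "a + a = b \<longleftrightarrow> a = half * b"
proof
  show "a + a = b \<Longrightarrow> a = half * b" using half_cancel[OF assms(1)] by metis
  have "half * b + half * b = b" using K_unit(1)[OF assms(2)] by (metis half(2) distrib_right)
  then show "a = half * b \<Longrightarrow> a + a = b" by metis
qed

text \<open>The terms \<open>Q x\<close> cancel, which leaves a linear equation in \<open>x\<close>
  with normal vector \<open>y' - y\<close>; dividing it by two uses \<open>half\<close>.\<close>

lemma bisector_iff:
  assumes "unital x" "unital y" "unital y'"
  shows "Q (x - y) = Q (x - y') \<longleftrightarrow> B (y' - y) x = half * (Q y' - Q y)"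
proof -
  have "Q (x - y) = Q (x - y') \<longleftrightarrow> B (y' - y) x + B (y' - y) x = Q y' - Q y"
  proof -
    have eq: "B (y' - y) x = B x y' - B x y" by (subst B_commute) (rule B_diff)
    have "Q (x - y) - Q (x - y') = (B (y' - y) x + B (y' - y) x) - (Q y' - Q y)"
      unfolding Q_diff eq by (simp add: algebra_simps)
    then show ?thesis
      by (simp only: eq_iff_diff_eq_0[of "Q (x - y)"] eq_iff_diff_eq_0[of "B (y' - y) x + B (y' - y) x"])
  qed
  also have "\<dots> \<longleftrightarrow> B (y' - y) x = half * (Q y' - Q y)"
    by (rule half_double_iff) (use assms in auto)
  finally show ?thesis .
qed

text \<open>Each pair \<open>x \<noteq> y\<close> contributes the expected
  \<open>q ^ (d - 1)\<close>, and the subtracted term absorbs all of these. Only the diagonal pairs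
  remain, with at most \<open>q ^ d\<close> each.\<close>

lemma sum_orthogonal_count:
  assumes U: "nd_space d U" and E: "E \<subseteq> U" and fin: "finite E"
    and P: "\<And>x. x \<in> E \<Longrightarrow> card {u \<in> U. P x x u} \<le> q ^ d"
      "\<And>x y. x \<in> E \<Longrightarrow> y \<in> E \<Longrightarrow> x \<noteq> y \<Longrightarrow> q * card {u \<in> U. P x y u} = q ^ d"
  shows "(\<Sum>u\<in>U. real (card {(x, y) \<in> E \<times> E. P x y u}) - (card E)\<^sup>2 / q) \<le> card E * real q ^ d"
proof -
  let ?N = "real (card E)"
  have fU: "finite U" using nd_spaceD(2)[OF U] .
  have "(\<Sum>u\<in>U. card {(x, y) \<in> E \<times> E. P x y u}) = (\<Sum>u\<in>U. \<Sum>p\<in>E \<times> E. if P (fst p) (snd p) u then 1 else 0)"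
    using fin by (simp add: sum.If_cases Int_def case_prod_unfold mem_Times_iff conj_ac)
  also have "\<dots> = (\<Sum>p\<in>E \<times> E. \<Sum>u\<in>U. if P (fst p) (snd p) u then 1 else 0)" by (rule sum.swap)
  also have "\<dots> = (\<Sum>p\<in>E \<times> E. card {u \<in> U. P (fst p) (snd p) u})"
    using fU by (simp add: sum.If_cases Int_def)
  finally have eq: "(\<Sum>u\<in>U. card {(x, y) \<in> E \<times> E. P x y u}) = (\<Sum>p\<in>E \<times> E. card {u \<in> U. P (fst p) (snd p) u})" .
  have "(\<Sum>p\<in>E \<times> E. real (card {u \<in> U. P (fst p) (snd p) u}))
      \<le> (\<Sum>p\<in>E \<times> E. real q ^ d / q + (if fst p = snd p then real q ^ d else 0))"
  proof (rule sum_mono)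
    fix p assume p: "p \<in> E \<times> E"
    show "real (card {u \<in> U. P (fst p) (snd p) u}) \<le> real q ^ d / q + (if fst p = snd p then real q ^ d else 0)"
    proof (cases "fst p = snd p")
      case True
      have "real (card {u \<in> U. P (fst p) (snd p) u}) \<le> real q ^ d"
        using P(1)[of "fst p"] p True by (auto simp flip: of_nat_power)
      then show ?thesis using True by (simp add: add_increasing)
    next
      case False
      have "real q * card {u \<in> U. P (fst p) (snd p) u} = real q ^ d"
        using P(2)[of "fst p" "snd p"] p False by (auto simp flip: of_nat_power of_nat_mult)
      then show ?thesis using False by (simp add: field_simps)
    qed
  qed
  also have "\<dots> = ?N\<^sup>2 * (real q ^ d / q) + (\<Sum>p\<in>E \<times> E. if fst p = snd p then real q ^ d else 0)"
    by (simp add: sum.distrib card_cartesian_product power2_eq_square)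
  also have "(\<Sum>p\<in>E \<times> E. if fst p = snd p then real q ^ d else 0) = ?N * real q ^ d"
  proof -
    have "(\<Sum>p\<in>E \<times> E. if fst p = snd p then real q ^ d else 0) = (\<Sum>p\<in>(\<lambda>x. (x, x)) ` E. real q ^ d)"
      using fin by (intro sum.mono_neutral_cong_right) auto
    then show ?thesis by (simp add: card_image inj_on_def)
  qed
  finally have le: "real (\<Sum>u\<in>U. card {(x, y) \<in> E \<times> E. P x y u}) \<le> ?N\<^sup>2 * (real q ^ d / q) + ?N * real q ^ d"
    unfolding eq by simp
  have const: "(\<Sum>u\<in>U. (card E)\<^sup>2 / real q) = ?N\<^sup>2 * (real q ^ d / q)"
    by (simp add: nd_spaceD(3)[OF U])
  show ?thesis unfolding sum_subtractf const using le by simp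
qed

definition hyperplane_count :: "'v set \<Rightarrow> 'v \<Rightarrow> 'a \<Rightarrow> nat" where
  "hyperplane_count E n c = card {x \<in> E. B n x = c}"

text \<open>By \<open>fibre_variance\<close> the inner sum is the excess number of pairs in
  \<open>E\<close> whose difference is orthogonal to \<open>n\<close>. A fixed nonzero difference is
  orthogonal to exactly \<open>q ^ (d - 1)\<close> vectors \<open>n\<close>.\<close>

lemma hyperplane_variance:
  assumes U: "nd_space d U" and E: "E \<subseteq> U"
  shows "(\<Sum>n\<in>U. \<Sum>c\<in>K. (real (hyperplane_count E n c) - card E / q)\<^sup>2) \<le> card E * real q ^ d"
proof -
  have fE: "finite E" using finite_subset[OF E nd_spaceD(2)[OF U]] .
  have EU: "\<And>x. x \<in> E \<Longrightarrow> unital x" using E subspD(4)[OF nd_spaceD(1)[OF U]] by blast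
  have "(\<Sum>c\<in>K. (real (hyperplane_count E n c) - card E / q)\<^sup>2)
      = real (card {(x, y) \<in> E \<times> E. B n x = B n y}) - (card E)\<^sup>2 / q" for n
    unfolding hyperplane_count_def q_def by (rule fibre_variance[OF fE]) (use EU in auto)
  moreover have "(\<Sum>n\<in>U. real (card {(x, y) \<in> E \<times> E. B n x = B n y}) - (card E)\<^sup>2 / q) \<le> card E * real q ^ d"
  proof (rule sum_orthogonal_count[OF U E fE])
    fix x y assume xy: "x \<in> E" "y \<in> E" "x \<noteq> y"
    have "B (x - y) n = B n x - B n y" for n by (subst B_commute) (rule B_diff)
    then have "{n \<in> U. B n x = B n y} = {n \<in> U. B (x - y) n = 0}" by simp
    then show "q * card {n \<in> U. B n x = B n y} = q ^ d"
      using card_hyperplane[OF U, of "x - y" 0] xy E subspD(5)[OF nd_spaceD(1)[OF U], of x y] by auto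
  qed (use nd_spaceD(3)[OF U] in simp)
  ultimately show ?thesis by simp
qed

definition bisector_count :: "'v set \<Rightarrow> 'v \<Rightarrow> 'v \<Rightarrow> nat" where
  "bisector_count E y y' = card {x \<in> E. Q (x - y) = Q (x - y')}"

text \<open>\<open>power_le_deviation\<close> starts at exponent two, so the first moment is treated
  by itself: for each \<open>x \<in> E\<close> the pairs equidistant from \<open>x\<close> are
  counted by the fibres of the distance to \<open>x\<close>.\<close>

lemma bisector_first_moment:
  assumes U: "nd_space d U" and E: "E \<subseteq> U"
  shows "(\<Sum>(y, y')\<in>E \<times> E. real (bisector_count E y y')) \<le> card E ^ 3 / q + card E * real q ^ d"
proof -
  let ?N = "real (card E)"
  have fE: "finite E" using finite_subset[OF E nd_spaceD(2)[OF U]] .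
  have EU: "\<And>x. x \<in> U \<Longrightarrow> unital x" using subspD(4)[OF nd_spaceD(1)[OF U]] by blast
  let ?F = "\<lambda>x. real (card {(y, y') \<in> E \<times> E. Q (x - y) = Q (x - y')}) - (card E)\<^sup>2 / q"
  have "(\<Sum>(y, y')\<in>E \<times> E. bisector_count E y y') = (\<Sum>p\<in>E \<times> E. \<Sum>x\<in>E. if Q (x - fst p) = Q (x - snd p) then 1 else 0)"
    using fE by (simp add: bisector_count_def case_prod_unfold sum.If_cases Int_def)
  also have "\<dots> = (\<Sum>x\<in>E. \<Sum>p\<in>E \<times> E. if Q (x - fst p) = Q (x - snd p) then 1 else 0)" by (rule sum.swap)
  also have "\<dots> = (\<Sum>x\<in>E. card {(y, y') \<in> E \<times> E. Q (x - y) = Q (x - y')})"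
    using fE by (simp add: sum.If_cases Int_def case_prod_unfold mem_Times_iff conj_ac)
  finally have "real (\<Sum>(y, y')\<in>E \<times> E. bisector_count E y y') = (\<Sum>x\<in>E. real (card {(y, y') \<in> E \<times> E. Q (x - y) = Q (x - y')}))"
    by simp
  then have eq: "(\<Sum>(y, y')\<in>E \<times> E. real (bisector_count E y y')) = (\<Sum>x\<in>E. ?F x) + ?N * (?N\<^sup>2 / q)"
    by (simp add: sum_subtractf case_prod_unfold)
  \<comment> \<open>Each \<open>?F x\<close> is a variance and so nonnegative. Enlarging the range
    to all of \<open>U\<close> makes the exact count of points on a bisecting hyperplane
    available.\<close>
  have "(\<Sum>x\<in>E. ?F x) \<le> (\<Sum>x\<in>U. ?F x)"
  proof (rule sum_mono2[OF nd_spaceD(2)[OF U] E])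
    fix x assume "x \<in> U - E"
    then have "0 \<le> (\<Sum>c\<in>K. (real (card {y \<in> E. Q (x - y) = c}) - card E / card K)\<^sup>2)" by (intro sum_nonneg) auto
    also have "\<dots> = ?F x"
      unfolding q_def by (rule fibre_variance[OF fE]) (use EU E \<open>x \<in> U - E\<close> in auto)
    finally show "0 \<le> ?F x" .
  qed
  also have "\<dots> \<le> card E * real q ^ d"
  proof (rule sum_orthogonal_count[OF U E fE, where P = "\<lambda>y y' x. Q (x - y) = Q (x - y')"])
    fix y y' assume y: "y \<in> E" "y' \<in> E" "y \<noteq> y'"
    have "unital y" "unital y'" using EU E y by blast+
    then have "Q (x - y) = Q (x - y') \<longleftrightarrow> B (y' - y) x = half * (Q y' - Q y)" if "x \<in> U" for x
      using EU[OF that] by (intro bisector_iff)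
    then have "{x \<in> U. Q (x - y) = Q (x - y')} = {x \<in> U. B (y' - y) x = half * (Q y' - Q y)}" by blast
    moreover have "y' - y \<in> U" "y' - y \<noteq> 0" "half * (Q y' - Q y) \<in> K"
      using y E subspD(5)[OF nd_spaceD(1)[OF U], of y' y] half(1) by auto
    ultimately show "q * card {x \<in> U. Q (x - y) = Q (x - y')} = q ^ d"
      using card_hyperplane[OF U, of "y' - y" "half * (Q y' - Q y)"] by simp
  qed (use nd_spaceD(3)[OF U] in simp)
  finally have "(\<Sum>x\<in>E. ?F x) \<le> card E * real q ^ d" .
  then show ?thesis unfolding eq by (simp add: power3_eq_cube power2_eq_square)
qed

lemma bisector_count_eq_hyperplane_count:
  assumes "E \<subseteq> U" "subsp U" "y \<in> E" "y' \<in> E"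
  shows "bisector_count E y y' = hyperplane_count E (y' - y) (half * (Q y' - Q y))"
proof -
  have u: "unital x" if "x \<in> E" for x using that subspD(4)[OF assms(2)] assms(1) by blast
  have "Q (x - y) = Q (x - y') \<longleftrightarrow> B (y' - y) x = half * (Q y' - Q y)" if "x \<in> E" for x
    by (rule bisector_iff[OF u[OF that] u[OF assms(3)] u[OF assms(4)]])
  then have "{x \<in> E. Q (x - y) = Q (x - y')} = {x \<in> E. B (y' - y) x = half * (Q y' - Q y)}" by blast
  then show ?thesis by (simp add: bisector_count_def hyperplane_count_def)
qed

text \<open>A pair \<open>(y, y')\<close> is sent to the normal and the constant of its bisecting
  hyperplane. As \<open>y\<close> and the normal determine \<open>y'\<close>, at most
  \<open>card E\<close> pairs share a hyperplane equation.\<close>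

lemma bisector_variance:
  assumes U: "nd_space d U" and E: "E \<subseteq> U"
  shows "(\<Sum>(y, y')\<in>E \<times> E. (real (bisector_count E y y') - card E / q)\<^sup>2) \<le> (card E)\<^sup>2 * real q ^ d"
proof -
  note sU = nd_spaceD(1)[OF U]
  have fE: "finite E" using finite_subset[OF E nd_spaceD(2)[OF U]] .
  let ?g = "\<lambda>(y, y'). (y' - y, half * (Q y' - Q y))"
  let ?F = "\<lambda>(n, c). (real (hyperplane_count E n c) - card E / q)\<^sup>2"
  have "(\<Sum>(y, y')\<in>E \<times> E. (real (bisector_count E y y') - card E / q)\<^sup>2) = (\<Sum>p\<in>E \<times> E. ?F (?g p))"
    by (rule sum.cong) (auto simp: bisector_count_eq_hyperplane_count[OF E sU])
  also have "\<dots> \<le> card E * (\<Sum>r\<in>U \<times> K. ?F r)"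
  proof (rule sum_fibre_le)
    show "?g ` (E \<times> E) \<subseteq> U \<times> K" using E subspD(5)[OF sU] half(1) by auto
    fix r assume "r \<in> U \<times> K"
    have "card {p \<in> E \<times> E. ?g p = r} \<le> card E"
    proof (rule card_inj_on_le[where f = fst])
      show "inj_on fst {p \<in> E \<times> E. ?g p = r}" by (auto intro!: inj_onI)
    qed (use fE in auto)
    then show "card {p \<in> E \<times> E. ?g p = r} \<le> card E" .
  qed (use fE nd_spaceD(2)[OF U] in auto)
  also have "\<dots> = card E * (\<Sum>n\<in>U. \<Sum>c\<in>K. (real (hyperplane_count E n c) - card E / q)\<^sup>2)"
    by (simp add: sum.cartesian_product)
  also have "\<dots> \<le> card E * (card E * real q ^ d)"
    by (rule mult_left_mono[OF hyperplane_variance[OF U E]]) simp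
  finally show ?thesis by (simp add: power2_eq_square mult.assoc)
qed

text \<open>
  The gain of \<open>q - 1\<close> comes from counting each pair with all multiples of its normal vector \<open>y' - y\<close>: a
  multiple still determines \<open>y'\<close> from \<open>y\<close> when the normal is nonisotropic.
\<close>

lemma nonisotropic_bisector_variance:
  assumes U: "nd_space d U" and E: "E \<subseteq> U"
  shows "(real q - 1) * (\<Sum>(y, y')\<in>{(y, y') \<in> E \<times> E. Q (y' - y) \<noteq> 0}. (real (bisector_count E y y') - card E / q)\<^sup>2)
    \<le> (card E)\<^sup>2 * real q ^ d"
proof -
  note sU = nd_spaceD(1)[OF U]
  have fE: "finite E" using finite_subset[OF E nd_spaceD(2)[OF U]] .
  have EU: "\<And>x. x \<in> E \<Longrightarrow> unital x" using E subspD(4)[OF sU] by blast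
  let ?P = "{(y, y') \<in> E \<times> E. Q (y' - y) \<noteq> 0}"
  let ?g = "\<lambda>(s, y, y'). (s \<star> (y' - y), s * (half * (Q y' - Q y)))"
  let ?F = "\<lambda>(n, c). (real (hyperplane_count E n c) - card E / q)\<^sup>2"
  have fP: "finite ?P" by (rule finite_subset[of _ "E \<times> E"]) (use fE in auto)
  have scale: "hyperplane_count E (s \<star> n) (s * c) = hyperplane_count E n c" if "s \<in> K - {0}" "unital n" "c \<in> K" for s n c
  proof -
    have "s * B n x = s * c \<longleftrightarrow> B n x = c" for x
    proof -
      have "s * (B n x - c) = 0 \<longleftrightarrow> B n x - c = 0" using K_no_zero_div[of s "B n x - c"] that by auto
      then show ?thesis by (simp add: right_diff_distrib)
    qed
    then show ?thesis by (simp add: hyperplane_count_def B_simps)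
  qed
  have "card (K - {0}) = q - 1" by (simp add: q_def card_Diff_singleton)
  then have cq: "real (card (K - {0})) = real q - 1" using q_pos by (simp add: of_nat_diff Suc_leI)
  have "(real q - 1) * (\<Sum>(y, y')\<in>?P. (real (bisector_count E y y') - card E / q)\<^sup>2)
      = (\<Sum>s\<in>K - {0}. \<Sum>p\<in>?P. ?F (?g (s, p)))"
  proof -
    have "(\<Sum>p\<in>?P. ?F (?g (s, p))) = (\<Sum>(y, y')\<in>?P. (real (bisector_count E y y') - card E / q)\<^sup>2)" if "s \<in> K - {0}" for s
    proof (rule sum.cong[OF refl])
      fix p assume "p \<in> ?P"
      then obtain y y' where p: "p = (y, y')" "y \<in> E" "y' \<in> E" by auto
      have "hyperplane_count E (s \<star> (y' - y)) (s * (half * (Q y' - Q y))) = bisector_count E y y'"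
        unfolding bisector_count_eq_hyperplane_count[OF E sU p(2,3)] by (rule scale[OF that]) (use EU p half(1) in auto)
      then show "?F (?g (s, p)) = (case p of (y, y') \<Rightarrow> (real (bisector_count E y y') - card E / q)\<^sup>2)" by (simp add: p(1))
    qed
    then show ?thesis using cq by simp
  qed
  also have "\<dots> = (\<Sum>p\<in>(K - {0}) \<times> ?P. ?F (?g p))"
    unfolding sum.cartesian_product by (rule sum.cong) auto
  also have "\<dots> \<le> card E * (\<Sum>r\<in>U \<times> K. ?F r)"
  proof (rule sum_fibre_le)
    have "y' - y \<in> U" if "y \<in> E" "y' \<in> E" for y y' using that E subspD(5)[OF sU] by blast
    then show "?g ` ((K - {0}) \<times> ?P) \<subseteq> U \<times> K" using subspD(3)[OF sU] by auto
    fix r assume "r \<in> U \<times> K"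
    have "card {p \<in> (K - {0}) \<times> ?P. ?g p = r} \<le> card E"
    proof (rule card_inj_on_le[where f = "\<lambda>p. fst (snd p)"])
      show "inj_on (\<lambda>p. fst (snd p)) {p \<in> (K - {0}) \<times> ?P. ?g p = r}"
      proof (rule inj_onI)
        fix p p' assume a: "p \<in> {p \<in> (K - {0}) \<times> ?P. ?g p = r}" "p' \<in> {p \<in> (K - {0}) \<times> ?P. ?g p = r}"
          "fst (snd p) = fst (snd p')"
        obtain s1 y y1 where p1: "p = (s1, y, y1)" by (rule prod_cases3)
        obtain s2 z y2 where p2: "p' = (s2, z, y2)" by (rule prod_cases3)
        have "z = y" using a(3) unfolding p1 p2 by simp
        have p: "p = (s1, y, y1)" "p' = (s2, y, y2)" using p1 p2 \<open>z = y\<close> by simp_all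
        have s: "s1 \<in> K" "s1 \<noteq> 0" "s2 \<in> K" "s2 \<noteq> 0" and y: "y \<in> E" "y1 \<in> E" "y2 \<in> E"
          and Qn: "Q (y1 - y) \<noteq> 0"
          using a(1,2) unfolding p by simp_all
        have "?g p = ?g p'" using a(1,2) by simp
        then have n: "s1 \<star> (y1 - y) = s2 \<star> (y2 - y)"
          and c: "s1 * (half * (Q y1 - Q y)) = s2 * (half * (Q y2 - Q y))" unfolding p by simp_all
        define n1 n2 where "n1 = y1 - y" and "n2 = y2 - y"
        have u: "unital n1" "unital n2" using y EU by (auto simp: n1_def n2_def)
        \<comment> \<open>Comparing constants for fixed \<open>y\<close> and fixed scaled normal
          gives \<open>s1 * Q n1 = s2 * Q n2\<close>. Comparing the norms of the scaled normals
          gives the same equation with an extra factor \<open>s1\<close>, respectively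
          \<open>s2\<close>. Since \<open>Q n1 \<noteq> 0\<close>, the scalars agree.\<close>
        have d1: "half * (Q y1 - Q y) = B y n1 + half * Q n1"
        proof -
          have "Q y1 - Q y = (B y n1 + B y n1) + Q n1"
            by (simp add: n1_def B_simps B_commute[of y1 y] algebra_simps)
          moreover have "half * (B y n1 + B y n1) = B y n1" by (rule half_cancel) (rule B_in_K(2)[OF u(1)])
          ultimately show ?thesis by (simp only: distrib_left[of half _ "Q n1"])
        qed
        have d2: "half * (Q y2 - Q y) = B y n2 + half * Q n2"
        proof -
          have "Q y2 - Q y = (B y n2 + B y n2) + Q n2"
            by (simp add: n2_def B_simps B_commute[of y2 y] algebra_simps)
          moreover have "half * (B y n2 + B y n2) = B y n2" by (rule half_cancel) (rule B_in_K(2)[OF u(2)])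
          ultimately show ?thesis by (simp only: distrib_left[of half _ "Q n2"])
        qed
        have "B y (s1 \<star> n1) = B y (s2 \<star> n2)" using n by (simp add: n1_def n2_def)
        then have "s1 * B y n1 = s2 * B y n2" by (simp add: B_simps)
        with c have "s1 * (half * Q n1) = s2 * (half * Q n2)" unfolding d1 d2 by (simp add: distrib_left)
        then have "half * (s1 * Q n1 - s2 * Q n2) = 0" by (simp add: algebra_simps)
        then have e1: "s1 * Q n1 = s2 * Q n2"
          using K_no_zero_div[of half "s1 * Q n1 - s2 * Q n2"] half s by auto
        have "Q (s1 \<star> n1) = Q (s2 \<star> n2)" using n by (simp add: n1_def n2_def)
        then have "s1 * (s1 * Q n1) = s2 * (s2 * Q n2)" by (simp add: B_simps)
        then have "(s1 - s2) * (s1 * Q n1) = 0" unfolding left_diff_distrib using e1 by simp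
        moreover have "s1 * Q n1 \<noteq> 0" using K_no_zero_div[of s1 "Q n1"] s Qn u by (auto simp: n1_def)
        ultimately have "s1 = s2" using K_no_zero_div[of "s1 - s2" "s1 * Q n1"] s by auto
        moreover have "n1 = n2"
        proof -
          have "s1 \<star> (n1 - n2) = 0" using n \<open>s1 = s2\<close> by (simp add: n1_def n2_def sc_simps)
          then show ?thesis using sc_eq_0[of s1 "n1 - n2"] s u by auto
        qed
        ultimately show "p = p'" using p by (simp add: n1_def n2_def)
      qed
    qed (use fE in auto)
    then show "card {p \<in> (K - {0}) \<times> ?P. ?g p = r} \<le> card E" .
  qed (use fP nd_spaceD(2)[OF U] in auto)
  also have "\<dots> = card E * (\<Sum>n\<in>U. \<Sum>c\<in>K. (real (hyperplane_count E n c) - card E / q)\<^sup>2)"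
    by (simp add: sum.cartesian_product)
  also have "\<dots> \<le> card E * (card E * real q ^ d)"
    by (rule mult_left_mono[OF hyperplane_variance[OF U E]]) simp
  finally show ?thesis by (simp add: power2_eq_square mult.assoc)
qed

text \<open>\<open>X\<close> is, up to the factor two, the variance per pair. The last condition
  says that the deviation term \<open>N ^ (i + 2) * X\<close> does not exceed the expected size
  \<open>N ^ (i + 4) / q ^ (i + 2)\<close>. The summand 8 is the 4 of
  \<open>power_le_deviation\<close> times the 2 in the variance hypothesis.\<close>

lemma moment_from_variance:
  fixes X :: real
  assumes "finite E" "E \<noteq> {}" "P \<subseteq> E \<times> E"
    and var: "(\<Sum>(y, y')\<in>P. (real (bisector_count E y y') - card E / q)\<^sup>2) \<le> 2 * (card E)\<^sup>2 * X"
    and X: "X * real q ^ (i + 2) \<le> (card E)\<^sup>2"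
  shows "(\<Sum>(y, y')\<in>P. real (bisector_count E y y') ^ (i + 2)) \<le> (2 ^ (i + 2) + 8) * real (card E) ^ (i + 4) / real q ^ (i + 2)"
proof -
  define N where "N = real (card E)"
  have N: "N > 0" using assms(1,2) by (simp add: N_def card_gt_0_iff)
  have q: "real q > 0" by simp
  have fP: "finite P" by (rule finite_subset[OF assms(3)]) (use assms(1) in auto)
  have "(\<Sum>(y, y')\<in>P. real (bisector_count E y y') ^ (i + 2))
      \<le> (\<Sum>(y, y')\<in>P. 2 ^ (i + 2) * (N / q) ^ (i + 2) + 4 * (real (bisector_count E y y') - N / q)\<^sup>2 * N ^ i)"
  proof (rule sum_mono, clarify)
    fix y y'
    have "bisector_count E y y' \<le> card E" unfolding bisector_count_def by (rule card_mono) (use assms(1) in auto)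
    then show "real (bisector_count E y y') ^ (i + 2) \<le> 2 ^ (i + 2) * (N / q) ^ (i + 2) + 4 * (real (bisector_count E y y') - N / q)\<^sup>2 * N ^ i"
      using N by (intro power_le_deviation) (auto simp: N_def)
  qed
  also have "\<dots> = card P * (2 ^ (i + 2) * (N / q) ^ (i + 2))
      + 4 * N ^ i * (\<Sum>(y, y')\<in>P. (real (bisector_count E y y') - N / q)\<^sup>2)"
    by (simp add: sum.distrib case_prod_unfold sum_distrib_left mult_ac)
  also have "\<dots> \<le> N\<^sup>2 * (2 ^ (i + 2) * (N / q) ^ (i + 2)) + 4 * N ^ i * (2 * N\<^sup>2 * X)"
  proof (intro add_mono mult_left_mono mult_right_mono)
    have "card P \<le> card (E \<times> E)" by (rule card_mono) (use assms in auto)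
    then show "real (card P) \<le> N\<^sup>2"
      by (simp add: N_def card_cartesian_product power2_eq_square flip: of_nat_mult)
  qed (use var N in \<open>auto simp: N_def\<close>)
  also have "\<dots> \<le> N\<^sup>2 * (2 ^ (i + 2) * (N / q) ^ (i + 2)) + 4 * N ^ i * (2 * N\<^sup>2 * (N\<^sup>2 / q ^ (i + 2)))"
    using X N q by (intro add_left_mono mult_left_mono) (auto simp: N_def field_simps)
  also have "N\<^sup>2 * (2 ^ (i + 2) * (N / q) ^ (i + 2)) + 4 * N ^ i * (2 * N\<^sup>2 * (N\<^sup>2 / q ^ (i + 2)))
      = (2 ^ (i + 2) + 8) * N ^ (i + 4) / q ^ (i + 2)"
  proof -
    have p1: "N ^ (i + 4) = N ^ i * N\<^sup>2 * N\<^sup>2" by (simp add: power_add numeral_eq_Suc)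
    have p2: "(N / q) ^ (i + 2) = N ^ i * N\<^sup>2 / q ^ (i + 2)"
      by (simp add: power_divide power_add power2_eq_square)
    have "N\<^sup>2 * (c * (N ^ i * N\<^sup>2 / Z)) + 4 * N ^ i * (2 * N\<^sup>2 * (N\<^sup>2 / Z)) = (c + 8) * (N ^ i * N\<^sup>2 * N\<^sup>2) / Z"
      for c Z :: real by (simp add: algebra_simps add_divide_distrib)
    then show ?thesis unfolding p1 p2 .
  qed
  finally show ?thesis by (simp add: N_def)
qed

lemma bisector_tuple_count:
  assumes "finite E" "P \<subseteq> E \<times> E"
  shows "card {(xs, y, y'). (y, y') \<in> P \<and> xs \<in> tuples {x \<in> E. Q (x - y) = Q (x - y')} i}
    = (\<Sum>(y, y')\<in>P. bisector_count E y y' ^ i)"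
proof -
  let ?H = "\<lambda>p. {x \<in> E. Q (x - fst p) = Q (x - snd p)}"
  have fP: "finite P" by (rule finite_subset[OF assms(2)]) (use assms(1) in auto)
  have "{(xs, y, y'). (y, y') \<in> P \<and> xs \<in> tuples {x \<in> E. Q (x - y) = Q (x - y')} i}
      = (\<lambda>(p, xs). (xs, p)) ` Sigma P (\<lambda>p. tuples (?H p) i)" by force
  then have "card {(xs, y, y'). (y, y') \<in> P \<and> xs \<in> tuples {x \<in> E. Q (x - y) = Q (x - y')} i}
      = card (Sigma P (\<lambda>p. tuples (?H p) i))"
    by (simp add: card_image inj_on_def split_beta)
  also have "\<dots> = (\<Sum>p\<in>P. card (tuples (?H p) i))"
    using fP assms(1) by (intro card_SigmaI) (auto intro: tuples_finite(1))
  also have "\<dots> = (\<Sum>p\<in>P. bisector_count E (fst p) (snd p) ^ i)"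
    using assms(1) by (simp add: tuples_finite(2) bisector_count_def)
  finally show ?thesis by (simp add: case_prod_unfold)
qed

section \<open>Counting distance arrays in dimension \<open>k + 1\<close>\<close>

definition vdist :: "'v \<Rightarrow> 'v \<Rightarrow> 'a" where "vdist y x = Q (x - y)"

lemma collisions_tuples:
  assumes "finite E"
  shows "card (collisions vdist (tuples E (Suc i))) = (\<Sum>(y, y')\<in>E \<times> E. bisector_count E y y' ^ i)"
proof -
  have "collisions vdist (tuples E (Suc i))
      = {(xs, y, y'). (y, y') \<in> E \<times> E \<and> xs \<in> tuples {x \<in> E. Q (x - y) = Q (x - y')} i}"
    by (auto simp: collisions_def tuples_def vdist_def)
  then show ?thesis using bisector_tuple_count[OF assms, of "E \<times> E"] by simp
qed

text \<open>The moment bound asks for \<open>q ^ (d + i) \<le> N ^ 2\<close>, and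
  \<open>N \<ge> q ^ (d - 1)\<close> pays for it exactly as long as \<open>i + 2 \<le> d\<close>.
  The top level \<open>i = d - 1\<close> misses by one factor \<open>q\<close>, which is where
  nonisotropic normals enter.\<close>

lemma collisions_tuples_bound:
  assumes U: "nd_space d U" and E: "E \<subseteq> U" "E \<noteq> {}" and d: "3 \<le> d" "i + 2 \<le> d"
    and large: "real q ^ (d - 1) \<le> card E" and A: "2 ^ i + 8 \<le> (A::real)"
  shows "card (collisions vdist (tuples E (Suc i))) \<le> A * real (card E) ^ (i + 2) / real q ^ i"
proof -
  define N where "N = real (card E)"
  have fE: "finite E" using finite_subset[OF E(1) nd_spaceD(2)[OF U]] .
  have N: "N > 0" using fE E(2) by (simp add: N_def card_gt_0_iff)
  have q: "real q > 0" "real q \<ge> 1" using q_ge_3 by auto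
  have sq: "real q ^ m \<le> N\<^sup>2" if "m \<le> 2 * (d - 1)" for m
  proof -
    have "real q ^ m \<le> real q ^ (2 * (d - 1))" using that q(2) by (intro power_increasing)
    also have "\<dots> = (real q ^ (d - 1))\<^sup>2" by (simp only: power_mult[symmetric] mult.commute)
    also have "\<dots> \<le> N\<^sup>2" using large q by (intro power_mono) (auto simp: N_def)
    finally show ?thesis .
  qed
  have "real (card (collisions vdist (tuples E (Suc i)))) = (\<Sum>(y, y')\<in>E \<times> E. real (bisector_count E y y') ^ i)"
    unfolding collisions_tuples[OF fE] by (simp add: case_prod_unfold)
  also have "\<dots> \<le> (2 ^ i + 8) * N ^ (i + 2) / real q ^ i"
  proof -
    consider "i = 0" | "i = 1" | i' where "i = i' + 2"
      by (metis One_nat_def add_2_eq_Suc' not0_implies_Suc)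
    then show ?thesis
    proof cases
      case 1
      then show ?thesis using N by (simp add: card_cartesian_product power2_eq_square N_def)
    next
      case 2
      have "real q ^ d * q = real q ^ (d + 1)" by simp
      also have "\<dots> \<le> N\<^sup>2" using d by (intro sq) simp
      finally have "real q ^ d \<le> N\<^sup>2 / q" using q by (simp add: field_simps)
      then have "N * real q ^ d \<le> N * (N\<^sup>2 / q)" using N by (intro mult_left_mono) auto
      moreover have "(\<Sum>(y, y')\<in>E \<times> E. real (bisector_count E y y')) \<le> N ^ 3 / q + N * real q ^ d"
        using bisector_first_moment[OF U E(1)] by (simp add: N_def)
      moreover have "N ^ 3 / q \<ge> 0" "N * (N\<^sup>2 / q) = N ^ 3 / q" "(2 ^ i + 8) * N ^ (i + 2) / real q ^ i = 10 * (N ^ 3 / q)"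
        using N 2 by (simp_all add: power3_eq_cube power2_eq_square)
      ultimately have "(\<Sum>(y, y')\<in>E \<times> E. real (bisector_count E y y')) \<le> (2 ^ i + 8) * N ^ (i + 2) / real q ^ i" by linarith
      then show ?thesis using 2 by simp
    next
      case 3
      have X: "real q ^ d * real q ^ (i' + 2) \<le> (card E)\<^sup>2"
        using sq[of "d + (i' + 2)"] d 3 by (simp add: N_def power_add mult_ac)
      have "(\<Sum>(y, y')\<in>E \<times> E. (real (bisector_count E y y') - card E / q)\<^sup>2) \<le> 2 * (card E)\<^sup>2 * real q ^ d"
        using bisector_variance[OF U E(1)] by (simp add: order.trans)
      from moment_from_variance[OF fE E(2) subset_refl this X] show ?thesis
        using 3 by (simp add: N_def numeral_eq_Suc)
    qed
  qed
  also have "\<dots> \<le> A * N ^ (i + 2) / real q ^ i"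
    using A N q by (intro divide_right_mono mult_right_mono) auto
  finally show ?thesis by (simp add: N_def)
qed

text \<open>The order is reversed so that vertex \<open>k\<close>, the last one added, becomes the
  head expected by \<open>distance_lists\<close>.\<close>

definition vlist :: "nat \<Rightarrow> (nat \<Rightarrow> 'v) \<Rightarrow> 'v list" where
  "vlist k x = map x (rev [0..<Suc k])"

lemma vlist_rec: "vlist k x = x k # map x (rev [0..<k])" by (simp add: vlist_def)

lemma distance_lists_vlist_cong:
  assumes "\<And>i l. i \<le> k \<Longrightarrow> l \<le> k \<Longrightarrow> Q (x i - x l) = Q (x' i - x' l)"
  shows "distance_lists vdist (vlist k x) = distance_lists vdist (vlist k x')"
proof -
  have "distance_lists vdist (map x (rev [0..<m])) = distance_lists vdist (map x' (rev [0..<m]))" if "m \<le> Suc k" for m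
    using that
  proof (induction m)
    case (Suc m)
    have "map (vdist (x m)) (map x (rev [0..<m])) = map (vdist (x' m)) (map x' (rev [0..<m]))"
      using assms Suc.prems by (auto simp: vdist_def)
    then show ?case using Suc by simp
  qed simp
  then show ?thesis unfolding vlist_def by blast
qed

text \<open>The bisecting hyperplane of \<open>x k\<close> and \<open>y'\<close> contains the
  vertices before \<open>x k\<close>. If \<open>n = y' - x k\<close> were isotropic it would contain
  \<open>x k\<close> too, both distances then being zero. So \<open>n\<close> would be orthogonal to
  all \<open>k\<close> edges, and \<open>anisotropic_line\<close> would give
  \<open>n = 0\<close>.\<close>

lemma nonsingular_simplices_collision_nonisotropic:
  assumes U: "nd_space (Suc k) U" and E: "E \<subseteq> U" and k: "0 < k"
    and x: "x \<in> nonsingular_simplices k E" and y': "y' \<in> E" "x k \<noteq> y'"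
    and eq: "\<And>i. i < k \<Longrightarrow> Q (x i - x k) = Q (x i - y')"
  shows "Q (y' - x k) \<noteq> 0"
proof
  note sU = nd_spaceD(1)[OF U]
  assume iso: "Q (y' - x k) = 0"
  define n where "n = y' - x k"
  have xU: "x i \<in> U" if "i \<le> k" for i using x E that by (auto simp: nonsingular_simplices_def PiE_iff)
  have nU: "n \<in> U" unfolding n_def by (rule subspD(5)[OF sU]) (use y' E xU in auto)
  have u: "unital (x i)" if "i \<le> k" for i using subspD(4)[OF sU xU[OF that]] .
  have uy: "unital y'" using subspD(4)[OF sU] y'(1) E by blast
  have Bn: "B n (x i) = half * (Q y' - Q (x k))" if "i < k" for i
    unfolding n_def using bisector_iff[OF u[of i] u[of k] uy] eq[OF that] that by simp
  have "Q (x k + n) = Q (x k) + Q n + 2 * B (x k) n" by (rule Q_add)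
  moreover have "x k + n = y'" "Q n = 0" using iso by (simp_all add: n_def)
  moreover have "B (x k) n = B n (x k)" by (rule B_commute)
  ultimately have "Q y' = Q (x k) + 2 * B n (x k)" by simp
  then have "Q y' - Q (x k) = B n (x k) + B n (x k)" by (simp only: mult_2 add_diff_cancel_left')
  then have Bk: "B n (x k) = half * (Q y' - Q (x k))"
    using half_cancel[of "B n (x k)"] subspD(4)[OF sU nU] by (metis B_in_K(1))
  have "B (edges x i) n = 0" if "i < k" for i
  proof -
    have "B n (x (Suc i)) = half * (Q y' - Q (x k))" using Bn[of "Suc i"] Bk that by (cases "Suc i = k") auto
    then have "B n (edges x i) = 0" using Bn[OF k] by (simp add: edges_def B_diff)
    then show ?thesis by (simp add: B_commute)
  qed
  moreover have "nonsingular k (edges x)" using x by (simp add: nonsingular_simplices_def)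
  moreover have "edges x i \<in> U" if "i < k" for i
    unfolding edges_def by (rule subspD(5)[OF sU]) (use xU that in auto)
  moreover have "Q n = 0" using iso by (simp add: n_def)
  ultimately have "n = 0" using anisotropic_line[OF U, of "edges x" n] nU by blast
  then show False using y'(2) by (simp add: n_def)
qed

theorem odd_base:
  assumes U: "nd_space (Suc k) U" and E: "E \<subseteq> U" and k: "2 \<le> k" and large: "4 * real q ^ k \<le> card E"
  shows "pinned_const k (1 / 2 ^ k) (2 ^ k + 9) * real q ^ (Suc k choose 2) \<le> card (gram k ` nonsingular_simplices k E)"
proof -
  define N where "N = real (card E)"
  have fE: "finite E" using finite_subset[OF E nd_spaceD(2)[OF U]] .
  have q: "real q > 0" "real q \<ge> 1" using q_ge_3 by auto
  have Nq: "4 * real q ^ k \<le> N" using large by (simp add: N_def)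
  moreover have "real q ^ k > 0" using q by simp
  ultimately have N: "N > 0" "real q ^ k \<le> N" by linarith+
  then have Ene: "E \<noteq> {}" by (auto simp: N_def)
  have "4 * real (q ^ Suc k) \<le> real (q * card E)" using Nq q by (simp add: N_def)
  then have "real (4 * q ^ Suc k) \<le> real (q * card E)" by (simp only: of_nat_mult of_nat_numeral)
  then have large': "4 * q ^ Suc k \<le> q * card E" by (simp only: of_nat_le_iff)
  define T where "T = nonsingular_simplices k E"
  have fT: "finite T" unfolding T_def by (rule finite_nonsingular_simplices[OF fE])
  have xE: "x i \<in> E" if "x \<in> T" "i \<le> k" for x i using that by (auto simp: T_def nonsingular_simplices_def PiE_iff)
  define S where "S = vlist k ` T"
  have inj: "inj_on (vlist k) T"
  proof (rule inj_onI)
    fix x x' assume x: "x \<in> T" "x' \<in> T" and eq: "vlist k x = vlist k x'"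
    have "x i = x' i" if "i \<in> {0..k}" for i using eq that by (auto simp: vlist_def)
    then show "x = x'" using x by (intro PiE_ext[of x "{0..k}" "\<lambda>_. E"]) (auto simp: T_def nonsingular_simplices_def)
  qed
  have St: "S \<subseteq> tuples E (Suc k)" using xE by (auto simp: S_def vlist_def tuples_def)
  have "card E ^ Suc k \<le> 2 ^ k * card T"
    unfolding T_def by (rule nonsingular_simplices_count[OF U E large']) simp
  then have "real (card E ^ Suc k) \<le> real (2 ^ k * card T)" by (simp only: of_nat_le_iff)
  then have Sc: "1 / 2 ^ k * real (card E) ^ Suc k \<le> card S"
    by (simp add: S_def card_image[OF inj] field_simps)
  let ?P = "{(y, y') \<in> E \<times> E. Q (y' - y) \<noteq> 0}"
  \<comment> \<open>The pairs with \<open>y = y'\<close> raise the moment constant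
    \<open>2 ^ k + 8\<close> by one. Their number \<open>N ^ (k + 1)\<close> is within the bound
    because \<open>N \<ge> q ^ k\<close>.\<close>
  have top: "card (collisions vdist S) \<le> (2 ^ k + 9) * real (card E) ^ (k + 2) / real q ^ k"
  proof -
    let ?A = "(\<lambda>(xs, y). (xs, y, y)) ` (tuples E k \<times> E)"
    let ?C = "{(xs, y, y'). (y, y') \<in> ?P \<and> xs \<in> tuples {x \<in> E. Q (x - y) = Q (x - y')} k}"
    have "collisions vdist S \<subseteq> ?A \<union> ?C"
    proof
      fix z assume "z \<in> collisions vdist S"
      then obtain xs y y' where z: "z = (xs, y, y')" "y # xs \<in> S" "y' # xs \<in> S" "map (vdist y) xs = map (vdist y') xs"
        by (auto simp: collisions_def)
      obtain x where x: "x \<in> T" "y # xs = vlist k x" using z(2) by (auto simp: S_def)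
      have y: "y = x k" and xs: "xs = map x (rev [0..<k])" using x(2) by (auto simp: vlist_rec)
      have "y # xs \<in> tuples E (Suc k)" "y' # xs \<in> tuples E (Suc k)" using St z(2,3) by blast+
      then have yE: "y \<in> E" "y' \<in> E" "xs \<in> tuples E k" by (simp_all add: tuples_def)
      have eq: "Q (x i - y) = Q (x i - y')" if "i < k" for i
        using z(4) that unfolding xs by (auto simp: vdist_def)
      show "z \<in> ?A \<union> ?C"
      proof (cases "y = y'")
        case True
        then show ?thesis using yE z(1) by auto
      next
        case False
        have "Q (y' - y) \<noteq> 0" unfolding y
          by (rule nonsingular_simplices_collision_nonisotropic[OF U E]) (use k x(1) yE False eq y in \<open>auto simp: T_def\<close>)
        moreover have "xs \<in> tuples {x \<in> E. Q (x - y) = Q (x - y')} k"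
          using yE(3) eq by (auto simp: tuples_def xs)
        ultimately show ?thesis using yE z(1) by auto
      qed
    qed
    moreover have fA: "finite ?A" using fE by (auto intro: tuples_finite)
    moreover have fC: "finite ?C"
      by (rule finite_subset[of _ "tuples E k \<times> E \<times> E"]) (use fE in \<open>auto simp: tuples_def intro: tuples_finite(1)[unfolded tuples_def]\<close>)
    ultimately have "card (collisions vdist S) \<le> card (?A \<union> ?C)" by (intro card_mono) auto
    also have "\<dots> \<le> card ?A + card ?C" by (rule card_Un_le)
    also have "\<dots> = card E ^ k * card E + (\<Sum>(y, y')\<in>?P. bisector_count E y y' ^ k)"
    proof -
      have "card ?A = card E ^ k * card E"
        using fE by (subst card_image) (auto intro!: inj_onI simp: card_cartesian_product tuples_finite)
      moreover have "card ?C = (\<Sum>(y, y')\<in>?P. bisector_count E y y' ^ k)" by (rule bisector_tuple_count[OF fE]) auto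
      ultimately show ?thesis by simp
    qed
    finally have "real (card (collisions vdist S)) \<le> real (card E ^ k * card E + (\<Sum>(y, y')\<in>?P. bisector_count E y y' ^ k))"
      by (simp only: of_nat_le_iff)
    also have "\<dots> = N ^ k * N + (\<Sum>(y, y')\<in>?P. real (bisector_count E y y') ^ k)"
      by (simp add: N_def case_prod_unfold)
    also have "\<dots> \<le> N ^ (k + 2) / real q ^ k + (2 ^ k + 8) * N ^ (k + 2) / real q ^ k"
    proof (rule add_mono)
      have "N ^ k * N * q ^ k \<le> N ^ k * N * N" using N by (intro mult_left_mono) auto
      then show "N ^ k * N \<le> N ^ (k + 2) / real q ^ k" using q by (simp add: field_simps)
      let ?S = "\<Sum>(y, y')\<in>?P. (real (bisector_count E y y') - card E / q)\<^sup>2"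
      have S0: "?S \<ge> 0" by (rule sum_nonneg) auto
      \<comment> \<open>Trading the gained \<open>q - 1\<close> for a full \<open>q\<close> costs
        the factor two that \<open>moment_from_variance\<close> allows for.\<close>
      have "real q * ?S \<le> 2 * ((real q - 1) * ?S)"
      proof -
        have "real q \<le> 2 * (real q - 1)" using q_ge_3 by simp
        from mult_right_mono[OF this S0] show ?thesis by (simp only: mult.assoc)
      qed
      also have "\<dots> \<le> 2 * ((card E)\<^sup>2 * real q ^ Suc k)"
        by (rule mult_left_mono[OF nonisotropic_bisector_variance[OF U E]]) simp
      finally have "real q * ?S \<le> real q * (2 * (card E)\<^sup>2 * real q ^ k)" by (simp add: mult_ac)
      then have var: "?S \<le> 2 * (card E)\<^sup>2 * real q ^ k" using q by (simp only: mult_le_cancel_left_pos)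
      have X: "real q ^ k * real q ^ k \<le> (card E)\<^sup>2"
        using mult_mono[OF N(2) N(2)] N(1) q by (simp add: N_def power2_eq_square)
      have PE: "?P \<subseteq> E \<times> E" by auto
      obtain i where i: "k = i + 2" using k by (metis add.commute le_Suc_ex)
      show "(\<Sum>(y, y')\<in>?P. real (bisector_count E y y') ^ k) \<le> (2 ^ k + 8) * N ^ (k + 2) / real q ^ k"
        using moment_from_variance[OF fE Ene PE var, of i] X unfolding i
        by (simp add: N_def numeral_eq_Suc) 
    qed
    also have "\<dots> = (2 ^ k + 9) * N ^ (k + 2) / real q ^ k" by (simp add: add_divide_distrib[symmetric] algebra_simps)
    finally show ?thesis by (simp add: N_def)
  qed
  have lower: "card (collisions vdist (tuples E (Suc i))) \<le> (2 ^ k + 9) * real (card E) ^ (i + 2) / real q ^ i" if "i < k" for i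
  proof (rule collisions_tuples_bound[OF U E Ene])
    show "3 \<le> Suc k" "i + 2 \<le> Suc k" using k that by auto
    show "real q ^ (Suc k - 1) \<le> card E" using N(2) by (simp add: N_def)
    have "(2::real) ^ i \<le> 2 ^ k" using that by (intro power_increasing) auto
    then show "(2::real) ^ i + 8 \<le> 2 ^ k + 9" by linarith
  qed
  have "pinned_const k (1 / 2 ^ k) (2 ^ k + 9) * real q ^ (Suc k choose 2) \<le> card (distance_lists vdist ` S)"
    by (rule pinned[OF fE Ene _ q(1) St]) (use Sc top lower in \<open>simp_all add: add_pos_pos\<close>)
  also have "card (distance_lists vdist ` S) = card ((\<lambda>x. distance_lists vdist (vlist k x)) ` T)"
    by (simp add: S_def image_image)
  also have "\<dots> \<le> card (gram k ` T)"
    using fT by (intro of_nat_mono card_image_le_image distance_lists_vlist_cong gram_distance)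
  finally show ?thesis by (simp add: T_def)
qed

end

section \<open>Characters and the Fourier transform\<close>

context idem_field
begin

text \<open>Modulo a maximal proper additive subgroup \<open>H\<close> of \<open>K\<close>, any
  \<open>a\<close> outside \<open>H\<close> generates the group. If \<open>a\<close> has order
  \<open>p\<close> modulo \<open>H\<close>, the class of \<open>j\<close> times \<open>a\<close> is
  sent to the \<open>p\<close>-th root of unity with angle \<open>2 * pi * j / p\<close>.\<close>

lemma character_ex:
  "\<exists>\<chi> :: 'a \<Rightarrow> complex. (\<forall>x\<in>K. \<forall>y\<in>K. \<chi> (x + y) = \<chi> x * \<chi> y) \<and> (\<forall>x\<in>K. norm (\<chi> x) = 1) \<and> (\<exists>b\<in>K. \<chi> b \<noteq> 1)"
proof -
  define sg where "sg H \<longleftrightarrow> 0 \<in> H \<and> H \<subseteq> K \<and> (\<forall>x\<in>H. \<forall>y\<in>H. x - y \<in> H)" for H :: "'a set"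
  define \<S> where "\<S> = {H. sg H \<and> H \<noteq> K}"
  have "finite \<S>" by (rule finite_subset[of _ "Pow K"]) (auto simp: \<S>_def sg_def)
  moreover have "\<S> \<noteq> {}"
  proof -
    have "{0} \<in> \<S>" using e_nz by (auto simp: \<S>_def sg_def)
    then show ?thesis by blast
  qed
  ultimately obtain H where H: "H \<in> \<S>" and max: "\<And>H'. H' \<in> \<S> \<Longrightarrow> H \<subseteq> H' \<Longrightarrow> H' = H"
    using finite_has_maximal[of \<S>] by blast
  have H0: "0 \<in> H" "H \<subseteq> K" "H \<noteq> K" and Hd: "\<And>x y. x \<in> H \<Longrightarrow> y \<in> H \<Longrightarrow> x - y \<in> H"
    using H by (auto simp: \<S>_def sg_def)
  have Hm: "- x \<in> H" if "x \<in> H" for x using Hd[OF H0(1) that] by simp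
  have Ha: "x + y \<in> H" if "x \<in> H" "y \<in> H" for x y using Hd[OF that(1) Hm[OF that(2)]] by simp
  have Hn: "of_nat n * x \<in> H" if "x \<in> H" for n x
    by (induction n) (auto simp: H0 Ha that distrib_right)
  have Hi: "of_int j * x \<in> H" if "x \<in> H" for j x
    by (cases j) (use Hn[OF that] Hm[OF Hn[OF that]] in \<open>simp_all del: of_nat_Suc\<close>)
  obtain a where a: "a \<in> K" "a \<notin> H" using H0 by blast
  have span: "\<exists>j. x - of_int j * a \<in> H" if x: "x \<in> K" for x
  proof -
    \<comment> \<open>\<open>M\<close> is the subgroup generated by \<open>H\<close> and
      \<open>a\<close>. It is strictly larger than \<open>H\<close>, so maximality makes it all of
      \<open>K\<close>.\<close>
    define M where "M = {y \<in> K. \<exists>j. y - of_int j * a \<in> H}"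
    have "sg M" unfolding sg_def
    proof (intro conjI ballI)
      show "0 \<in> M" using H0(1) by (auto simp: M_def intro: exI[of _ 0])
      fix y z assume "y \<in> M" "z \<in> M"
      then obtain j l where yz: "y \<in> K" "z \<in> K" "y - of_int j * a \<in> H" "z - of_int l * a \<in> H"
        by (auto simp: M_def)
      have "(y - of_int j * a) - (z - of_int l * a) = (y - z) - of_int (j - l) * a"
        by (simp add: algebra_simps)
      then have "(y - z) - of_int (j - l) * a \<in> H" using Hd[OF yz(3,4)] by (simp only:)
      then show "y - z \<in> M" unfolding M_def using K_closed(4)[OF yz(1,2)] by blast
    qed (auto simp: M_def)
    moreover have "H \<subseteq> M" using H0(2) by (auto simp: M_def intro: exI[of _ 0])
    moreover have "a \<in> M" using a(1) H0(1) by (auto simp: M_def intro: exI[of _ 1])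
    ultimately have "M = K" using max[of M] a(2) by (auto simp: \<S>_def)
    then show ?thesis using x by (auto simp: M_def)
  qed
  have "\<not> inj (\<lambda>n. of_nat n * a)"
  proof
    assume "inj (\<lambda>n. of_nat n * a)"
    moreover have "range (\<lambda>n. of_nat n * a) \<subseteq> K" using a(1) by auto
    ultimately show False using finite_subset[OF _ finite_K] range_inj_infinite by blast
  qed
  then obtain m n :: nat where mn: "m \<noteq> n" "of_nat m * a = of_nat n * a" unfolding inj_def by blast
  define i j where "i = min m n" and "j = max m n"
  have ij: "i < j" "of_nat i * a = of_nat j * a" using mn by (auto simp: i_def j_def min_def max_def)
  have "of_nat (j - i) * a = 0" using ij by (simp add: of_nat_diff left_diff_distrib)
  then have ex: "\<exists>n>0. of_nat n * a \<in> H" using ij(1) H0(1) by (intro exI[of _ "j - i"]) simp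
  define p where "p = (LEAST n. n > 0 \<and> of_nat n * a \<in> H)"
  have p: "p > 0" "of_nat p * a \<in> H" using LeastI_ex[OF ex] by (auto simp: p_def)
  have pmin: "\<not> of_nat n * a \<in> H" if "n > 0" "n < p" for n
    using not_less_Least[of n "\<lambda>n. n > 0 \<and> of_nat n * a \<in> H"] that by (auto simp: p_def)
  have "p \<noteq> 1" using p(2) a(2) by auto
  then have p2: "p \<ge> 2" using p(1) by linarith
  have dvd: "int p dvd j" if "of_int j * a \<in> H" for j
  proof -
    have "of_int (j mod int p) * a = of_int j * a - of_int (j div int p) * (of_nat p * a)"
      by (simp add: minus_div_mult_eq_mod[symmetric] left_diff_distrib mult.assoc)
    then have "of_int (j mod int p) * a \<in> H" using Hd[OF that Hi[OF p(2)]] by simp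
    then have "of_nat (nat (j mod int p)) * a \<in> H" using p(1) by (simp add: of_nat_nat)
    then have "\<not> nat (j mod int p) > 0" using pmin[of "nat (j mod int p)"] p(1) by (auto simp: nat_less_iff)
    then have "j mod int p = 0" using p(1) pos_mod_sign[of "int p" j] by linarith
    then show ?thesis by auto
  qed
  define f where "f j = cis (2 * pi * real_of_int j / real p)" for j :: int
  have f_add: "f (j + l) = f j * f l" for j l
    by (simp add: f_def cis_mult add_divide_distrib distrib_left)
  have f_dvd: "f j = 1" if "int p dvd j" for j
  proof -
    from that obtain m where "j = int p * m" by blast
    then have "2 * pi * real_of_int j / real p = 2 * pi * real_of_int m" using p(1) by simp
    then show ?thesis by (simp add: f_def cis_multiple_2pi)
  qed
  have f_cong: "f j = f l" if "of_int (j - l) * a \<in> H" for j l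
    using f_add[of "j - l" l] f_dvd[OF dvd[OF that]] by simp
  define J where "J x = (SOME j. x - of_int j * a \<in> H)" for x
  have J: "x - of_int (J x) * a \<in> H" if "x \<in> K" for x unfolding J_def by (rule someI_ex[OF span[OF that]])
  have fJ: "f (J x) = f j" if "x \<in> K" "x - of_int j * a \<in> H" for x j
  proof (rule f_cong)
    have "(x - of_int j * a) - (x - of_int (J x) * a) \<in> H" by (rule Hd[OF that(2) J[OF that(1)]])
    then show "of_int (J x - j) * a \<in> H" by (simp add: algebra_simps)
  qed
  have "f (J (x + y)) = f (J x) * f (J y)" if "x \<in> K" "y \<in> K" for x y
  proof -
    have "(x - of_int (J x) * a) + (y - of_int (J y) * a) \<in> H" by (rule Ha[OF J[OF that(1)] J[OF that(2)]])
    then have "(x + y) - of_int (J x + J y) * a \<in> H" by (simp add: algebra_simps)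
    then show ?thesis using fJ[OF K_closed(3)[OF that]] by (simp only: f_add)
  qed
  moreover have "norm (f (J x)) = 1" for x by (simp add: f_def)
  moreover have "f (J a) \<noteq> 1"
  proof
    assume "f (J a) = 1"
    then have "f 1 = 1" using fJ[of a 1] a(1) H0(1) by simp
    \<comment> \<open>Since \<open>p \<ge> 2\<close>, the angle lies in the interval from
      \<open>0\<close> to \<open>pi\<close>, on which the cosine is injective.\<close>
    then have "cos (2 * pi / real p) = cos 0" by (simp add: f_def complex_eq_iff)
    moreover have "2 * pi / real p \<le> pi" using p2 by (simp add: divide_le_eq)
    ultimately have "2 * pi / real p = 0" using cos_inj_pi[of "2 * pi / real p" 0] by simp
    then show False using p(1) by simp
  qed
  ultimately show ?thesis using a(1) by (intro exI[of _ "\<lambda>x. f (J x)"]) blast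
qed

definition chi :: "'a \<Rightarrow> complex" where
  "chi = (SOME \<chi>. (\<forall>x\<in>K. \<forall>y\<in>K. \<chi> (x + y) = \<chi> x * \<chi> y) \<and> (\<forall>x\<in>K. norm (\<chi> x) = 1) \<and> (\<exists>b\<in>K. \<chi> b \<noteq> 1))"

lemma chi: "x \<in> K \<Longrightarrow> y \<in> K \<Longrightarrow> chi (x + y) = chi x * chi y" "x \<in> K \<Longrightarrow> norm (chi x) = 1"
  "\<exists>b\<in>K. chi b \<noteq> 1"
  using someI_ex[OF character_ex] unfolding chi_def[symmetric] by blast+

lemma chi_0 [simp]: "chi 0 = 1"
proof -
  have "chi 0 * chi 0 = chi 0 * 1" using chi(1)[of 0 0] by simp
  moreover have "chi 0 \<noteq> 0" using chi(2)[of 0] by auto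
  ultimately show ?thesis by simp
qed

lemma chi_minus: "x \<in> K \<Longrightarrow> chi (- x) = cnj (chi x)"
proof -
  assume x: "x \<in> K"
  have "chi x * chi (- x) = 1" using chi(1)[of x "- x"] x by simp
  moreover have "chi x * cnj (chi x) = 1" using chi(2)[OF x] complex_norm_square[of "chi x"] by simp
  ultimately have "chi x * chi (- x) = chi x * cnj (chi x)" by (simp only:)
  moreover have "chi x \<noteq> 0" using chi(2)[OF x] by auto
  ultimately show ?thesis by (rule iffD1[OF mult_left_cancel, rotated])
qed

lemma chi_diff: "x \<in> K \<Longrightarrow> y \<in> K \<Longrightarrow> chi (x - y) = chi x * cnj (chi y)"
  using chi(1)[of x "- y"] chi_minus[of y] by simp

text \<open>Translation by an element on which the character is nontrivial multiplies the sum by a scalar \<open>\<noteq> 1\<close>.\<close>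

lemma chi_sum_zero:
  assumes "finite S" "\<And>s. s \<in> S \<Longrightarrow> g s \<in> K" "b \<in> K" "chi b \<noteq> 1"
    "bij_betw \<tau> S S" "\<And>s. s \<in> S \<Longrightarrow> g (\<tau> s) = b + g s"
  shows "(\<Sum>s\<in>S. chi (g s)) = 0"
proof -
  have "(\<Sum>s\<in>S. chi (g s)) = (\<Sum>s\<in>S. chi (g (\<tau> s)))"
    by (rule sum.reindex_bij_betw[OF assms(5), symmetric])
  also have "\<dots> = (\<Sum>s\<in>S. chi b * chi (g s))"
    by (rule sum.cong) (use assms chi(1) in auto)
  also have "\<dots> = chi b * (\<Sum>s\<in>S. chi (g s))" by (simp add: sum_distrib_left)
  finally have "(chi b - 1) * (\<Sum>s\<in>S. chi (g s)) = 0" by (simp add: left_diff_distrib)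
  then show ?thesis using assms(4) by simp
qed

lemma chi_sum_field: "a \<in> K \<Longrightarrow> (\<Sum>t\<in>K. chi (t * a)) = (if a = 0 then of_nat q else 0)"
proof (cases "a = 0")
  case False
  assume a: "a \<in> K"
  obtain b where b: "b \<in> K" "chi b \<noteq> 1" using chi(3) by blast
  obtain y where y: "y \<in> K" "a * y = e" using K_inverse[OF a False] by blast
  have "(\<Sum>t\<in>K. chi (t * a)) = 0"
  proof (rule chi_sum_zero[OF finite_K _ b])
    show "bij_betw (\<lambda>t. b * y + t) K K"
      by (rule bij_betw_byWitness[where f' = "\<lambda>t. t - b * y"]) (use b(1) y(1) in auto)
    show "(b * y + t) * a = b + t * a" for t
      using y(2) K_unit(2)[OF b(1)] by (simp add: distrib_right mult.assoc mult.commute[of y])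
  qed (use a in auto)
  then show ?thesis using False by simp
qed (simp add: q_def)

end

context form_space
begin

lemma chi_sum_space:
  assumes U: "nd_space d U" and \<xi>: "\<xi> \<in> U"
  shows "(\<Sum>u\<in>U. chi (B u \<xi>)) = (if \<xi> = 0 then of_nat (q ^ d) else 0)"
proof (cases "\<xi> = 0")
  case False
  note sU = nd_spaceD(1)[OF U]
  obtain b where b: "b \<in> K" "chi b \<noteq> 1" using chi(3) by blast
  obtain \<zeta> where z: "\<zeta> \<in> U" "B \<xi> \<zeta> = e" using nd_dual[OF U \<xi> False] .
  have "(\<Sum>u\<in>U. chi (B u \<xi>)) = 0"
  proof (rule chi_sum_zero[OF nd_spaceD(2)[OF U] _ b])
    have "b \<star> \<zeta> \<in> U" using subspD(3)[OF sU z(1)] .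
    then show "bij_betw (\<lambda>u. b \<star> \<zeta> + u) U U"
      using subspD(2,5)[OF sU]
      by (intro bij_betw_byWitness[where f' = "\<lambda>u. u - b \<star> \<zeta>"]) auto
    show "B (b \<star> \<zeta> + u) \<xi> = b + B u \<xi>" for u
      using z(2) K_unit(2)[OF b(1)] B_commute[of \<zeta> \<xi>] by (simp add: B_simps)
    show "B u \<xi> \<in> K" for u using subspD(4)[OF sU \<xi>] by blast
  qed
  then show ?thesis using False by simp
qed (simp add: nd_spaceD(3)[OF U])

text \<open>The transform is not normalised. The form identifies \<open>U\<close> with its dual, so
  frequencies are again vectors of \<open>U\<close> and an isometry acts on points and frequencies
  alike.\<close>

definition fourier :: "'v set \<Rightarrow> ('v \<Rightarrow> real) \<Rightarrow> 'v \<Rightarrow> complex" where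
  "fourier U f \<xi> = (\<Sum>u\<in>U. of_real (f u) * chi (B u \<xi>))"

lemma fourier_norm_expand:
  assumes U: "nd_space d U" and \<xi>: "\<xi> \<in> U"
  shows "complex_of_real ((cmod (fourier U f \<xi>))\<^sup>2) = (\<Sum>(u, v)\<in>U \<times> U. of_real (f u * f v) * chi (B (u - v) \<xi>))"
proof -
  note sU = nd_spaceD(1)[OF U]
  have BK: "B u \<xi> \<in> K" for u using subspD(4)[OF sU \<xi>] by blast
  have "complex_of_real ((cmod (fourier U f \<xi>))\<^sup>2) = fourier U f \<xi> * cnj (fourier U f \<xi>)"
    by (rule complex_norm_square)
  also have "\<dots> = (\<Sum>u\<in>U. \<Sum>v\<in>U. (of_real (f u) * chi (B u \<xi>)) * (of_real (f v) * cnj (chi (B v \<xi>))))"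
    by (simp add: fourier_def sum_product)
  also have "\<dots> = (\<Sum>u\<in>U. \<Sum>v\<in>U. of_real (f u * f v) * chi (B (u - v) \<xi>))"
    by (intro sum.cong) (auto simp: B_diff chi_diff[OF BK BK] mult_ac)
  finally show ?thesis by (simp add: sum.cartesian_product)
qed

lemma parseval:
  assumes U: "nd_space d U"
  shows "(\<Sum>\<xi>\<in>U. (cmod (fourier U f \<xi>))\<^sup>2) = real q ^ d * (\<Sum>u\<in>U. (f u)\<^sup>2)"
proof -
  note sU = nd_spaceD(1)[OF U]
  have fU: "finite U" using nd_spaceD(2)[OF U] .
  have "complex_of_real (\<Sum>\<xi>\<in>U. (cmod (fourier U f \<xi>))\<^sup>2)
      = (\<Sum>\<xi>\<in>U. \<Sum>p\<in>U \<times> U. of_real (f (fst p) * f (snd p)) * chi (B (fst p - snd p) \<xi>))"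
    by (simp add: fourier_norm_expand[OF U] case_prod_unfold del: of_real_power)
  also have "\<dots> = (\<Sum>p\<in>U \<times> U. of_real (f (fst p) * f (snd p)) * (\<Sum>\<xi>\<in>U. chi (B \<xi> (fst p - snd p))))"
    by (subst sum.swap) (simp add: sum_distrib_left B_commute)
  also have "\<dots> = (\<Sum>p\<in>U \<times> U. if fst p = snd p then of_real (f (fst p) * f (snd p)) * of_nat (q ^ d) else 0)"
    by (intro sum.cong refl) (use chi_sum_space[OF U] subspD(5)[OF sU] in \<open>auto simp: mem_Times_iff\<close>)
  also have "\<dots> = (\<Sum>p\<in>(\<lambda>u. (u, u)) ` U. of_real (f (fst p) * f (snd p)) * of_nat (q ^ d))"
    using fU by (intro sum.mono_neutral_cong_right) auto
  also have "\<dots> = (\<Sum>u\<in>U. of_real (f u * f u) * of_nat (q ^ d))"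
    by (subst sum.reindex) (auto simp: inj_on_def)
  also have "\<dots> = complex_of_real (real q ^ d * (\<Sum>u\<in>U. (f u)\<^sup>2))"
    by (simp add: power2_eq_square sum_distrib_left mult_ac)
  finally show ?thesis by (simp only: of_real_eq_iff)
qed

end

section \<open>Counting isometries\<close>

context form_space
begin

text \<open>The maps are extensional on \<open>U\<close>, which makes the set finite; their
  bijectivity is derived from nondegeneracy in \<open>Isom_bij\<close>.\<close>

definition Isom :: "'v set \<Rightarrow> ('v \<Rightarrow> 'v) set" where
  "Isom U = {\<theta> \<in> U \<rightarrow>\<^sub>E U. (\<forall>u\<in>U. \<forall>v\<in>U. \<theta> (u + v) = \<theta> u + \<theta> v) \<and>
    (\<forall>a. \<forall>u\<in>U. \<theta> (a \<star> u) = a \<star> \<theta> u) \<and> (\<forall>u\<in>U. \<forall>v\<in>U. B (\<theta> u) (\<theta> v) = B u v)}"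

lemma IsomD:
  assumes "\<theta> \<in> Isom U"
  shows "\<theta> \<in> U \<rightarrow>\<^sub>E U" "u \<in> U \<Longrightarrow> \<theta> u \<in> U" "u \<in> U \<Longrightarrow> v \<in> U \<Longrightarrow> \<theta> (u + v) = \<theta> u + \<theta> v"
    "u \<in> U \<Longrightarrow> \<theta> (a \<star> u) = a \<star> \<theta> u" "u \<in> U \<Longrightarrow> v \<in> U \<Longrightarrow> B (\<theta> u) (\<theta> v) = B u v"
  using assms by (auto simp: Isom_def)

lemma Isom_diff:
  assumes "\<theta> \<in> Isom U" "subsp U" "u \<in> U" "v \<in> U"
  shows "\<theta> (u - v) = \<theta> u - \<theta> v"
  using IsomD(3)[OF assms(1) subspD(5)[OF assms(2,3,4)] assms(4)] by simp

lemma finite_Isom: "finite U \<Longrightarrow> finite (Isom U)"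
  by (rule finite_subset[of _ "U \<rightarrow>\<^sub>E U"]) (auto simp: Isom_def intro: finite_PiE)

lemma Isom_inj:
  assumes "nd_space d U" "\<theta> \<in> Isom U"
  shows "inj_on \<theta> U"
proof (rule inj_onI)
  fix u v assume uv: "u \<in> U" "v \<in> U" "\<theta> u = \<theta> v"
  note sU = nd_spaceD(1)[OF assms(1)]
  have d: "u - v \<in> U" using subspD(5)[OF sU uv(1,2)] .
  have "B (u - v) w = 0" if "w \<in> U" for w
  proof -
    have "\<theta> (u - v) = 0" using Isom_diff[OF assms(2) sU uv(1,2)] uv(3) by simp
    then show ?thesis using IsomD(5)[OF assms(2) d that] by simp
  qed
  then have "u - v = 0" by (rule nd_spaceD(4)[OF assms(1) d])
  then show "u = v" by simp
qed

lemma Isom_bij: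
  assumes "nd_space d U" "\<theta> \<in> Isom U"
  shows "bij_betw \<theta> U U"
proof -
  have "\<theta> ` U \<subseteq> U" using IsomD(2)[OF assms(2)] by blast
  then show ?thesis
    using endo_inj_surj[OF nd_spaceD(2)[OF assms(1)] _ Isom_inj[OF assms]] Isom_inj[OF assms]
    by (simp add: bij_betw_def)
qed

text \<open>Composing the members of \<open>\<Theta>\<close> with the inverse of a fixed member
  \<open>\<theta>0\<close> yields isometries that fix \<open>A\<close> pointwise. They preserve
  \<open>W\<close>, the orthogonal complement of \<open>A\<close>, and are determined by their
  restriction to \<open>W\<close> because \<open>U = A + W\<close>.\<close>

lemma Isom_agree_count:
  assumes U: "nd_space d U" and W: "W = perp U A" and A: "A \<subseteq> U"
    and decomp: "\<And>u. u \<in> U \<Longrightarrow> \<exists>a\<in>A. u - a \<in> W"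
    and \<Theta>: "\<Theta> \<subseteq> Isom U" "\<And>\<theta> \<theta>' a. \<theta> \<in> \<Theta> \<Longrightarrow> \<theta>' \<in> \<Theta> \<Longrightarrow> a \<in> A \<Longrightarrow> \<theta> a = \<theta>' a"
  shows "card \<Theta> \<le> card (Isom W)"
proof (cases "\<Theta> = {}")
  case False
  then obtain \<theta>0 where t0: "\<theta>0 \<in> \<Theta>" by blast
  then have t0I: "\<theta>0 \<in> Isom U" using \<Theta> by blast
  note sU = nd_spaceD(1)[OF U]
  have WU: "W \<subseteq> U" by (auto simp: W perp_def)
  have sW: "subsp W" unfolding W by (rule subsp_perp[OF sU])
  define \<iota> where "\<iota> = the_inv_into U \<theta>0"
  have bij: "bij_betw \<theta>0 U U" using Isom_bij[OF U t0I] .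
  have \<iota>: "\<iota> (\<theta>0 u) = u" if "u \<in> U" for u
    using the_inv_into_f_f[OF bij_betw_imp_inj_on[OF bij] that] by (simp add: \<iota>_def)
  have \<iota>': "\<theta>0 (\<iota> u) = u" "\<iota> u \<in> U" if "u \<in> U" for u
    using f_the_inv_into_f_bij_betw[OF bij] the_inv_into_into[OF bij_betw_imp_inj_on[OF bij], of u U]
      bij that by (auto simp: \<iota>_def bij_betw_def)
  have \<iota>_add: "\<iota> (u + v) = \<iota> u + \<iota> v" if "u \<in> U" "v \<in> U" for u v
  proof -
    have "\<iota> u + \<iota> v = \<iota> (\<theta>0 (\<iota> u + \<iota> v))" using \<iota>[OF subspD(2)[OF sU]] \<iota>'(2) that by simp
    then show ?thesis using IsomD(3)[OF t0I] \<iota>' that by simp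
  qed
  have \<iota>_sc: "\<iota> (a \<star> u) = a \<star> \<iota> u" if "u \<in> U" for a u
  proof -
    have "a \<star> \<iota> u = \<iota> (\<theta>0 (a \<star> \<iota> u))" using \<iota>[OF subspD(3)[OF sU]] \<iota>'(2) that by simp
    then show ?thesis using IsomD(4)[OF t0I] \<iota>' that by simp
  qed
  have \<iota>_B: "B (\<iota> u) v = B u (\<theta>0 v)" if "u \<in> U" "v \<in> U" for u v
    using IsomD(5)[OF t0I \<iota>'(2)[OF that(1)] that(2)] \<iota>'(1)[OF that(1)] by simp
  define \<Phi> where "\<Phi> \<theta> = (\<lambda>w\<in>W. \<iota> (\<theta> w))" for \<theta>
  have mem: "\<Phi> \<theta> \<in> Isom W" if t: "\<theta> \<in> \<Theta>" for \<theta>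
  proof -
    have tI: "\<theta> \<in> Isom U" using \<Theta> t by blast
    have tw: "\<theta> w \<in> U" if "w \<in> W" for w using IsomD(2)[OF tI] that WU by blast
    have into: "\<iota> (\<theta> w) \<in> W" if w: "w \<in> W" for w
      unfolding W perp_def
    proof (intro CollectI conjI ballI)
      show "\<iota> (\<theta> w) \<in> U" using \<iota>'(2)[OF tw[OF w]] .
      fix a assume a: "a \<in> A"
      then have aU: "a \<in> U" using A by blast
      have "B (\<iota> (\<theta> w)) a = B (\<theta> w) (\<theta>0 a)" by (rule \<iota>_B[OF tw[OF w] aU])
      also have "\<dots> = B (\<theta> w) (\<theta> a)" using \<Theta>(2)[OF t0 t a] by simp
      also have "\<dots> = B w a" using IsomD(5)[OF tI] w WU aU by blast
      finally show "B (\<iota> (\<theta> w)) a = 0" using w a by (simp add: W perp_def)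
    qed
    show ?thesis unfolding Isom_def
    proof (intro CollectI conjI ballI allI)
      show "\<Phi> \<theta> \<in> W \<rightarrow>\<^sub>E W" using into by (auto simp: \<Phi>_def)
      show "\<Phi> \<theta> (u + v) = \<Phi> \<theta> u + \<Phi> \<theta> v" if uv: "u \<in> W" "v \<in> W" for u v
      proof -
        have "u \<in> U" "v \<in> U" using uv WU by blast+
        then have "\<iota> (\<theta> (u + v)) = \<iota> (\<theta> u) + \<iota> (\<theta> v)"
          using IsomD(3)[OF tI] \<iota>_add[OF tw[OF uv(1)] tw[OF uv(2)]] by simp
        then show ?thesis using uv subspD(2)[OF sW uv] by (simp add: \<Phi>_def)
      qed
      show "\<Phi> \<theta> (a \<star> u) = a \<star> \<Phi> \<theta> u" if u: "u \<in> W" for a u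
      proof -
        have "u \<in> U" using u WU by blast
        then have "\<iota> (\<theta> (a \<star> u)) = a \<star> \<iota> (\<theta> u)" using IsomD(4)[OF tI] \<iota>_sc[OF tw[OF u]] by simp
        then show ?thesis using u subspD(3)[OF sW u] by (simp add: \<Phi>_def)
      qed
      fix u v assume uv: "u \<in> W" "v \<in> W"
      have "B (\<iota> (\<theta> u)) (\<iota> (\<theta> v)) = B (\<theta> u) (\<theta>0 (\<iota> (\<theta> v)))" by (rule \<iota>_B[OF tw[OF uv(1)] \<iota>'(2)[OF tw[OF uv(2)]]])
      also have "\<dots> = B u v" using \<iota>'(1)[OF tw[OF uv(2)]] IsomD(5)[OF tI, of u v] uv WU by auto
      finally show "B (\<Phi> \<theta> u) (\<Phi> \<theta> v) = B u v" using uv by (simp add: \<Phi>_def)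
    qed
  qed
  have "inj_on \<Phi> \<Theta>"
  proof (rule inj_onI)
    fix \<theta> \<theta>' assume t: "\<theta> \<in> \<Theta>" "\<theta>' \<in> \<Theta>" and eq: "\<Phi> \<theta> = \<Phi> \<theta>'"
    have tI: "\<theta> \<in> Isom U" "\<theta>' \<in> Isom U" using \<Theta>(1) t by auto
    have onW: "\<theta> w = \<theta>' w" if w: "w \<in> W" for w
    proof -
      have wU: "w \<in> U" using w WU by blast
      have "\<iota> (\<theta> w) = \<iota> (\<theta>' w)" using fun_cong[OF eq, of w] w by (simp add: \<Phi>_def)
      then have "\<theta>0 (\<iota> (\<theta> w)) = \<theta>0 (\<iota> (\<theta>' w))" by simp
      then show ?thesis using \<iota>'(1)[OF IsomD(2)[OF tI(1) wU]] \<iota>'(1)[OF IsomD(2)[OF tI(2) wU]] by simp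
    qed
    show "\<theta> = \<theta>'"
    proof (rule PiE_ext[OF IsomD(1)[OF tI(1)] IsomD(1)[OF tI(2)]])
      fix u assume u: "u \<in> U"
      then obtain a where a: "a \<in> A" "u - a \<in> W" using decomp by blast
      have "u - a \<in> U" "a \<in> U" using a WU A by auto
      then have "\<theta> ((u - a) + a) = \<theta> (u - a) + \<theta> a" "\<theta>' ((u - a) + a) = \<theta>' (u - a) + \<theta>' a"
        by (rule IsomD(3)[OF tI(1)], rule IsomD(3)[OF tI(2)])
      then have "\<theta> ((u - a) + a) = \<theta>' ((u - a) + a)" using onW[OF a(2)] \<Theta>(2)[OF t a(1)] by simp
      then show "\<theta> u = \<theta>' u" by simp
    qed
  qed
  moreover have "\<Phi> ` \<Theta> \<subseteq> Isom W" using mem by blast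
  moreover have "finite (Isom W)" using finite_Isom[OF finite_subset[OF WU nd_spaceD(2)[OF U]]] .
  ultimately show ?thesis by (rule card_inj_on_le)
qed simp

definition line :: "'v \<Rightarrow> 'v set" where "line w = range (\<lambda>t. t \<star> w)"

lemma perp_line: "perp U (line w) = perp U {w}"
proof (rule subset_antisym; rule subsetI)
  fix u assume u: "u \<in> perp U (line w)"
  have "1 \<star> w \<in> line w" by (simp add: line_def)
  then show "u \<in> perp U {w}" using u by (simp add: perp_def sc_one)
qed (auto simp: perp_def line_def B_sc_right)

lemma nonisotropic_split:
  assumes U: "nd_space (Suc m) U" and w: "w \<in> U" "Q w \<noteq> 0"
  shows "nd_space m (perp U {w})" "u \<in> U \<Longrightarrow> \<exists>a\<in>line w. u - a \<in> perp U {w}"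
proof -
  note sU = nd_spaceD(1)[OF U]
  have uw: "unital w" using subspD(4)[OF sU w(1)] .
  obtain y where y: "y \<in> K" "Q w * y = e" using K_inverse[OF B_in_K(1)[OF uw] w(2)] by blast
  show dec: "\<exists>a\<in>line w. u - a \<in> perp U {w}" if u: "u \<in> U" for u
  proof (rule bexI[of _ "(B u w * y) \<star> w"])
    have "B u w * y * Q w = B u w"
      using y(2) K_unit(2)[OF B_in_K(2)[OF uw, of u]] by (simp add: mult.assoc mult.commute[of y])
    then have "B (u - (B u w * y) \<star> w) w = 0" by (simp add: B_simps)
    moreover have "u - (B u w * y) \<star> w \<in> U" by (rule subspD(5)[OF sU u subspD(3)[OF sU w(1)]])
    ultimately show "u - (B u w * y) \<star> w \<in> perp U {w}" by (simp add: perp_def)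
    show "(B u w * y) \<star> w \<in> line w" by (simp add: line_def)
  qed
  have "perp U {w} = {u \<in> U. B w u = 0}" by (auto simp: perp_def B_commute[of w])
  moreover have "w \<noteq> 0" using w(2) by auto
  ultimately have "q * card (perp U {w}) = q ^ Suc m"
    using card_hyperplane[OF U w(1) _ K_closed(1)] by simp
  then have c: "card (perp U {w}) = q ^ m" using q_pos by simp
  show "nd_space m (perp U {w})" unfolding nd_space_def
  proof (intro conjI ballI impI)
    show "subsp (perp U {w})" by (rule subsp_perp[OF sU])
    show "finite (perp U {w})" using nd_spaceD(2)[OF U] by (simp add: perp_def)
    show "card (perp U {w}) = q ^ m" by (rule c)
    fix x assume x: "x \<in> perp U {w}" "\<forall>v\<in>perp U {w}. B x v = 0"
    show "x = 0"
    proof (rule nd_spaceD(4)[OF U])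
      show "x \<in> U" using x(1) by (simp add: perp_def)
      fix u assume "u \<in> U"
      then obtain t where t: "u - t \<star> w \<in> perp U {w}" using dec by (auto simp: line_def)
      have "B x (u - t \<star> w) = 0" using x(2) t by blast
      moreover have "B x w = 0" using x(1) by (simp add: perp_def)
      ultimately show "B x u = 0" by (simp add: B_simps)
    qed
  qed
qed

lemma hyperbolic_split:
  assumes U: "nd_space (Suc (Suc m)) U" and z: "\<xi> \<in> U" "\<zeta> \<in> U" "Q \<xi> = 0" "Q \<zeta> = 0" "B \<xi> \<zeta> = e"
  shows "nd_space m (perp U {\<xi>, \<zeta>})" "u \<in> U \<Longrightarrow> u - (B u \<zeta> \<star> \<xi> + B u \<xi> \<star> \<zeta>) \<in> perp U {\<xi>, \<zeta>}"
proof -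
  note sU = nd_spaceD(1)[OF U]
  have uz: "unital \<xi>" "unital \<zeta>" using subspD(4)[OF sU] z by auto
  have z5: "B \<zeta> \<xi> = e" using z(5) by (simp add: B_commute)
  show dec: "u - (B u \<zeta> \<star> \<xi> + B u \<xi> \<star> \<zeta>) \<in> perp U {\<xi>, \<zeta>}" if u: "u \<in> U" for u
  proof -
    have "B (u - (B u \<zeta> \<star> \<xi> + B u \<xi> \<star> \<zeta>)) \<xi> = 0" "B (u - (B u \<zeta> \<star> \<xi> + B u \<xi> \<star> \<zeta>)) \<zeta> = 0"
      using K_unit(2)[OF B_in_K(2)[OF uz(1), of u]] K_unit(2)[OF B_in_K(2)[OF uz(2), of u]]
      by (simp_all add: B_simps z z5)
    moreover have "u - (B u \<zeta> \<star> \<xi> + B u \<xi> \<star> \<zeta>) \<in> U"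
      by (rule subspD(5)[OF sU u subspD(2)[OF sU subspD(3)[OF sU z(1)] subspD(3)[OF sU z(2)]]])
    ultimately show ?thesis by (simp add: perp_def)
  qed
  have xi0: "\<xi> \<noteq> 0" using z(5) e_nz by auto
  have "perp U {\<xi>} = {u \<in> U. B \<xi> u = 0}" by (auto simp: perp_def B_commute[of \<xi>])
  then have "q * card (perp U {\<xi>}) = q ^ Suc (Suc m)" using card_hyperplane[OF U z(1) xi0 K_closed(1)] by simp
  then have c1: "card (perp U {\<xi>}) = q ^ Suc m" using q_pos by simp
  have fp: "finite (perp U {\<xi>})" using nd_spaceD(2)[OF U] by (simp add: perp_def)
  \<comment> \<open>Being isotropic, \<open>\<xi>\<close> lies in its own orthogonal hyperplane,
    where it serves as the vector on which \<open>B \<zeta>\<close> takes the value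
    \<open>e\<close>.\<close>
  have "q * card {u \<in> perp U {\<xi>}. B \<zeta> u = 0} = card (perp U {\<xi>})"
    by (rule linear_fibre[OF subsp_perp[OF sU] fp, of _ \<xi>]) (use z z5 in \<open>auto simp: B_simps perp_def\<close>)
  moreover have "{u \<in> perp U {\<xi>}. B \<zeta> u = 0} = perp U {\<xi>, \<zeta>}" by (auto simp: perp_def B_commute[of \<zeta>])
  ultimately have c: "card (perp U {\<xi>, \<zeta>}) = q ^ m" using c1 q_pos by simp
  show "nd_space m (perp U {\<xi>, \<zeta>})" unfolding nd_space_def
  proof (intro conjI ballI impI)
    show "subsp (perp U {\<xi>, \<zeta>})" by (rule subsp_perp[OF sU])
    show "finite (perp U {\<xi>, \<zeta>})" using nd_spaceD(2)[OF U] by (simp add: perp_def)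
    show "card (perp U {\<xi>, \<zeta>}) = q ^ m" by (rule c)
    fix x assume x: "x \<in> perp U {\<xi>, \<zeta>}" "\<forall>v\<in>perp U {\<xi>, \<zeta>}. B x v = 0"
    show "x = 0"
    proof (rule nd_spaceD(4)[OF U])
      show "x \<in> U" using x(1) by (simp add: perp_def)
      fix u assume u: "u \<in> U"
      have "B x (u - (B u \<zeta> \<star> \<xi> + B u \<xi> \<star> \<zeta>)) = 0" using x(2) dec[OF u] by blast
      moreover have "B x \<xi> = 0" "B x \<zeta> = 0" using x(1) by (simp_all add: perp_def)
      ultimately show "B x u = 0" by (simp add: B_simps)
    qed
  qed
qed

text \<open>Moving \<open>z\<close> along the isotropic \<open>\<xi>\<close> keeps
  \<open>B \<xi> z = e\<close> and changes \<open>Q z\<close> linearly: subtracting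
  \<open>a \<star> \<xi>\<close> lowers it by \<open>2 * a\<close> for \<open>a \<in> K\<close>, so
  \<open>a = half * Q z\<close> makes it vanish.\<close>

lemma hyperbolic_partner:
  assumes U: "nd_space d U" and x: "\<xi> \<in> U" "\<xi> \<noteq> 0" "Q \<xi> = 0"
  obtains \<zeta> where "\<zeta> \<in> U" "Q \<zeta> = 0" "B \<xi> \<zeta> = e"
proof -
  note sU = nd_spaceD(1)[OF U]
  obtain z where z: "z \<in> U" "B \<xi> z = e" using nd_dual[OF U x(1,2)] .
  have zK: "Q z \<in> K" using subspD(4)[OF sU z(1)] by blast
  have hz: "half * Q z * e = half * Q z" by (rule K_unit(2)) (use half(1) in auto)
  define \<zeta> where "\<zeta> = z - (half * Q z) \<star> \<xi>"
  have "Q \<zeta> = Q z - 2 * (half * Q z * e)"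
    using x(3) z(2) by (simp add: \<zeta>_def B_simps B_commute[of z \<xi>])
  also have "\<dots> = Q z - (half + half) * Q z"
    by (simp only: hz mult_2 distrib_right)
  also have "\<dots> = 0" by (simp add: half(2) K_unit(1)[OF zK])
  finally have "Q \<zeta> = 0" .
  moreover have "\<zeta> \<in> U" unfolding \<zeta>_def by (rule subspD(5)[OF sU z(1) subspD(3)[OF sU x(1)]])
  moreover have "B \<xi> \<zeta> = e" using x(3) z(2) by (simp add: \<zeta>_def B_simps)
  ultimately show ?thesis using that by blast
qed

lemma sphere_bound:
  assumes U: "nd_space (Suc m) U" and w: "w \<in> U" "Q w \<noteq> 0"
  shows "card {v \<in> U. Q v = c} \<le> 2 * q ^ m"
proof -
  note sU = nd_spaceD(1)[OF U]
  have "q * card {v \<in> U. Q v = c} \<le> 2 * card U"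
    by (rule quadratic_zero_count[OF nd_spaceD(2)[OF U] _ subspD(4)[OF sU w(1)] w(2)])
      (rule subspD(2)[OF sU _ subspD(3)[OF sU w(1)]])
  then have "q * card {v \<in> U. Q v = c} \<le> q * (2 * q ^ m)" using nd_spaceD(3)[OF U] by simp
  then show ?thesis using q_pos by (simp only: mult_le_cancel1)
qed

lemma nonisotropic_ex:
  assumes "nd_space (Suc m) U"
  obtains w where "w \<in> U" "Q w \<noteq> 0"
  using nonsingular_direction[OF assms, of 0 "\<lambda>_. 0"] by (auto simp: nonsingular_def)

lemma choose2_Suc: "Suc m choose 2 = m + (m choose 2)"
  by (simp add: numeral_2_eq_2)

lemma Isom_line_agree:
  assumes "\<theta> \<in> Isom U" "\<theta>' \<in> Isom U" "w \<in> U" "\<theta> w = \<theta>' w" "a \<in> line w"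
  shows "\<theta> a = \<theta>' a"
  using assms(4,5) IsomD(4)[OF assms(1,3)] IsomD(4)[OF assms(2,3)] by (auto simp: line_def)

lemma nonisotropic_stabilizer:
  assumes U: "nd_space (Suc m) U" and w: "w \<in> U" "Q w \<noteq> 0"
  shows "card {\<theta> \<in> Isom U. \<theta> w = v} \<le> card (Isom (perp U {w}))"
proof (rule Isom_agree_count[OF U perp_line[symmetric]])
  show "line w \<subseteq> U" using subspD(3)[OF nd_spaceD(1)[OF U] w(1)] by (auto simp: line_def)
  show "\<exists>a\<in>line w. u - a \<in> perp U {w}" if "u \<in> U" for u by (rule nonisotropic_split(2)[OF U w that])
  show "\<theta> a = \<theta>' a" if "\<theta> \<in> {\<theta> \<in> Isom U. \<theta> w = v}" "\<theta>' \<in> {\<theta> \<in> Isom U. \<theta> w = v}" "a \<in> line w" for \<theta> \<theta>' a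
    using Isom_line_agree[of \<theta> U \<theta>' w a] that w(1) by simp
qed auto

text \<open>Induction on the dimension: a nonisotropic vector \<open>w\<close> has at most
  \<open>2 * q ^ m\<close> possible images, all of norm \<open>Q w\<close>, and the isometries with
  a given image number at most the isometries of the orthogonal complement of
  \<open>w\<close>.\<close>

lemma Isom_count: "nd_space m U \<Longrightarrow> card (Isom U) \<le> 2 ^ m * q ^ (m choose 2)"
proof (induction m arbitrary: U)
  case 0
  then have "card U = 1" by (auto simp: nd_space_def)
  then have "card (U \<rightarrow>\<^sub>E U) = 1" "finite (U \<rightarrow>\<^sub>E U)"
    using nd_spaceD(2)[OF 0] by (auto simp: card_PiE intro: finite_PiE)
  moreover have "Isom U \<subseteq> U \<rightarrow>\<^sub>E U" by (auto simp: Isom_def)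
  ultimately have "card (Isom U) \<le> 1" by (metis card_mono)
  then show ?case by (simp add: numeral_2_eq_2)
next
  case (Suc m)
  obtain w where w: "w \<in> U" "Q w \<noteq> 0" using nonisotropic_ex[OF Suc.prems] .
  let ?Y = "{v \<in> U. Q v = Q w}"
  have fY: "finite ?Y" using nd_spaceD(2)[OF Suc.prems] by simp
  have "Isom U \<subseteq> (\<Union>v\<in>?Y. {\<theta> \<in> Isom U. \<theta> w = v})"
  proof
    fix \<theta> assume t: "\<theta> \<in> Isom U"
    have "\<theta> w \<in> ?Y" using IsomD(2)[OF t w(1)] IsomD(5)[OF t w(1) w(1)] by simp
    then show "\<theta> \<in> (\<Union>v\<in>?Y. {\<theta> \<in> Isom U. \<theta> w = v})" using t by blast
  qed
  then have "card (Isom U) \<le> card (\<Union>v\<in>?Y. {\<theta> \<in> Isom U. \<theta> w = v})"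
    using fY finite_Isom[OF nd_spaceD(2)[OF Suc.prems]] by (intro card_mono) auto
  also have "\<dots> \<le> (\<Sum>v\<in>?Y. card {\<theta> \<in> Isom U. \<theta> w = v})" by (rule card_UN_le[OF fY])
  also have "\<dots> \<le> (\<Sum>v\<in>?Y. 2 ^ m * q ^ (m choose 2))"
    using nonisotropic_stabilizer[OF Suc.prems w] Suc.IH[OF nonisotropic_split(1)[OF Suc.prems w]]
    by (intro sum_mono) (rule order.trans)
  also have "\<dots> = card ?Y * (2 ^ m * q ^ (m choose 2))" by simp
  also have "\<dots> \<le> (2 * q ^ m) * (2 ^ m * q ^ (m choose 2))"
    by (rule mult_right_mono[OF sphere_bound[OF Suc.prems w]]) simp
  also have "\<dots> = 2 ^ Suc m * q ^ (Suc m choose 2)" by (simp add: choose2_Suc power_add)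
  finally show ?case .
qed

text \<open>For isotropic \<open>\<xi>\<close> the complement of \<open>\<xi>\<close> is degenerate,
  so the image of a hyperbolic partner \<open>\<zeta>\<close> is prescribed as well. It has at most
  \<open>q ^ m\<close> possibilities, and what remains is the isometry count in dimension
  \<open>m\<close>.\<close>

lemma Isom_transporter_count:
  assumes U: "nd_space (Suc (Suc m)) U" and \<xi>: "\<xi> \<in> U" "\<xi> \<noteq> 0"
  shows "card {\<theta> \<in> Isom U. \<theta> \<xi> = \<eta>} \<le> 2 ^ Suc m * q ^ (Suc m choose 2)"
proof (cases "Q \<xi> = 0")
  case False
  have "card {\<theta> \<in> Isom U. \<theta> \<xi> = \<eta>} \<le> card (Isom (perp U {\<xi>}))"
    by (rule nonisotropic_stabilizer[OF U \<xi>(1) False])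
  also have "\<dots> \<le> 2 ^ Suc m * q ^ (Suc m choose 2)"
    by (rule Isom_count[OF nonisotropic_split(1)[OF U \<xi>(1) False]])
  finally show ?thesis .
next
  case True
  note sU = nd_spaceD(1)[OF U]
  obtain \<zeta> where z: "\<zeta> \<in> U" "Q \<zeta> = 0" "B \<xi> \<zeta> = e" using hyperbolic_partner[OF U \<xi> True] .
  let ?\<Theta> = "{\<theta> \<in> Isom U. \<theta> \<xi> = \<eta>}" and ?W = "perp U {\<xi>, \<zeta>}"
  show ?thesis
  proof (cases "?\<Theta> = {}")
    case False
    then obtain \<theta>0 where t0: "\<theta>0 \<in> Isom U" "\<theta>0 \<xi> = \<eta>" by blast
    have eta: "\<eta> \<in> U" "Q \<eta> = 0" using IsomD(2)[OF t0(1) \<xi>(1)] IsomD(5)[OF t0(1) \<xi>(1) \<xi>(1)] True t0(2) by auto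
    have eta0: "\<eta> \<noteq> 0"
    proof
      assume "\<eta> = 0"
      then have "B (\<theta>0 \<xi>) (\<theta>0 \<zeta>) = 0" using t0(2) by simp
      then show False using IsomD(5)[OF t0(1) \<xi>(1) z(1)] z(3) e_nz by simp
    qed
    have ueta: "unital \<eta>" using subspD(4)[OF sU eta(1)] .
    let ?S = "{v \<in> U. B \<eta> v = e}"
    have fS: "finite ?S" using nd_spaceD(2)[OF U] by simp
    have "q * card ?S = q ^ Suc (Suc m)" by (rule card_hyperplane[OF U eta(1) eta0]) auto
    then have cS: "card ?S = q ^ Suc m" using q_pos by simp
    \<comment> \<open>On lines in the isotropic direction \<open>\<eta>\<close> inside
      \<open>?S\<close> the form \<open>Q\<close> is affine in the parameter with slope two, so it
      has at most one zero on each.\<close>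
    have "q * card {v \<in> ?S. Q v = 0} \<le> 1 * card ?S"
    proof (rule line_count[where w = \<eta>, OF fS])
      show "s + t \<star> \<eta> \<in> ?S" if "s \<in> ?S" for s t
        using that subspD(2,3)[OF sU] eta by (simp add: B_simps)
      fix s assume s: "s \<in> ?S"
      have us: "unital s" using subspD(4)[OF sU] s by blast
      have uniq: "t = t'" if "t \<in> {t \<in> K. Q (s + t \<star> \<eta>) = 0}" "t' \<in> {t \<in> K. Q (s + t \<star> \<eta>) = 0}" for t t'
      proof -
        have Qt: "Q (s + r \<star> \<eta>) = Q s + (r + r)" if "r \<in> K" for r
          using s eta(2) K_unit(2)[OF that] by (simp add: B_simps B_commute[of s \<eta>])
        have "Q s + (t + t) = Q s + (t' + t')" using Qt[of t] Qt[of t'] that by simp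
        then have "t + t = t' + t'" by (simp only: add_left_cancel)
        then have "half * (t + t) = half * (t' + t')" by (simp only:)
        moreover have "t \<in> K" "t' \<in> K" using that by simp_all
        ultimately show ?thesis by (simp only: half_cancel)
      qed
      have fT: "finite {t \<in> K. Q (s + t \<star> \<eta>) = 0}" by simp
      from card_le_Suc0_iff_eq[OF fT] have "card {t \<in> K. Q (s + t \<star> \<eta>) = 0} \<le> Suc 0"
        using uniq by blast
      then show "card {t \<in> K. Q (s + t \<star> \<eta>) = 0} \<le> 1" by simp
    qed
    then have "q * card {v \<in> ?S. Q v = 0} \<le> q * q ^ m" using cS by simp
    then have cY: "card {v \<in> ?S. Q v = 0} \<le> q ^ m" using q_pos by (simp only: mult_le_cancel1)
    let ?Y = "{v \<in> ?S. Q v = 0}"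
    have fY: "finite ?Y" by (rule finite_subset[OF _ fS]) auto
    have split: "card {\<theta> \<in> ?\<Theta>. \<theta> \<zeta> = v} \<le> card (Isom ?W)" for v
    proof (rule Isom_agree_count[OF U, where A = "{a \<star> \<xi> + b \<star> \<zeta> | a b. True}"])
      show "?W = perp U {a \<star> \<xi> + b \<star> \<zeta> | a b. True}"
      proof (rule subset_antisym; rule subsetI)
        fix u assume u: "u \<in> perp U {a \<star> \<xi> + b \<star> \<zeta> | a b. True}"
        then have "B u (1 \<star> \<xi> + 0 \<star> \<zeta>) = 0" "B u (0 \<star> \<xi> + 1 \<star> \<zeta>) = 0" unfolding perp_def by blast+
        then show "u \<in> ?W" using u by (simp add: perp_def sc_one)
      qed (auto simp: perp_def B_simps)
      show "{a \<star> \<xi> + b \<star> \<zeta> | a b. True} \<subseteq> U"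
        using subspD(2)[OF sU subspD(3)[OF sU \<xi>(1)] subspD(3)[OF sU z(1)]] by blast
      show "\<exists>a\<in>{a \<star> \<xi> + b \<star> \<zeta> | a b. True}. u - a \<in> ?W" if "u \<in> U" for u
        using hyperbolic_split(2)[OF U \<xi>(1) z(1) True z(2,3) that] by blast
      fix \<theta> \<theta>' c assume t: "\<theta> \<in> {\<theta> \<in> ?\<Theta>. \<theta> \<zeta> = v}" "\<theta>' \<in> {\<theta> \<in> ?\<Theta>. \<theta> \<zeta> = v}" "c \<in> {a \<star> \<xi> + b \<star> \<zeta> | a b. True}"
      then obtain a b where c: "c = a \<star> \<xi> + b \<star> \<zeta>" by blast
      have lin: "\<phi> c = a \<star> \<phi> \<xi> + b \<star> \<phi> \<zeta>" if "\<phi> \<in> Isom U" for \<phi>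
        using IsomD(3)[OF that subspD(3)[OF sU \<xi>(1)] subspD(3)[OF sU z(1)]] IsomD(4)[OF that \<xi>(1)] IsomD(4)[OF that z(1)]
        by (simp add: c)
      show "\<theta> c = \<theta>' c" using lin[of \<theta>] lin[of \<theta>'] t(1,2) by simp
    qed auto
    have "?\<Theta> \<subseteq> (\<Union>v\<in>?Y. {\<theta> \<in> ?\<Theta>. \<theta> \<zeta> = v})"
    proof
      fix \<theta> assume t: "\<theta> \<in> ?\<Theta>"
      then have tI: "\<theta> \<in> Isom U" by blast
      have "\<theta> \<zeta> \<in> ?Y" using t IsomD(2)[OF tI z(1)] IsomD(5)[OF tI z(1) z(1)] IsomD(5)[OF tI \<xi>(1) z(1)] z by auto
      then show "\<theta> \<in> (\<Union>v\<in>?Y. {\<theta> \<in> ?\<Theta>. \<theta> \<zeta> = v})" using t by blast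
    qed
    then have "card ?\<Theta> \<le> card (\<Union>v\<in>?Y. {\<theta> \<in> ?\<Theta>. \<theta> \<zeta> = v})"
      using fY finite_Isom[OF nd_spaceD(2)[OF U]] by (intro card_mono) auto
    also have "\<dots> \<le> (\<Sum>v\<in>?Y. card {\<theta> \<in> ?\<Theta>. \<theta> \<zeta> = v})" by (rule card_UN_le[OF fY])
    also have "\<dots> \<le> (\<Sum>v\<in>?Y. 2 ^ m * q ^ (m choose 2))"
      using split Isom_count[OF hyperbolic_split(1)[OF U \<xi>(1) z(1) True z(2,3)]]
      by (intro sum_mono) (rule order.trans)
    also have "\<dots> = card ?Y * (2 ^ m * q ^ (m choose 2))" by simp
    also have "\<dots> \<le> q ^ m * (2 ^ m * q ^ (m choose 2))" by (rule mult_right_mono[OF cY]) simp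
    also have "\<dots> \<le> 2 ^ Suc m * q ^ (Suc m choose 2)" by (simp add: choose2_Suc power_add)
    finally show ?thesis .
  next
    case True
    show ?thesis unfolding True by simp
  qed
qed

end

section \<open>Incidences under rigid motions and the case of dimension \<open>k\<close>\<close>

context form_space
begin

definition incidences :: "'v set \<Rightarrow> ('v \<Rightarrow> 'v) \<Rightarrow> 'v \<Rightarrow> nat" where
  "incidences E \<theta> z = card {v \<in> E. z + \<theta> v \<in> E}"

lemma translate_bij: "subsp U \<Longrightarrow> z \<in> U \<Longrightarrow> bij_betw (\<lambda>u. z + u) U U"
  by (rule bij_betw_byWitness[where f' = "\<lambda>u. u - z"]) (auto dest: subspD)

text \<open>A correlation becomes a product. Evaluating at the frequency
  \<open>\<theta> \<eta>\<close> lets the isometry be cancelled in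
  \<open>B (\<theta> v) (\<theta> \<eta>)\<close>, so the second factor is the transform at
  \<open>\<eta>\<close> itself.\<close>

lemma fourier_twisted_correlation:
  assumes U: "nd_space d U" and \<theta>: "\<theta> \<in> Isom U" and \<eta>: "\<eta> \<in> U"
  shows "fourier U (\<lambda>z. \<Sum>v\<in>U. f (z + \<theta> v) * f v) (\<theta> \<eta>) = fourier U f (\<theta> \<eta>) * cnj (fourier U f \<eta>)"
proof -
  note sU = nd_spaceD(1)[OF U]
  have tU: "\<theta> v \<in> U" if "v \<in> U" for v using IsomD(2)[OF \<theta> that] .
  have BK: "B w (\<theta> \<eta>) \<in> K" for w using subspD(4)[OF sU tU[OF \<eta>]] by blast
  have inner: "(\<Sum>z\<in>U. of_real (f (z + \<theta> v)) * chi (B z (\<theta> \<eta>))) = fourier U f (\<theta> \<eta>) * cnj (chi (B v \<eta>))"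
    if v: "v \<in> U" for v
  proof -
    have "(\<Sum>z\<in>U. of_real (f (z + \<theta> v)) * chi (B z (\<theta> \<eta>)))
        = (\<Sum>z\<in>U. (\<lambda>w. of_real (f w) * chi (B (w - \<theta> v) (\<theta> \<eta>))) (\<theta> v + z))"
      by (simp add: add.commute)
    also have "\<dots> = (\<Sum>w\<in>U. of_real (f w) * chi (B (w - \<theta> v) (\<theta> \<eta>)))"
      by (rule sum.reindex_bij_betw[OF translate_bij[OF sU tU[OF v]]])
    also have "\<dots> = (\<Sum>w\<in>U. of_real (f w) * chi (B w (\<theta> \<eta>)) * cnj (chi (B v \<eta>)))"
    proof (rule sum.cong[OF refl])
      fix w
      have "chi (B (w - \<theta> v) (\<theta> \<eta>)) = chi (B w (\<theta> \<eta>)) * cnj (chi (B (\<theta> v) (\<theta> \<eta>)))"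
        unfolding B_diff by (rule chi_diff[OF BK BK])
      then show "of_real (f w) * chi (B (w - \<theta> v) (\<theta> \<eta>)) = of_real (f w) * chi (B w (\<theta> \<eta>)) * cnj (chi (B v \<eta>))"
        by (simp add: IsomD(5)[OF \<theta> v \<eta>])
    qed
    finally show ?thesis by (simp add: fourier_def sum_distrib_right)
  qed
  have "fourier U (\<lambda>z. \<Sum>v\<in>U. f (z + \<theta> v) * f v) (\<theta> \<eta>)
      = (\<Sum>z\<in>U. \<Sum>v\<in>U. of_real (f v) * (of_real (f (z + \<theta> v)) * chi (B z (\<theta> \<eta>))))"
    by (simp add: fourier_def sum_distrib_left sum_distrib_right mult_ac)
  also have "\<dots> = (\<Sum>v\<in>U. of_real (f v) * (\<Sum>z\<in>U. of_real (f (z + \<theta> v)) * chi (B z (\<theta> \<eta>))))"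
    by (subst sum.swap) (simp add: sum_distrib_left)
  also have "\<dots> = (\<Sum>v\<in>U. of_real (f v) * (fourier U f (\<theta> \<eta>) * cnj (chi (B v \<eta>))))"
    by (intro sum.cong refl) (simp add: inner)
  also have "\<dots> = fourier U f (\<theta> \<eta>) * cnj (fourier U f \<eta>)"
    by (simp add: fourier_def[of U f \<eta>] sum_distrib_left mult_ac)
  finally show ?thesis .
qed

text \<open>For fixed \<open>\<theta>\<close> Parseval turns the sum over \<open>z\<close> into a
  sum of \<open>a (\<theta> \<eta>) * a \<eta>\<close>. Summing over \<open>\<theta>\<close> first,
  every frequency is hit by a given nonzero \<open>\<eta>\<close> at most \<open>S\<close> times.
  Both factors then become full sums of \<open>a\<close>, at most \<open>D * N\<close> each.\<close>

lemma twisted_variance: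
  assumes U: "nd_space d U" and E: "E \<subseteq> U"
    and S: "\<And>\<xi> \<eta>. \<xi> \<in> U \<Longrightarrow> \<xi> \<noteq> 0 \<Longrightarrow> card {\<theta> \<in> Isom U. \<theta> \<xi> = \<eta>} \<le> S"
  shows "(\<Sum>\<theta>\<in>Isom U. \<Sum>z\<in>U. (real (incidences E \<theta> z) - (real (card E))\<^sup>2 / real q ^ d)\<^sup>2)
    \<le> S * real q ^ d * (real (card E))\<^sup>2"
proof -
  note sU = nd_spaceD(1)[OF U] and fU = nd_spaceD(2)[OF U]
  have fE: "finite E" using finite_subset[OF E fU] .
  define N where "N = real (card E)"
  define D where "D = real q ^ d"
  have D: "D > 0" by (simp add: D_def)
  have cU: "real (card U) = D" by (simp add: D_def nd_spaceD(3)[OF U])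
  define ind where "ind u = (if u \<in> E then 1 else 0 :: real)" for u
  \<comment> \<open>Subtracting the density centres the correlation at the mean number of
    incidences. It also makes the transform vanish at frequency zero, the one frequency that the
    hypothesis on \<open>S\<close> leaves out.\<close>
  define f where "f u = ind u - N / D" for u
  have UE: "U \<inter> E = E" using E by blast
  have sum_ind: "(\<Sum>u\<in>U. ind u) = N" using fU by (simp add: ind_def sum.If_cases UE N_def)
  have sumf: "(\<Sum>u\<in>U. f u) = 0" using D by (simp add: f_def sum_subtractf sum_ind cU)
  have "(\<Sum>u\<in>U. (f u)\<^sup>2) = (\<Sum>u\<in>U. ind u - 2 * (N / D) * ind u + (N / D)\<^sup>2)"
    by (intro sum.cong refl) (simp add: f_def ind_def power2_eq_square algebra_simps)
  also have "\<dots> = N - 2 * (N / D) * N + D * (N / D)\<^sup>2"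
    by (simp only: sum.distrib sum_subtractf sum_distrib_left[symmetric] sum_ind) (simp add: cU)
  also have "\<dots> = N - N\<^sup>2 / D" using D by (simp add: power2_eq_square field_simps)
  also have "\<dots> \<le> N" using D by simp
  finally have sumf2: "(\<Sum>u\<in>U. (f u)\<^sup>2) \<le> N" .
  define g where "g \<theta> z = (\<Sum>v\<in>U. f (z + \<theta> v) * f v)" for \<theta> z
  have g: "g \<theta> z = real (incidences E \<theta> z) - N\<^sup>2 / D" if t: "\<theta> \<in> Isom U" and z: "z \<in> U" for \<theta> z
  proof -
    have "(\<Sum>v\<in>U. ind (z + \<theta> v)) = (\<Sum>u\<in>U. ind (z + u))"
      by (rule sum.reindex_bij_betw[OF Isom_bij[OF U t]])
    also have "\<dots> = (\<Sum>u\<in>U. ind u)" by (rule sum.reindex_bij_betw[OF translate_bij[OF sU z]])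
    finally have s1: "(\<Sum>v\<in>U. ind (z + \<theta> v)) = N" by (simp add: sum_ind)
    have "(\<Sum>v\<in>U. ind (z + \<theta> v) * ind v) = (\<Sum>v\<in>U. if v \<in> {v \<in> E. z + \<theta> v \<in> E} then 1 else 0)"
      by (intro sum.cong refl) (simp add: ind_def)
    moreover have "U \<inter> {v \<in> E. z + \<theta> v \<in> E} = {v \<in> E. z + \<theta> v \<in> E}" using E by blast
    ultimately have s2: "(\<Sum>v\<in>U. ind (z + \<theta> v) * ind v) = real (incidences E \<theta> z)"
      using fU by (simp only: sum.If_cases incidences_def) simp
    have "g \<theta> z = (\<Sum>v\<in>U. ind (z + \<theta> v) * ind v - N / D * ind (z + \<theta> v) - N / D * ind v + (N / D)\<^sup>2)"
      unfolding g_def by (intro sum.cong refl) (simp add: f_def power2_eq_square algebra_simps)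
    also have "\<dots> = real (incidences E \<theta> z) - N / D * N - N / D * N + D * (N / D)\<^sup>2"
      by (simp only: sum.distrib sum_subtractf sum_distrib_left[symmetric] s1 s2 sum_ind) (simp add: cU)
    also have "\<dots> = real (incidences E \<theta> z) - N\<^sup>2 / D" using D by (simp add: power2_eq_square field_simps)
    finally show ?thesis .
  qed
  define a where "a \<xi> = (cmod (fourier U f \<xi>))\<^sup>2" for \<xi>
  have a0: "a \<xi> \<ge> 0" for \<xi> by (simp add: a_def)
  have "fourier U f 0 = of_real (\<Sum>u\<in>U. f u)" by (simp add: fourier_def)
  then have az: "a 0 = 0" by (simp add: a_def sumf)
  have suma: "(\<Sum>\<xi>\<in>U. a \<xi>) \<le> D * N"
    unfolding a_def parseval[OF U] using sumf2 D by (simp add: D_def)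
  have suma0: "(\<Sum>\<xi>\<in>U. a \<xi>) \<ge> 0" by (rule sum_nonneg) (rule a0)
  have fixed: "D * (\<Sum>z\<in>U. (g \<theta> z)\<^sup>2) = (\<Sum>\<eta>\<in>U. a (\<theta> \<eta>) * a \<eta>)" if t: "\<theta> \<in> Isom U" for \<theta>
  proof -
    have "D * (\<Sum>z\<in>U. (g \<theta> z)\<^sup>2) = (\<Sum>\<xi>\<in>U. (cmod (fourier U (g \<theta>) \<xi>))\<^sup>2)"
      unfolding D_def by (rule parseval[OF U, symmetric])
    also have "\<dots> = (\<Sum>\<eta>\<in>U. (cmod (fourier U (g \<theta>) (\<theta> \<eta>)))\<^sup>2)"
      by (rule sum.reindex_bij_betw[OF Isom_bij[OF U t], symmetric])
    also have "\<dots> = (\<Sum>\<eta>\<in>U. a (\<theta> \<eta>) * a \<eta>)"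
    proof (rule sum.cong[OF refl])
      fix \<eta> assume e: "\<eta> \<in> U"
      have "fourier U (g \<theta>) (\<theta> \<eta>) = fourier U f (\<theta> \<eta>) * cnj (fourier U f \<eta>)"
        unfolding g_def by (rule fourier_twisted_correlation[OF U t e])
      then show "(cmod (fourier U (g \<theta>) (\<theta> \<eta>)))\<^sup>2 = a (\<theta> \<eta>) * a \<eta>"
        by (simp add: a_def norm_mult power_mult_distrib)
    qed
    finally show ?thesis .
  qed
  have "D * (\<Sum>\<theta>\<in>Isom U. \<Sum>z\<in>U. (g \<theta> z)\<^sup>2) = (\<Sum>\<theta>\<in>Isom U. \<Sum>\<eta>\<in>U. a (\<theta> \<eta>) * a \<eta>)"
    unfolding sum_distrib_left[of D "\<lambda>\<theta>. \<Sum>z\<in>U. (g \<theta> z)\<^sup>2"] by (rule sum.cong[OF refl]) (rule fixed)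
  also have "\<dots> = (\<Sum>\<eta>\<in>U. (\<Sum>\<theta>\<in>Isom U. a (\<theta> \<eta>)) * a \<eta>)"
    by (subst sum.swap) (simp add: sum_distrib_right)
  also have "\<dots> \<le> (\<Sum>\<eta>\<in>U. (real S * (\<Sum>\<xi>\<in>U. a \<xi>)) * a \<eta>)"
  proof (rule sum_mono)
    fix \<eta> assume e: "\<eta> \<in> U"
    show "(\<Sum>\<theta>\<in>Isom U. a (\<theta> \<eta>)) * a \<eta> \<le> (real S * (\<Sum>\<xi>\<in>U. a \<xi>)) * a \<eta>"
    proof (cases "\<eta> = 0")
      case False
      have "(\<Sum>\<theta>\<in>Isom U. a (\<theta> \<eta>)) \<le> real S * (\<Sum>\<xi>\<in>U. a \<xi>)"
        using IsomD(2) e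
        by (intro sum_fibre_le[OF finite_Isom[OF fU] fU, where g = "\<lambda>\<theta>. \<theta> \<eta>"] S[OF e False] a0) auto
      then show ?thesis by (rule mult_right_mono) (rule a0)
    qed (simp add: az)
  qed
  also have "\<dots> = real S * ((\<Sum>\<xi>\<in>U. a \<xi>) * (\<Sum>\<xi>\<in>U. a \<xi>))"
    by (simp add: sum_distrib_left[symmetric] mult.assoc)
  also have "\<dots> \<le> real S * ((D * N) * (D * N))"
    using suma suma0 by (intro mult_left_mono mult_mono) auto
  finally have "D * (\<Sum>\<theta>\<in>Isom U. \<Sum>z\<in>U. (g \<theta> z)\<^sup>2) \<le> D * (real S * D * N\<^sup>2)"
    by (simp add: power2_eq_square mult_ac)
  then have "(\<Sum>\<theta>\<in>Isom U. \<Sum>z\<in>U. (g \<theta> z)\<^sup>2) \<le> real S * D * N\<^sup>2"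
    using D by (simp only: mult_le_cancel_left_pos)
  then show ?thesis using g by (simp add: N_def D_def)
qed

text \<open>The number of vectors equals the dimension, so both tuples are bases. Copying
  coordinates from one to the other is linear, and equality of the Gram matrices makes it preserve
  \<open>B\<close>.\<close>

lemma gram_eq_isometry:
  assumes U: "nd_space d U" and v: "nonsingular d v" "nonsingular d v'" "\<And>i. i < d \<Longrightarrow> v i \<in> U" "\<And>i. i < d \<Longrightarrow> v' i \<in> U"
    and eq: "\<And>i l. i < d \<Longrightarrow> l < d \<Longrightarrow> B (v i) (v l) = B (v' i) (v' l)"
  obtains \<theta> where "\<theta> \<in> Isom U" "\<And>i. i < d \<Longrightarrow> \<theta> (v i) = v' i"
proof -
  note sU = nd_spaceD(1)[OF U]
  define co where "co u = (SOME c. (\<forall>i<d. c i \<in> K) \<and> u = lincomb d c v)" for u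
  have co: "\<And>i. i < d \<Longrightarrow> co u i \<in> K" "u = lincomb d (co u) v" if u: "u \<in> U" for u
  proof -
    have "\<exists>c. (\<forall>i<d. c i \<in> K) \<and> u = lincomb d c v" using nonsingular_basis[OF U v(1,3) u] by metis
    then have "(\<forall>i<d. co u i \<in> K) \<and> u = lincomb d (co u) v" unfolding co_def by (rule someI_ex)
    then show "\<And>i. i < d \<Longrightarrow> co u i \<in> K" "u = lincomb d (co u) v" by auto
  qed
  define \<theta> where "\<theta> = (\<lambda>u\<in>U. lincomb d (co u) v')"
  have \<theta>: "\<theta> (lincomb d c v) = lincomb d c v'" if c: "\<And>i. i < d \<Longrightarrow> c i \<in> K" for c
  proof -
    have cU: "lincomb d c v \<in> U" by (rule lincomb_in[OF sU v(3)])
    have "co (lincomb d c v) i = c i" if "i < d" for i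
      by (rule nonsingular_inj[OF v(1) _ _ _ that]) (use co(1)[OF cU] c co(2)[OF cU, symmetric] in auto)
    then have "lincomb d (co (lincomb d c v)) v' = lincomb d c v'" by (intro lincomb_cong) auto
    then show ?thesis using cU by (simp add: \<theta>_def)
  qed
  have "\<theta> \<in> Isom U" unfolding Isom_def
  proof (intro CollectI conjI ballI allI)
    show "\<theta> \<in> U \<rightarrow>\<^sub>E U" using lincomb_in[OF sU v(4)] by (auto simp: \<theta>_def)
    fix u assume u: "u \<in> U"
    have uc: "u = lincomb d (co u) v" using co(2)[OF u] .
    have tu: "\<theta> u = lincomb d (co u) v'" using u by (simp add: \<theta>_def)
    show "\<theta> (a \<star> u) = a \<star> \<theta> u" for a
    proof -
      have "\<theta> (lincomb d (\<lambda>i. a * co u i) v) = lincomb d (\<lambda>i. a * co u i) v'" by (rule \<theta>) (use co(1)[OF u] in auto)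
      then show ?thesis unfolding lincomb_scale using uc tu by simp
    qed
    fix w assume w: "w \<in> U"
    have wc: "w = lincomb d (co w) v" using co(2)[OF w] .
    have tw: "\<theta> w = lincomb d (co w) v'" using w by (simp add: \<theta>_def)
    have "\<theta> (lincomb d (\<lambda>i. co u i + co w i) v) = lincomb d (\<lambda>i. co u i + co w i) v'"
      by (rule \<theta>) (use co(1)[OF u] co(1)[OF w] in auto)
    then show "\<theta> (u + w) = \<theta> u + \<theta> w" unfolding lincomb_add using uc wc tu tw by simp
    have "B (lincomb d (co u) v') (lincomb d (co w) v') = B (lincomb d (co u) v) (lincomb d (co w) v)"
      unfolding B_lincomb_lincomb using eq by (intro sum.cong refl) simp
    then show "B (\<theta> u) (\<theta> w) = B u w" using uc wc tu tw by simp
  qed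
  moreover have "\<theta> (v i) = v' i" if i: "i < d" for i
  proof -
    define c where "c l = (if l = i then e else 0)" for l
    have *: "lincomb d c x = e \<star> x i" for x :: "nat \<Rightarrow> 'v"
    proof -
      have "lincomb d c x = (\<Sum>l<d. if l = i then e \<star> x l else 0)"
        unfolding lincomb_def by (intro sum.cong refl) (simp add: c_def)
      then show ?thesis using i by simp
    qed
    have "\<theta> (lincomb d c v) = lincomb d c v'" by (rule \<theta>) (auto simp: c_def)
    moreover have "e \<star> v i = v i" "e \<star> v' i = v' i"
      using subspD(4)[OF sU v(3)[OF i]] subspD(4)[OF sU v(4)[OF i]] by (simp_all add: unital_def)
    ultimately show ?thesis unfolding * by simp
  qed
  ultimately show ?thesis using that by blast
qed

text \<open>Two simplices with equal Gram matrices differ by some motion with parts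
  \<open>\<theta>\<close> and \<open>z\<close>. All \<open>d + 1\<close> vertices of the first then
  lie among the points of \<open>E\<close> that this motion sends into \<open>E\<close>.\<close>

lemma gram_pairs_le_moment:
  assumes U: "nd_space d U" and E: "E \<subseteq> U"
  shows "card {(x, x') \<in> nonsingular_simplices d E \<times> nonsingular_simplices d E. gram d x = gram d x'}
    \<le> (\<Sum>\<theta>\<in>Isom U. \<Sum>z\<in>U. incidences E \<theta> z ^ Suc d)"
proof -
  note sU = nd_spaceD(1)[OF U] and fU = nd_spaceD(2)[OF U]
  have fE: "finite E" using finite_subset[OF E fU] .
  have fI: "finite (Isom U)" by (rule finite_Isom[OF fU])
  define X where "X p = {0..d} \<rightarrow>\<^sub>E {v \<in> E. snd p + fst p v \<in> E}" for p
  let ?S = "Sigma (Isom U \<times> U) X"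
  let ?h = "\<lambda>(p, x). (x, \<lambda>i\<in>{0..d}. snd p + fst p (x i))"
  have fX: "finite (X p)" for p unfolding X_def using fE by (intro finite_PiE) auto
  have "{(x, x') \<in> nonsingular_simplices d E \<times> nonsingular_simplices d E. gram d x = gram d x'} \<subseteq> ?h ` ?S"
  proof clarify
    fix x x' assume x: "x \<in> nonsingular_simplices d E" "x' \<in> nonsingular_simplices d E" and eq: "gram d x = gram d x'"
    have xE: "x i \<in> E" "x' i \<in> E" if "i \<le> d" for i using x that by (auto simp: nonsingular_simplices_def PiE_iff)
    have xU: "x i \<in> U" "x' i \<in> U" if "i \<le> d" for i using xE[OF that] E by auto
    have eU: "edges x i \<in> U" "edges x' i \<in> U" if "i < d" for i
      using subspD(5)[OF sU] xU that by (simp_all add: edges_def)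
    obtain \<theta> where \<theta>: "\<theta> \<in> Isom U" "\<And>i. i < d \<Longrightarrow> \<theta> (edges x i) = edges x' i"
      using gram_eq_isometry[OF U, of "edges x" "edges x'"] x eU gramD[OF eq] by (auto simp: nonsingular_simplices_def)
    define z where "z = x' 0 - \<theta> (x 0)"
    have zU: "z \<in> U" unfolding z_def by (rule subspD(5)[OF sU xU(2) IsomD(2)[OF \<theta>(1) xU(1)]]) auto
    have eq': "x' i = z + \<theta> (x i)" if i: "i \<le> d" for i
    proof (cases i)
      case 0
      then show ?thesis by (simp add: z_def)
    next
      case (Suc m)
      then have m: "m < d" using i by simp
      have "\<theta> (edges x m + x 0) = edges x' m + \<theta> (x 0)"
        using IsomD(3)[OF \<theta>(1) eU(1)[OF m] xU(1)] \<theta>(2)[OF m] by simp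
      then show ?thesis using Suc by (simp add: edges_def z_def)
    qed
    have "x \<in> X (\<theta>, z)" using x(1) xE eq' by (auto simp: X_def nonsingular_simplices_def PiE_iff)
    moreover have "x' = (\<lambda>i\<in>{0..d}. z + \<theta> (x i))"
      by (rule PiE_ext[of x' "{0..d}" "\<lambda>_. E"])
        (use x(2) xE eq' in \<open>auto simp: nonsingular_simplices_def\<close>)
    ultimately show "(x, x') \<in> ?h ` ?S"
      using \<theta>(1) zU by (intro image_eqI[of _ _ "((\<theta>, z), x)"]) auto
  qed
  then have "card {(x, x') \<in> nonsingular_simplices d E \<times> nonsingular_simplices d E. gram d x = gram d x'} \<le> card ?S"
    by (rule surj_card_le[rotated]) (use fI fU fX in auto)
  also have "\<dots> = (\<Sum>p\<in>Isom U \<times> U. card (X p))" using fI fU fX by (intro card_SigmaI) auto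
  also have "\<dots> = (\<Sum>p\<in>Isom U \<times> U. incidences E (fst p) (snd p) ^ Suc d)"
    by (simp add: X_def card_PiE incidences_def)
  also have "\<dots> = (\<Sum>\<theta>\<in>Isom U. \<Sum>z\<in>U. incidences E \<theta> z ^ Suc d)"
    by (simp add: sum.cartesian_product case_prod_unfold)
  finally show ?thesis .
qed

lemma two_choose2: "2 * (Suc d choose 2) = d * (d + 1)"
  by (induction d) (simp_all add: choose2_Suc)

text \<open>The condition on \<open>q ^ (d * d + 1)\<close> says precisely that the deviation part
  of the moment is at most of the order of its mean part. The other size condition makes nonsingular
  simplices a positive proportion of all tuples.\<close>

theorem even_base:
  assumes U: "nd_space d U" and E: "E \<subseteq> U" and d: "2 \<le> d"
    and large: "4 * q ^ d \<le> q * card E" "real q ^ (d * d + 1) \<le> real (card E) ^ Suc d"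
  shows "real q ^ (Suc d choose 2) / (8 ^ d * (2 ^ Suc d + 4)) \<le> card (gram d ` nonsingular_simplices d E)"
proof -
  obtain m where m: "d = Suc (Suc m)" using d by (metis add_2_eq_Suc le_Suc_ex)
  note fU = nd_spaceD(2)[OF U]
  have fE: "finite E" using finite_subset[OF E fU] .
  define N where "N = real (card E)"
  define \<mu> where "\<mu> = N\<^sup>2 / real q ^ d"
  define t where "t = Suc d choose 2"
  define s where "s = Suc m choose 2"
  \<comment> \<open>This is the order of the number of congruent pairs expected if all
    \<open>q ^ t\<close> classes were hit equally often. It arises since there are about
    \<open>q ^ t\<close> motions, each with about \<open>\<mu>\<close> incidences.\<close>
  define X where "X = N ^ (2 * Suc d) / real q ^ t"
  define T where "T = nonsingular_simplices d E"
  define \<Lambda> where "\<Lambda> = real (card {(x, x') \<in> T \<times> T. gram d x = gram d x'})"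
  have q: "real q > 0" by simp
  have "0 < 4 * q ^ d" by simp
  then have "0 < q * card E" using large(1) by (rule less_le_trans)
  then have N: "N > 0" by (simp add: N_def)
  have dc: "d choose 2 = Suc m + s" by (simp add: m s_def choose2_Suc[of "Suc m"])
  have t: "t = d + (d choose 2)" by (simp add: t_def choose2_Suc)
  have t2: "t + t = d * Suc d" using two_choose2[of d] by (simp add: t_def)
  \<comment> \<open>The summands are the exponents of the transporter bound, of the translations and
    of the denominator of \<open>X\<close>; their total is the exponent in the size
    hypothesis.\<close>
  have e1: "s + d + t = d * d + 1" using t2 t dc m by simp
  have fT: "finite T" unfolding T_def by (rule finite_nonsingular_simplices[OF fE])
  have "card E ^ Suc d \<le> 2 ^ d * card T" unfolding T_def by (rule nonsingular_simplices_count[OF U E large(1)]) simp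
  then have "real (card E ^ Suc d) \<le> real (2 ^ d * card T)" by (simp only: of_nat_le_iff)
  then have cT: "N ^ Suc d / 2 ^ d \<le> card T" by (simp add: N_def field_simps)
  have rN: "incidences E \<theta> z \<le> N" for \<theta> z unfolding incidences_def N_def by (intro of_nat_mono card_mono fE) auto
  have cI: "real (card (Isom U)) \<le> 2 ^ d * real q ^ (d choose 2)"
  proof -
    have "real (card (Isom U)) \<le> real (2 ^ d * q ^ (d choose 2))" by (intro of_nat_mono Isom_count[OF U])
    then show ?thesis by simp
  qed
  have first: "card (Isom U) * (real q ^ d * (2 ^ Suc d * \<mu> ^ Suc d)) \<le> 2 ^ d * 2 ^ Suc d * X"
  proof -
    have "card (Isom U) * (real q ^ d * (2 ^ Suc d * \<mu> ^ Suc d))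
        \<le> (2 ^ d * real q ^ (d choose 2)) * (real q ^ d * (2 ^ Suc d * \<mu> ^ Suc d))"
      by (rule mult_right_mono[OF cI]) (simp add: \<mu>_def)
    also have "\<dots> = 2 ^ d * 2 ^ Suc d * (real q ^ t * \<mu> ^ Suc d)"
      unfolding t by (simp only: power_add mult_ac)
    also have "real q ^ t * \<mu> ^ Suc d = X"
    proof -
      have "\<mu> ^ Suc d = N ^ (2 * Suc d) / real q ^ (t + t)"
        unfolding \<mu>_def t2 power_divide by (simp only: power_mult[symmetric])
      then show ?thesis using q by (simp add: X_def power_add)
    qed
    finally show ?thesis .
  qed
  have second: "4 * N ^ Suc m * (real (2 ^ Suc m * q ^ s) * real q ^ d * N\<^sup>2) \<le> 2 ^ d * 4 * X"
  proof -
    have "real q ^ s * real q ^ d * N ^ Suc d * real q ^ t = real q ^ (s + d + t) * N ^ Suc d"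
      by (simp only: power_add mult_ac)
    also have "\<dots> \<le> N ^ Suc d * N ^ Suc d"
      unfolding e1 using large(2) N by (intro mult_right_mono) (auto simp: N_def)
    also have "\<dots> = N ^ (2 * Suc d)" by (simp only: mult_2 power_add)
    finally have "real q ^ s * real q ^ d * N ^ Suc d \<le> X" using q by (simp add: X_def pos_le_divide_eq)
    then have "4 * 2 ^ Suc m * (real q ^ s * real q ^ d * N ^ Suc d) \<le> 4 * 2 ^ Suc m * X" by simp
    also have "\<dots> \<le> 2 ^ d * 4 * X" by (rule mult_right_mono) (use N q in \<open>simp_all add: m X_def\<close>)
    finally show ?thesis by (simp add: m power2_eq_square mult_ac)
  qed
  have "\<Lambda> \<le> (\<Sum>\<theta>\<in>Isom U. \<Sum>z\<in>U. real (incidences E \<theta> z) ^ Suc d)"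
  proof -
    have "\<Lambda> \<le> real (\<Sum>\<theta>\<in>Isom U. \<Sum>z\<in>U. incidences E \<theta> z ^ Suc d)"
      unfolding \<Lambda>_def T_def by (rule of_nat_mono[OF gram_pairs_le_moment[OF U E]])
    then show ?thesis by simp
  qed
  also have "\<dots> \<le> (\<Sum>\<theta>\<in>Isom U. \<Sum>z\<in>U. 2 ^ Suc d * \<mu> ^ Suc d + 4 * N ^ Suc m * (real (incidences E \<theta> z) - \<mu>)\<^sup>2)"
  proof (intro sum_mono)
    fix \<theta> z
    have "real (incidences E \<theta> z) ^ (Suc m + 2)
        \<le> 2 ^ (Suc m + 2) * \<mu> ^ (Suc m + 2) + 4 * (real (incidences E \<theta> z) - \<mu>)\<^sup>2 * N ^ Suc m"
      by (rule power_le_deviation[OF _ rN]) (use N q in \<open>auto simp: \<mu>_def\<close>)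
    then show "real (incidences E \<theta> z) ^ Suc d \<le> 2 ^ Suc d * \<mu> ^ Suc d + 4 * N ^ Suc m * (real (incidences E \<theta> z) - \<mu>)\<^sup>2"
      by (simp add: m mult_ac)
  qed
  also have "\<dots> = card (Isom U) * (real q ^ d * (2 ^ Suc d * \<mu> ^ Suc d))
      + 4 * N ^ Suc m * (\<Sum>\<theta>\<in>Isom U. \<Sum>z\<in>U. (real (incidences E \<theta> z) - \<mu>)\<^sup>2)"
    by (simp only: sum.distrib sum_distrib_left[symmetric]) (simp add: nd_spaceD(3)[OF U])
  also have "\<dots> \<le> 2 ^ d * 2 ^ Suc d * X + 2 ^ d * 4 * X"
  proof (rule add_mono[OF first])
    have "(\<Sum>\<theta>\<in>Isom U. \<Sum>z\<in>U. (real (incidences E \<theta> z) - \<mu>)\<^sup>2) \<le> real (2 ^ Suc m * q ^ s) * real q ^ d * N\<^sup>2"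
      unfolding \<mu>_def N_def s_def using U
      by (intro twisted_variance[OF U E] Isom_transporter_count) (simp_all add: m)
    then have "4 * N ^ Suc m * (\<Sum>\<theta>\<in>Isom U. \<Sum>z\<in>U. (real (incidences E \<theta> z) - \<mu>)\<^sup>2)
        \<le> 4 * N ^ Suc m * (real (2 ^ Suc m * q ^ s) * real q ^ d * N\<^sup>2)"
      using N by (intro mult_left_mono) auto
    then show "4 * N ^ Suc m * (\<Sum>\<theta>\<in>Isom U. \<Sum>z\<in>U. (real (incidences E \<theta> z) - \<mu>)\<^sup>2) \<le> 2 ^ d * 4 * X"
      using second by linarith
  qed
  also have "\<dots> = 2 ^ d * (2 ^ Suc d + 4) * X" by (simp only: distrib_left distrib_right mult_ac)
  finally have L: "\<Lambda> \<le> 2 ^ d * (2 ^ Suc d + 4) * X" .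
  define G where "G = real (card (gram d ` T))"
  have X0: "X > 0" using N q by (simp add: X_def)
  have "(N ^ Suc d / 2 ^ d)\<^sup>2 \<le> (real (card T))\<^sup>2" using cT N by (intro power_mono) auto
  also have "\<dots> \<le> G * \<Lambda>" unfolding G_def \<Lambda>_def by (rule card_image_ge[OF fT])
  also have "\<dots> \<le> G * (2 ^ d * (2 ^ Suc d + 4) * X)" using L by (intro mult_left_mono) (auto simp: G_def)
  finally have "(N ^ Suc d / 2 ^ d)\<^sup>2 \<le> G * (2 ^ d * (2 ^ Suc d + 4)) * X" by (simp only: mult.assoc)
  moreover have "(N ^ Suc d / 2 ^ d)\<^sup>2 = real q ^ t / 4 ^ d * X"
  proof -
    have "(N ^ Suc d)\<^sup>2 = N ^ (2 * Suc d)" by (simp only: power_mult[symmetric] mult.commute)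
    moreover have "(2 ^ d)\<^sup>2 = (4 ^ d :: real)" by (simp add: power2_eq_square power_mult_distrib[symmetric])
    ultimately show ?thesis using q by (simp add: power_divide X_def)
  qed
  ultimately have "real q ^ t / 4 ^ d \<le> G * (2 ^ d * (2 ^ Suc d + 4))"
    using X0 by (simp only: mult_le_cancel_right_pos)
  then have "real q ^ t / 4 ^ d / (2 ^ d * (2 ^ Suc d + 4)) \<le> G"
    by (subst pos_divide_le_eq) (auto intro!: mult_pos_pos add_pos_pos)
  moreover have "(4::real) ^ d * (2 ^ d * (2 ^ Suc d + 4)) = 8 ^ d * (2 ^ Suc d + 4)"
    by (simp add: power_mult_distrib[symmetric] mult.assoc[symmetric])
  ultimately show ?thesis by (simp only: divide_divide_eq_left G_def T_def t_def)
qed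

end

section \<open>Descent along an isotropic line\<close>

text \<open>The exponent is three times the dimension reached by the step. If \<open>q\<close> is so
  small that \<open>q powr (1 / 3) < 4 * C\<close>, the required size exceeds the number of points
  of the whole space and no set \<open>E\<close> qualifies.\<close>

primrec iterated_const :: "real \<Rightarrow> nat \<Rightarrow> nat \<Rightarrow> real" where
  "iterated_const C d 0 = C"
| "iterated_const C d (Suc i) = (4 * iterated_const C d i) ^ (3 * (d + 2 * i + 2))"

lemma iterated_const_ge_1: "C \<ge> 1 \<Longrightarrow> iterated_const C d i \<ge> 1"
proof (induction i)
  case (Suc i)
  then have "1 \<le> 4 * iterated_const C d i" by simp
  then show ?case unfolding iterated_const.simps by (rule one_le_power)
qed simp

context form_space
begin

text \<open>Every value is taken at most twice and zero only once.\<close>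

lemma square_values:
  assumes a: "a \<in> K" "a \<noteq> 0"
  shows "q + 1 \<le> 2 * card ((\<lambda>x. a * (x * x)) ` K)"
proof -
  let ?f = "\<lambda>x. a * (x * x)"
  have roots: "card {x \<in> K. ?f x = c} \<le> 2" for c
  proof (cases "{x \<in> K. ?f x = c} = {}")
    case False
    then obtain x0 where x0: "x0 \<in> K" "?f x0 = c" by blast
    have "{x \<in> K. ?f x = c} \<subseteq> {x0, - x0}"
    proof (rule subsetI)
      fix x assume "x \<in> {x \<in> K. ?f x = c}"
      then have x: "x \<in> K" "?f x = c" by simp_all
      have "a * ((x - x0) * (x + x0)) = 0" using x(2) x0(2) by (simp add: algebra_simps)
      then have "x - x0 = 0 \<or> x + x0 = 0"
        using K_no_zero_div[of a "(x - x0) * (x + x0)"] K_no_zero_div[of "x - x0" "x + x0"] a x(1) x0(1) by auto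
      then show "x \<in> {x0, - x0}" by (auto simp: eq_neg_iff_add_eq_0)
    qed
    then have "card {x \<in> K. ?f x = c} \<le> card {x0, - x0}" by (intro card_mono) auto
    also have "\<dots> \<le> 2" by (simp add: card_insert_if)
    finally show ?thesis .
  next
    case True
    show ?thesis unfolding True by simp
  qed
  let ?X = "?f ` K"
  have zero: "{x \<in> K. ?f x = 0} = {0}"
  proof (rule subset_antisym; rule subsetI)
    fix x assume "x \<in> {x \<in> K. ?f x = 0}"
    then have "x \<in> K" "a * (x * x) = 0" by simp_all
    then show "x \<in> {0}" using K_no_zero_div[of a "x * x"] K_no_zero_div[of x x] a by auto
  qed auto
  have X0: "0 \<in> ?X" by (rule image_eqI[of _ _ 0]) auto
  have "q = (\<Sum>c\<in>?X. card {x \<in> K. ?f x = c})" unfolding q_def by (rule fibre_sum[symmetric]) auto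
  also have "\<dots> = card {x \<in> K. ?f x = 0} + (\<Sum>c\<in>?X - {0}. card {x \<in> K. ?f x = c})"
    by (rule sum.remove) (use X0 in auto)
  also have "\<dots> \<le> 1 + (\<Sum>c\<in>?X - {0}. 2)" unfolding zero by (intro add_mono sum_mono roots) auto
  also have "\<dots> = 1 + 2 * (card ?X - 1)" using X0 by (simp add: card_Diff_singleton)
  finally have "q \<le> 1 + 2 * (card ?X - 1)" .
  moreover have "card ?X > 0" using X0 by (auto simp: card_gt_0_iff)
  ultimately show ?thesis by linarith
qed

text \<open>For three orthogonal nonisotropic vectors, the values of \<open>Q w1 * x ^ 2\<close> and
  of \<open>- Q w3 - Q w2 * y ^ 2\<close> each fill more than half of \<open>K\<close>, so they
  meet. The coefficient \<open>1\<close> at \<open>w3\<close> keeps the resulting vector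
  nonzero.\<close>

lemma isotropic_ex:
  assumes U: "nd_space (Suc (Suc (Suc m))) U"
  obtains n where "n \<in> U" "n \<noteq> 0" "Q n = 0"
proof -
  obtain w1 where w1: "w1 \<in> U" "Q w1 \<noteq> 0" using nonisotropic_ex[OF U] .
  have U1: "nd_space (Suc (Suc m)) (perp U {w1})" by (rule nonisotropic_split(1)[OF U w1])
  obtain w2 where w2: "w2 \<in> perp U {w1}" "Q w2 \<noteq> 0" using nonisotropic_ex[OF U1] .
  have U2: "nd_space (Suc m) (perp (perp U {w1}) {w2})" by (rule nonisotropic_split(1)[OF U1 w2])
  obtain w3 where w3: "w3 \<in> perp (perp U {w1}) {w2}" "Q w3 \<noteq> 0" using nonisotropic_ex[OF U2] .
  have orth: "B w2 w1 = 0" "B w3 w1 = 0" "B w3 w2 = 0" "B w1 w2 = 0" "B w1 w3 = 0" "B w2 w3 = 0"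
    and w23: "w2 \<in> U" "w3 \<in> U"
    using w2(1) w3(1) B_commute[of w1] B_commute[of w2 w3] by (auto simp: perp_def)
  note sU = nd_spaceD(1)[OF U]
  have u: "unital w1" "unital w2" "unital w3" using subspD(4)[OF sU] w1 w23 by auto
  let ?X = "(\<lambda>x. Q w1 * (x * x)) ` K" and ?Y = "(\<lambda>y. - Q w3 - Q w2 * (y * y)) ` K"
  have cX: "q + 1 \<le> 2 * card ?X" by (rule square_values) (use u w1 in auto)
  have cZ: "q + 1 \<le> 2 * card ((\<lambda>x. Q w2 * (x * x)) ` K)" by (rule square_values) (use u w2 in auto)
  have "?Y = (\<lambda>z. - Q w3 - z) ` (\<lambda>x. Q w2 * (x * x)) ` K" by (simp add: image_image)
  then have "card ?Y = card ((\<lambda>x. Q w2 * (x * x)) ` K)" by (simp add: card_image inj_on_def)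
  then have cY: "q + 1 \<le> 2 * card ?Y" using cZ by simp
  have XY: "?X \<subseteq> K" "?Y \<subseteq> K" using u by auto
  have "?X \<inter> ?Y \<noteq> {}"
  proof
    assume "?X \<inter> ?Y = {}"
    then have "card ?X + card ?Y = card (?X \<union> ?Y)" by (intro card_Un_disjoint[symmetric]) auto
    also have "\<dots> \<le> q" unfolding q_def by (rule card_mono) (use XY in auto)
    finally show False using cX cY by linarith
  qed
  then obtain x y where xy: "Q w1 * (x * x) = - Q w3 - Q w2 * (y * y)" by blast
  define n where "n = x \<star> w1 + y \<star> w2 + w3"
  have "n \<in> U" unfolding n_def
    by (intro subspD(2)[OF sU] subspD(3)[OF sU] w1(1) w23)
  moreover have "Q n = Q w1 * (x * x) + Q w2 * (y * y) + Q w3"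
    by (simp add: n_def B_simps orth algebra_simps)
  then have "Q n = 0" unfolding xy by simp
  moreover have "B n w3 = Q w3" by (simp add: n_def B_simps orth)
  then have "n \<noteq> 0" using w3(2) by auto
  ultimately show ?thesis using that by blast
qed

text \<open>In coordinates for a hyperbolic pair and its complement \<open>W\<close>, a nonzero
  coefficient \<open>a\<close> of \<open>\<xi>\<close> and a component \<open>w \<in> W\<close> may
  be chosen freely; vanishing of \<open>Q\<close> then determines the coefficient of
  \<open>\<zeta>\<close>.\<close>

lemma isotropic_count:
  assumes U: "nd_space (Suc (Suc (Suc m))) U"
  shows "(q - 1) * q ^ Suc m \<le> card {n \<in> U. n \<noteq> 0 \<and> Q n = 0}"
proof -
  note sU = nd_spaceD(1)[OF U]
  obtain \<xi> where x: "\<xi> \<in> U" "\<xi> \<noteq> 0" "Q \<xi> = 0" using isotropic_ex[OF U] .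
  obtain \<zeta> where z: "\<zeta> \<in> U" "Q \<zeta> = 0" "B \<xi> \<zeta> = e" using hyperbolic_partner[OF U x] .
  have z': "B \<zeta> \<xi> = e" using z(3) by (simp add: B_commute)
  define W where "W = perp U {\<xi>, \<zeta>}"
  have W: "nd_space (Suc m) W" unfolding W_def by (rule hyperbolic_split(1)[OF U x(1) z(1) x(3) z(2,3)])
  have Wp: "w \<in> U" "B w \<xi> = 0" "B w \<zeta> = 0" "B \<xi> w = 0" "B \<zeta> w = 0" if "w \<in> W" for w
    using that B_commute[of \<xi> w] B_commute[of \<zeta> w] by (auto simp: W_def perp_def)
  define iv where "iv a = (SOME y. y \<in> K \<and> a * y = e)" for a
  have iv: "iv a \<in> K" "a * iv a = e" if "a \<in> K - {0}" for a
  proof -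
    have "iv a \<in> K \<and> a * iv a = e" unfolding iv_def by (rule someI_ex) (use K_inverse that in blast)
    then show "iv a \<in> K" "a * iv a = e" by auto
  qed
  let ?f = "\<lambda>(a, w). a \<star> \<xi> + (- (half * Q w) * iv a) \<star> \<zeta> + w"
  have Bz: "B (?f (a, w)) \<zeta> = a" if "a \<in> K - {0}" "w \<in> W" for a w
    using K_unit(2)[of a] that Wp[OF that(2)] by (simp add: B_simps z)
  have "card ((K - {0}) \<times> W) \<le> card {n \<in> U. n \<noteq> 0 \<and> Q n = 0}"
  proof (rule card_inj_on_le)
    show "inj_on ?f ((K - {0}) \<times> W)"
    proof (rule inj_onI)
      fix p p' assume p: "p \<in> (K - {0}) \<times> W" "p' \<in> (K - {0}) \<times> W" and eq0: "?f p = ?f p'"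
      obtain a w where aw1: "p = (a, w)" "a \<in> K" "a \<noteq> 0" "w \<in> W" using p(1) by blast
      obtain a' w' where aw2: "p' = (a', w')" "a' \<in> K" "a' \<noteq> 0" "w' \<in> W" using p(2) by blast
      note aw = aw1(2-4) aw2(2-4)
      have eq: "a \<star> \<xi> + (- (half * Q w) * iv a) \<star> \<zeta> + w = a' \<star> \<xi> + (- (half * Q w') * iv a') \<star> \<zeta> + w'"
        using eq0 unfolding aw1(1) aw2(1) case_prod_conv .
      have "B (?f (a, w)) \<zeta> = B (?f (a', w')) \<zeta>" using eq by simp
      then have aa: "a = a'" using Bz[of a w] Bz[of a' w'] aw by simp
      have uz: "unital \<zeta>" using subspD(4)[OF sU z(1)] .
      have "B (?f (a, w)) \<xi> = B (?f (a', w')) \<xi>" using eq by simp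
      then have "(- (half * Q w) * iv a) * e = (- (half * Q w') * iv a') * e"
        using Wp[OF aw(3)] Wp[OF aw(6)] by (simp add: B_simps x z')
      moreover have "(- (half * Q w) * iv a) * e = - (half * Q w) * iv a" "(- (half * Q w') * iv a') * e = - (half * Q w') * iv a'"
        by (rule K_unit(2), use half(1) in blast)+
      ultimately have "- (half * Q w) * iv a = - (half * Q w') * iv a'" by (simp only:)
      then have "w = w'" using eq unfolding aa by simp
      then show "p = p'" using aa aw1(1) aw2(1) by simp
    qed
    show "?f ` ((K - {0}) \<times> W) \<subseteq> {n \<in> U. n \<noteq> 0 \<and> Q n = 0}"
    proof (rule image_subsetI)
      fix p assume p: "p \<in> (K - {0}) \<times> W"
      obtain a w where aw: "p = (a, w)" "a \<in> K - {0}" "w \<in> W" using p by blast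
      have 1: "?f p \<in> U" unfolding aw(1) case_prod_conv
        by (intro subspD(2)[OF sU] subspD(3)[OF sU] x(1) z(1) Wp(1)[OF aw(3)])
      have 2: "?f p \<noteq> 0" using Bz[OF aw(2,3)] aw(1,2) by auto
      have QwK: "Q w \<in> K" using subspD(4)[OF sU Wp(1)[OF aw(3)]] by blast
      define b where "b = - (half * Q w) * iv a"
      have ab: "a * b = - (half * Q w)"
      proof -
        have "a * b = - (half * Q w) * (a * iv a)" by (simp add: b_def mult_ac)
        also have "\<dots> = - (half * Q w)" unfolding iv(2)[OF aw(2)] by (rule K_unit(2)) (use half(1) in blast)
        finally show ?thesis .
      qed
      have "Q (a \<star> \<xi> + b \<star> \<zeta> + w) = (a * b) * e + (a * b) * e + Q w"
        using Wp[OF aw(3)] by (simp add: B_simps x z z' mult_ac)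
      also have "(a * b) * e = - (half * Q w)" unfolding ab by (rule K_unit(2)) (use half(1) in blast)
      also have "- (half * Q w) + - (half * Q w) + Q w = - ((half + half) * Q w) + Q w" by (simp add: distrib_right)
      also have "\<dots> = 0" unfolding half(2) K_unit(1)[OF QwK] by simp
      finally have 3: "Q (?f p) = 0" unfolding aw(1) b_def by simp
      show "?f p \<in> {n \<in> U. n \<noteq> 0 \<and> Q n = 0}" using 1 2 3 by blast
    qed
    show "finite {n \<in> U. n \<noteq> 0 \<and> Q n = 0}" using nd_spaceD(2)[OF U] by simp
  qed
  moreover have "card ((K - {0}) \<times> W) = (q - 1) * q ^ Suc m"
    by (simp add: card_cartesian_product card_Diff_singleton q_def[symmetric] nd_spaceD(3)[OF W])
  ultimately show ?thesis by simp
qed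

text \<open>The hyperplane orthogonal to \<open>\<xi>\<close> contains a nonisotropic vector: if
  \<open>\<xi>\<close> is isotropic, one is found orthogonal to a whole hyperbolic pair. Lines in
  that direction meet the zero set of \<open>Q\<close> at most twice.\<close>

lemma perp_isotropic_bound:
  assumes U: "nd_space (Suc (Suc (Suc m))) U" and \<xi>: "\<xi> \<in> U" "\<xi> \<noteq> 0"
  shows "card {n \<in> U. (n \<noteq> 0 \<and> Q n = 0) \<and> B n \<xi> = 0} \<le> 2 * q ^ Suc m"
proof -
  note sU = nd_spaceD(1)[OF U]
  obtain w where w: "w \<in> perp U {\<xi>}" "Q w \<noteq> 0"
  proof (cases "Q \<xi> = 0")
    case False
    then show ?thesis using nonisotropic_ex[OF nonisotropic_split(1)[OF U \<xi>(1) False]] that by blast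
  next
    case True
    obtain \<zeta> where z: "\<zeta> \<in> U" "Q \<zeta> = 0" "B \<xi> \<zeta> = e" using hyperbolic_partner[OF U \<xi> True] .
    obtain w where "w \<in> perp U {\<xi>, \<zeta>}" "Q w \<noteq> 0"
      using nonisotropic_ex[OF hyperbolic_split(1)[OF U \<xi>(1) z(1) True z(2,3)]] .
    then show ?thesis using that by (auto simp: perp_def)
  qed
  let ?P = "perp U {\<xi>}"
  have sP: "subsp ?P" by (rule subsp_perp[OF sU])
  have fP: "finite ?P" using nd_spaceD(2)[OF U] by (simp add: perp_def)
  have "?P = {u \<in> U. B \<xi> u = 0}" by (auto simp: perp_def B_commute[of \<xi>])
  then have "q * card ?P = q ^ Suc (Suc (Suc m))" using card_hyperplane[OF U \<xi> K_closed(1)] by simp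
  then have cP: "card ?P = q ^ Suc (Suc m)" using q_pos by simp
  have "q * card {s \<in> ?P. Q s = 0} \<le> 2 * card ?P"
    by (rule quadratic_zero_count[OF fP _ subspD(4)[OF sP w(1)] w(2)])
      (rule subspD(2)[OF sP _ subspD(3)[OF sP w(1)]])
  then have "q * card {s \<in> ?P. Q s = 0} \<le> q * (2 * q ^ Suc m)" unfolding cP by simp
  then have le: "card {s \<in> ?P. Q s = 0} \<le> 2 * q ^ Suc m" using q_pos by (simp only: mult_le_cancel1)
  have "card {n \<in> U. (n \<noteq> 0 \<and> Q n = 0) \<and> B n \<xi> = 0} \<le> card {s \<in> ?P. Q s = 0}"
  proof (rule card_mono)
    show "finite {s \<in> ?P. Q s = 0}" by (rule finite_subset[OF _ fP]) auto
  qed (auto simp: perp_def)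
  then show ?thesis using le by simp
qed

text \<open>For a nonzero unital \<open>n\<close> this counts the ordered pairs of points of
  \<open>E\<close> on a common line in direction \<open>n\<close>, the pairs \<open>t = 0\<close> of
  equal points included.\<close>

definition lines_count :: "'v set \<Rightarrow> 'v \<Rightarrow> nat" where
  "lines_count E n = (\<Sum>t\<in>K. card {x \<in> E. x + t \<star> n \<in> E})"

text \<open>The summands are autocorrelations of the indicator of \<open>E\<close>, with transform
  \<open>a \<xi>\<close>. Summing the character over \<open>t\<close> keeps only the frequencies
  orthogonal to \<open>n\<close>.\<close>

lemma lines_count_fourier:
  assumes U: "nd_space d U" and E: "E \<subseteq> U" and n: "n \<in> U"
  defines "f \<equiv> \<lambda>u. if u \<in> E then 1 else 0"
  shows "real q ^ d * lines_count E n = real q * (\<Sum>\<xi>\<in>{\<xi> \<in> U. B n \<xi> = 0}. (cmod (fourier U f \<xi>))\<^sup>2)"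
proof -
  note sU = nd_spaceD(1)[OF U] and fU = nd_spaceD(2)[OF U]
  have fE: "finite E" using finite_subset[OF E fU] .
  define a where "a \<xi> = complex_of_real ((cmod (fourier U f \<xi>))\<^sup>2)" for \<xi>
  have corr: "(\<Sum>\<xi>\<in>U. a \<xi> * chi (B w \<xi>)) = of_nat (q ^ d) * of_nat (card {x \<in> E. x + w \<in> E})" if w: "w \<in> U" for w
  proof -
    have "(\<Sum>\<xi>\<in>U. a \<xi> * chi (B w \<xi>)) = (\<Sum>\<xi>\<in>U. \<Sum>p\<in>U \<times> U. of_real (f (fst p) * f (snd p)) * chi (B (fst p - snd p + w) \<xi>))"
    proof (rule sum.cong[OF refl])
      fix \<xi> assume x: "\<xi> \<in> U"
      have BK: "B v \<xi> \<in> K" for v using subspD(4)[OF sU x] by blast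
      show "a \<xi> * chi (B w \<xi>) = (\<Sum>p\<in>U \<times> U. of_real (f (fst p) * f (snd p)) * chi (B (fst p - snd p + w) \<xi>))"
        unfolding a_def fourier_norm_expand[OF U x] sum_distrib_right B_add_left chi(1)[OF BK BK]
        by (simp add: case_prod_unfold mult.assoc)
    qed
    also have "\<dots> = (\<Sum>p\<in>U \<times> U. of_real (f (fst p) * f (snd p)) * (\<Sum>\<xi>\<in>U. chi (B \<xi> (fst p - snd p + w))))"
      by (subst sum.swap) (simp add: sum_distrib_left B_commute)
    also have "\<dots> = (\<Sum>p\<in>U \<times> U. if p \<in> (\<lambda>x. (x, x + w)) ` {x \<in> E. x + w \<in> E} then of_nat (q ^ d) else 0)"
    proof (rule sum.cong[OF refl])
      fix p assume p: "p \<in> U \<times> U"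
      then have mem: "fst p - snd p + w \<in> U" using subspD(2,5)[OF sU] w by auto
      have h: "fst p - snd p + w = fst p + w - snd p" by (simp add: algebra_simps)
      have "fst p - snd p + w = 0 \<longleftrightarrow> snd p = fst p + w" unfolding h right_minus_eq by (rule eq_commute)
      then have iff: "p \<in> (\<lambda>x. (x, x + w)) ` {x \<in> E. x + w \<in> E} \<longleftrightarrow> fst p \<in> E \<and> snd p \<in> E \<and> fst p - snd p + w = 0"
        by (cases p) (auto simp: image_iff)
      show "of_real (f (fst p) * f (snd p)) * (\<Sum>\<xi>\<in>U. chi (B \<xi> (fst p - snd p + w)))
          = (if p \<in> (\<lambda>x. (x, x + w)) ` {x \<in> E. x + w \<in> E} then of_nat (q ^ d) else 0)"
        unfolding iff chi_sum_space[OF U mem] by (simp add: f_def)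
    qed
    also have "\<dots> = of_nat (q ^ d) * of_nat (card ((U \<times> U) \<inter> (\<lambda>x. (x, x + w)) ` {x \<in> E. x + w \<in> E}))"
      using fU by (simp add: sum.If_cases)
    also have "(U \<times> U) \<inter> (\<lambda>x. (x, x + w)) ` {x \<in> E. x + w \<in> E} = (\<lambda>x. (x, x + w)) ` {x \<in> E. x + w \<in> E}"
      using E by auto
    also have "card \<dots> = card {x \<in> E. x + w \<in> E}" by (rule card_image) (auto intro: inj_onI)
    finally show ?thesis .
  qed
  have "of_nat (q ^ d) * of_nat (lines_count E n) = (\<Sum>t\<in>K. of_nat (q ^ d) * complex_of_nat (card {x \<in> E. x + t \<star> n \<in> E}))"
    by (simp add: lines_count_def sum_distrib_left)
  also have "\<dots> = (\<Sum>t\<in>K. \<Sum>\<xi>\<in>U. a \<xi> * chi (t * B n \<xi>))"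
  proof (rule sum.cong[OF refl])
    fix t
    show "of_nat (q ^ d) * complex_of_nat (card {x \<in> E. x + t \<star> n \<in> E}) = (\<Sum>\<xi>\<in>U. a \<xi> * chi (t * B n \<xi>))"
      using corr[OF subspD(3)[OF sU n, of t]] by (simp only: B_sc_left)
  qed
  also have "\<dots> = (\<Sum>\<xi>\<in>U. a \<xi> * (\<Sum>t\<in>K. chi (t * B n \<xi>)))"
    by (subst sum.swap) (simp add: sum_distrib_left)
  also have "\<dots> = (\<Sum>\<xi>\<in>U. if B n \<xi> = 0 then a \<xi> * of_nat q else 0)"
    by (intro sum.cong refl) (use chi_sum_field B_in_K(1)[OF subspD(4)[OF sU n]] in auto)
  also have "\<dots> = (\<Sum>\<xi>\<in>{\<xi> \<in> U. B n \<xi> = 0}. a \<xi> * of_nat q)"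
    using fU by (simp add: sum.inter_filter)
  also have "\<dots> = complex_of_real (real q * (\<Sum>\<xi>\<in>{\<xi> \<in> U. B n \<xi> = 0}. (cmod (fourier U f \<xi>))\<^sup>2))"
    by (simp add: a_def sum_distrib_left mult.commute)
  finally have "complex_of_real (real q ^ d * lines_count E n)
      = complex_of_real (real q * (\<Sum>\<xi>\<in>{\<xi> \<in> U. B n \<xi> = 0}. (cmod (fourier U f \<xi>))\<^sup>2))" by simp
  then show ?thesis by (simp only: of_real_eq_iff)
qed

text \<open>Averaged over isotropic \<open>n\<close>, frequency zero gives the expected
  \<open>N ^ 2 / q ^ (d - 1)\<close> with \<open>d = m + 3\<close>. Any other frequency is
  orthogonal to a proportion of at most \<open>2 / (q - 1)\<close> of the \<open>n\<close>, so by
  Parseval the rest contributes at most \<open>2 * q / (q - 1) * N\<close>, which is at most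
  \<open>3 * N\<close> for \<open>q \<ge> 3\<close>.\<close>

lemma good_isotropic_direction:
  assumes U: "nd_space (Suc (Suc (Suc m))) U" and E: "E \<subseteq> U"
  obtains n where "n \<in> U" "n \<noteq> 0" "Q n = 0"
    "lines_count E n \<le> (real (card E))\<^sup>2 / real q ^ Suc (Suc m) + 3 * real (card E)"
proof (rule ccontr)
  note goal = that
  note sU = nd_spaceD(1)[OF U] and fU = nd_spaceD(2)[OF U]
  have fE: "finite E" using finite_subset[OF E fU] .
  define N where "N = real (card E)"
  define I where "I = {n \<in> U. n \<noteq> 0 \<and> Q n = 0}"
  define D where "D = real q ^ Suc (Suc (Suc m))"
  define f where "f u = (if u \<in> E then 1 else 0 :: real)" for u
  define a where "a \<xi> = (cmod (fourier U f \<xi>))\<^sup>2" for \<xi>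
  have fI: "finite I" using fU by (simp add: I_def)
  have q: "real q > 0" "real q \<ge> 3" using q_ge_3 by auto
  have D: "D > 0" by (simp add: D_def)
  have UE: "U \<inter> E = E" using E by blast
  have sf: "(\<Sum>u\<in>U. f u) = N" using fU by (simp add: f_def sum.If_cases UE N_def)
  have f2: "(f u)\<^sup>2 = f u" for u by (simp add: f_def)
  have az: "a 0 = N\<^sup>2"
  proof -
    have "fourier U f 0 = of_real (\<Sum>u\<in>U. f u)" by (simp add: fourier_def)
    then show ?thesis unfolding sf by (simp add: a_def)
  qed
  have suma: "(\<Sum>\<xi>\<in>U. a \<xi>) = D * N" unfolding a_def parseval[OF U] f2 sf D_def ..
  have a0: "a \<xi> \<ge> 0" for \<xi> by (simp add: a_def)
  have cI: "(real q - 1) * real q ^ Suc m \<le> card I"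
  proof -
    have "real ((q - 1) * q ^ Suc m) \<le> card I" unfolding I_def by (rule of_nat_mono[OF isotropic_count[OF U]])
    then show ?thesis using q_ge_3 by (simp add: of_nat_diff)
  qed
  moreover have "(real q - 1) * real q ^ Suc m > 0" using q by simp
  ultimately have I0: "real (card I) > 0" by linarith
  assume no: "\<not> thesis"
  have big: "N\<^sup>2 / real q ^ Suc (Suc m) + 3 * N < lines_count E n" if "n \<in> I" for n
  proof (rule ccontr)
    assume "\<not> N\<^sup>2 / real q ^ Suc (Suc m) + 3 * N < lines_count E n"
    then have "lines_count E n \<le> (real (card E))\<^sup>2 / real q ^ Suc (Suc m) + 3 * real (card E)"
      unfolding N_def by (simp only: not_less)
    moreover have "n \<in> U" "n \<noteq> 0" "Q n = 0" using that by (simp_all add: I_def)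
    ultimately show False using goal[of n] no by blast
  qed
  have Ine: "I \<noteq> {}" using I0 by auto
  have "D * (card I * (N\<^sup>2 / real q ^ Suc (Suc m) + 3 * N)) = D * (\<Sum>n\<in>I. N\<^sup>2 / real q ^ Suc (Suc m) + 3 * N)" by simp
  also have "\<dots> < D * (\<Sum>n\<in>I. real (lines_count E n))"
    by (rule mult_strict_left_mono[OF sum_strict_mono[OF fI Ine big] D])
  also have "\<dots> = (\<Sum>n\<in>I. real q * (\<Sum>\<xi>\<in>{\<xi> \<in> U. B n \<xi> = 0}. a \<xi>))"
    unfolding sum_distrib_left[of D]
  proof (rule sum.cong[OF refl])
    fix n assume "n \<in> I"
    then have "n \<in> U" by (simp add: I_def)
    from lines_count_fourier[OF U E this]
    show "D * lines_count E n = real q * (\<Sum>\<xi>\<in>{\<xi> \<in> U. B n \<xi> = 0}. a \<xi>)"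
      by (simp only: D_def a_def f_def[abs_def])
  qed
  also have "\<dots> = real q * (\<Sum>n\<in>I. \<Sum>\<xi>\<in>U. if B n \<xi> = 0 then a \<xi> else 0)"
    using fU by (simp add: sum_distrib_left sum.inter_filter)
  also have "\<dots> = real q * (\<Sum>\<xi>\<in>U. \<Sum>n\<in>I. if B n \<xi> = 0 then a \<xi> else 0)" by (subst sum.swap) simp
  also have "\<dots> = real q * (\<Sum>\<xi>\<in>U. card {n \<in> I. B n \<xi> = 0} * a \<xi>)"
    using fI by (simp add: sum.inter_filter[symmetric])
  also have "\<dots> \<le> real q * (\<Sum>\<xi>\<in>U. (if \<xi> = 0 then card I * a \<xi> else 0) + 2 * real q ^ Suc m * a \<xi>)"
  proof (intro mult_left_mono sum_mono)
    fix \<xi> assume x: "\<xi> \<in> U"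
    show "card {n \<in> I. B n \<xi> = 0} * a \<xi> \<le> (if \<xi> = 0 then card I * a \<xi> else 0) + 2 * real q ^ Suc m * a \<xi>"
    proof (cases "\<xi> = 0")
      case True
      then show ?thesis using a0 by simp
    next
      case False
      have "{n \<in> I. B n \<xi> = 0} = {n \<in> U. (n \<noteq> 0 \<and> Q n = 0) \<and> B n \<xi> = 0}" by (auto simp: I_def)
      then have "card {n \<in> I. B n \<xi> = 0} \<le> 2 * q ^ Suc m" using perp_isotropic_bound[OF U x False] by simp
      then have "real (card {n \<in> I. B n \<xi> = 0}) \<le> real (2 * q ^ Suc m)" by (simp only: of_nat_le_iff)
      then have "real (card {n \<in> I. B n \<xi> = 0}) * a \<xi> \<le> real (2 * q ^ Suc m) * a \<xi>" by (rule mult_right_mono) (rule a0)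
      then show ?thesis using False by simp
    qed
  qed simp
  also have "\<dots> = real q * (card I * N\<^sup>2 + 2 * real q ^ Suc m * (D * N))"
    using fU subspD(1)[OF sU] by (simp add: sum.distrib sum_distrib_left[symmetric] suma az)
  also have "\<dots> \<le> D * (card I * (N\<^sup>2 / real q ^ Suc (Suc m) + 3 * N))"
  proof -
    have "D * (card I * (N\<^sup>2 / real q ^ Suc (Suc m))) = real q * (card I * N\<^sup>2)" using q by (simp add: D_def)
    moreover have "real q * (2 * real q ^ Suc m) \<le> 3 * real (card I)"
    proof -
      have "real q * 2 \<le> 3 * (real q - 1)" using q by simp
      then have "real q * 2 * real q ^ Suc m \<le> 3 * (real q - 1) * real q ^ Suc m" by (rule mult_right_mono) simp
      also have "\<dots> = 3 * ((real q - 1) * real q ^ Suc m)" by (simp only: mult.assoc)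
      also have "\<dots> \<le> 3 * real (card I)" by (rule mult_left_mono[OF cI]) simp
      finally show ?thesis by (simp only: mult.assoc)
    qed
    then have "real q * (2 * real q ^ Suc m) * (D * N) \<le> 3 * real (card I) * (D * N)"
      by (rule mult_right_mono) (use D in \<open>simp add: N_def\<close>)
    ultimately show ?thesis by (simp add: distrib_left mult_ac)
  qed
  finally show False by simp
qed

lemma nonsingular_gram_cong:
  assumes "\<And>i l. i < k \<Longrightarrow> l < k \<Longrightarrow> B (v i) (v l) = B (v' i) (v' l)"
  shows "nonsingular k v \<longleftrightarrow> nonsingular k v'"
proof -
  have "B (v i) (lincomb k c v) = B (v' i) (lincomb k c v')" if "i < k" for i c
    unfolding B_lincomb using assms that by (intro sum.cong refl) simp
  then show ?thesis unfolding nonsingular_def by simp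
qed

text \<open>The two values in the minimum are the two regimes of the bound on collisions. Up to
  \<open>N = q ^ (m + 2)\<close> the term \<open>3 * N\<close> dominates and the image has about
  \<open>N\<close> points, spread over \<open>q\<close> slices. Beyond that, a slice already fills a
  positive proportion of \<open>W\<close>.\<close>

lemma reduction:
  assumes U: "nd_space (Suc (Suc (Suc m))) U" and E: "E \<subseteq> U" and ne: "E \<noteq> {}"
  obtains W E' where "nd_space (Suc m) W" "E' \<subseteq> W"
    "min (real (card E) / q) (real q ^ Suc m) \<le> 4 * card E'"
    "\<And>k. gram k ` nonsingular_simplices k E' \<subseteq> gram k ` nonsingular_simplices k E"
proof -
  note sU = nd_spaceD(1)[OF U] and fU = nd_spaceD(2)[OF U]
  have fE: "finite E" using finite_subset[OF E fU] .
  define N where "N = real (card E)"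
  have N: "N > 0" using fE ne by (simp add: N_def card_gt_0_iff)
  have q: "real q > 0" by simp
  obtain n where n: "n \<in> U" "n \<noteq> 0" "Q n = 0"
    and L: "lines_count E n \<le> N\<^sup>2 / real q ^ Suc (Suc m) + 3 * N"
    using good_isotropic_direction[OF U E] unfolding N_def by blast
  obtain n' where n': "n' \<in> U" "Q n' = 0" "B n n' = e" using hyperbolic_partner[OF U n] .
  define W where "W = perp U {n, n'}"
  have W: "nd_space (Suc m) W" unfolding W_def by (rule hyperbolic_split(1)[OF U n(1) n'(1) n(3) n'(2,3)])
  have EU: "unital x" if "x \<in> E" for x using subspD(4)[OF sU] that E by blast
  define p where "p x = x - (B x n' \<star> n + B x n \<star> n')" for x
  have pW: "p x \<in> W" if "x \<in> U" for x
    unfolding p_def W_def by (rule hyperbolic_split(2)[OF U n(1) n'(1) n(3) n'(2,3) that])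
  \<comment> \<open>Recording the slice \<open>B x n\<close> fixes the component along
    \<open>n'\<close>, so points with the same image can differ only by a multiple of
    \<open>n\<close>.\<close>
  define \<phi> where "\<phi> x = (p x, B x n)" for x
  have coll: "{(x, y) \<in> E \<times> E. \<phi> x = \<phi> y} \<subseteq> (\<lambda>(t, x). (x, x + t \<star> n)) ` Sigma K (\<lambda>t. {x \<in> E. x + t \<star> n \<in> E})"
  proof clarify
    fix x y assume xy: "x \<in> E" "y \<in> E" and eq: "\<phi> x = \<phi> y"
    have "p x = p y" "B x n = B y n" using eq by (simp_all add: \<phi>_def)
    then have "y = x + (B y n' - B x n') \<star> n"
      by (simp add: p_def sc_diff_left algebra_simps)
    moreover have "B y n' - B x n' \<in> K" using EU xy by blast
    ultimately show "(x, y) \<in> (\<lambda>(t, x). (x, x + t \<star> n)) ` Sigma K (\<lambda>t. {x \<in> E. x + t \<star> n \<in> E})"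
      using xy by (intro image_eqI[of _ _ "(B y n' - B x n', x)"]) auto
  qed
  have "card {(x, y) \<in> E \<times> E. \<phi> x = \<phi> y} \<le> card (Sigma K (\<lambda>t. {x \<in> E. x + t \<star> n \<in> E}))"
    by (rule surj_card_le[OF _ coll]) (use fE in auto)
  also have "\<dots> = lines_count E n" unfolding lines_count_def using fE by (intro card_SigmaI) auto
  finally have cl: "real (card {(x, y) \<in> E \<times> E. \<phi> x = \<phi> y}) \<le> lines_count E n" by simp
  have "N\<^sup>2 \<le> card (\<phi> ` E) * real (card {(x, y) \<in> E \<times> E. \<phi> x = \<phi> y})"
    unfolding N_def by (rule card_image_ge[OF fE])
  also have "\<dots> \<le> card (\<phi> ` E) * (N\<^sup>2 / real q ^ Suc (Suc m) + 3 * N)"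
    by (rule mult_left_mono) (use cl L in linarith)+
  finally have c\<phi>: "N\<^sup>2 \<le> card (\<phi> ` E) * (N\<^sup>2 / real q ^ Suc (Suc m) + 3 * N)" .
  define X where "X c = p ` {x \<in> E. B x n = c}" for c
  have "\<exists>c\<in>K. card (\<phi> ` E) \<le> q * card (X c)"
  proof (rule ccontr)
    assume "\<not> (\<exists>c\<in>K. card (\<phi> ` E) \<le> q * card (X c))"
    then have lt: "q * card (X c) < card (\<phi> ` E)" if "c \<in> K" for c using that by force
    have "\<phi> ` E \<subseteq> (\<Union>c\<in>K. X c \<times> {c})" using EU by (auto simp: \<phi>_def X_def)
    then have "card (\<phi> ` E) \<le> card (\<Union>c\<in>K. X c \<times> {c})" using fE by (intro card_mono) (auto simp: X_def)
    also have "\<dots> \<le> (\<Sum>c\<in>K. card (X c \<times> {c}))" by (rule card_UN_le) simp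
    also have "\<dots> = (\<Sum>c\<in>K. card (X c))" by (simp add: card_cartesian_product)
    finally have "q * card (\<phi> ` E) \<le> (\<Sum>c\<in>K. q * card (X c))" by (simp add: sum_distrib_left[symmetric])
    also have "\<dots> < (\<Sum>c\<in>K. card (\<phi> ` E))" by (rule sum_strict_mono) (use lt in auto)
    also have "\<dots> = q * card (\<phi> ` E)" by (simp add: q_def)
    finally show False by simp
  qed
  then obtain c where c: "c \<in> K" "card (\<phi> ` E) \<le> q * card (X c)" by blast
  then have cc: "real (card (\<phi> ` E)) \<le> real q * card (X c)" by (simp flip: of_nat_mult)
  define R where "R = N\<^sup>2 / real q ^ Suc (Suc m) + 3 * N"
  have R0: "R > 0" unfolding R_def using N q by (simp add: add_nonneg_pos)
  have XR: "N\<^sup>2 \<le> real q * card (X c) * R"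
    using c\<phi> mult_right_mono[OF cc, of R] R0 unfolding R_def by linarith
  have size: "min (N / q) (real q ^ Suc m) \<le> 4 * card (X c)"
  proof (cases "N \<le> real q ^ Suc (Suc m)")
    case True
    have "N * N \<le> N * real q ^ Suc (Suc m)" using True N by (intro mult_left_mono) auto
    then have "N\<^sup>2 / real q ^ Suc (Suc m) \<le> N" unfolding power2_eq_square using q by (subst pos_divide_le_eq) auto
    then have "R \<le> 4 * N" by (simp add: R_def)
    then have "real q * card (X c) * R \<le> real q * card (X c) * (4 * N)" by (rule mult_left_mono) simp
    then have "N\<^sup>2 \<le> real q * card (X c) * (4 * N)" by (rule order_trans[OF XR])
    then have "N * N \<le> real q * card (X c) * 4 * N" by (simp only: power2_eq_square mult.assoc)
    then have "N \<le> real q * card (X c) * 4" using N by (simp only: mult_le_cancel_right_pos)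
    then have "N / q \<le> 4 * card (X c)" using q by (subst pos_divide_le_eq) (auto simp: mult_ac)
    then show ?thesis by simp
  next
    case False
    define P where "P = real q ^ Suc (Suc m)"
    have P: "P > 0" "P < N" using False by (simp_all add: P_def)
    have "P * N \<le> N\<^sup>2" unfolding power2_eq_square using P N by (intro mult_right_mono) auto
    then have "N \<le> N\<^sup>2 / P" using P by (subst pos_le_divide_eq) (auto simp: mult.commute)
    moreover have "R = N\<^sup>2 / P + 3 * N" by (simp only: R_def P_def)
    ultimately have "R \<le> 4 * (N\<^sup>2 / P)" by linarith
    then have "real q * card (X c) * R \<le> real q * card (X c) * (4 * (N\<^sup>2 / P))" by (rule mult_left_mono) simp
    then have "N\<^sup>2 \<le> real q * card (X c) * (4 * (N\<^sup>2 / P))" by (rule order_trans[OF XR])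
    then have "N\<^sup>2 \<le> (real q * card (X c) * 4 / P) * N\<^sup>2" by simp
    then have "1 * N\<^sup>2 \<le> (real q * card (X c) * 4 / P) * N\<^sup>2" by (simp only: mult_1)
    then have "1 \<le> real q * card (X c) * 4 / P" using N by (subst (asm) mult_le_cancel_right_pos) auto
    then have "P \<le> real q * card (X c) * 4" using P by (subst (asm) pos_le_divide_eq) auto
    then have "real q * real q ^ Suc m \<le> real q * (4 * card (X c))" by (simp add: P_def mult_ac)
    then have "real q ^ Suc m \<le> 4 * card (X c)" using q by (simp only: mult_le_cancel_left_pos)
    then show ?thesis by simp
  qed
  have XW: "X c \<subseteq> W" using pW E by (auto simp: X_def)
  have gram: "gram k ` nonsingular_simplices k (X c) \<subseteq> gram k ` nonsingular_simplices k E" for k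
  proof (rule image_subsetI)
    fix x assume x: "x \<in> nonsingular_simplices k (X c)"
    define s where "s v = (SOME y. y \<in> E \<and> B y n = c \<and> p y = v)" for v
    have s: "s v \<in> E" "B (s v) n = c" "p (s v) = v" if "v \<in> X c" for v
    proof -
      have "s v \<in> E \<and> B (s v) n = c \<and> p (s v) = v" unfolding s_def by (rule someI_ex) (use that in \<open>auto simp: X_def\<close>)
      then show "s v \<in> E" "B (s v) n = c" "p (s v) = v" by auto
    qed
    have xX: "x i \<in> X c" if "i \<le> k" for i using x that by (auto simp: nonsingular_simplices_def PiE_iff)
    define y where "y = (\<lambda>i\<in>{0..k}. s (x i))"
    have y: "y i \<in> E" "B (y i) n = c" "p (y i) = x i" if "i \<le> k" for i using s[OF xX[OF that]] that by (simp_all add: y_def)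
    have sW: "subsp W" using nd_spaceD(1)[OF W] .
    have edge: "edges y i = edges x i + (B (edges y i) n') \<star> n" "edges x i \<in> W" if i: "i < k" for i
    proof -
      have "x (Suc i) - x 0 = p (y (Suc i)) - p (y 0)" using y(3)[of "Suc i"] y(3)[of 0] i by simp
      also have "\<dots> = (y (Suc i) - y 0) - B (y (Suc i) - y 0) n' \<star> n"
        using y(2)[of "Suc i"] y(2)[of 0] i by (simp add: p_def B_diff sc_diff_left)
      finally show "edges y i = edges x i + (B (edges y i) n') \<star> n" by (simp add: edges_def)
      have "x (Suc i) \<in> W" "x 0 \<in> W" using xX[of "Suc i"] xX[of 0] XW i by auto
      then show "edges x i \<in> W" unfolding edges_def by (rule subspD(5)[OF sW])
    qed
    have Wn: "B w n = 0" "B n w = 0" if "w \<in> W" for w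
    proof -
      show "B w n = 0" using that by (simp add: W_def perp_def)
      then show "B n w = 0" using B_commute[of n w] by simp
    qed
    \<comment> \<open>Within one slice, the edges of the lifted simplex differ from the projected
      ones by multiples of \<open>n\<close>, which is isotropic and orthogonal to
      \<open>W\<close>.\<close>
    have Beq: "B (edges y i) (edges y l) = B (edges x i) (edges x l)" if "i < k" "l < k" for i l
    proof -
      define a b where "a = B (edges y i) n'" and "b = B (edges y l) n'"
      have "B (edges x i + a \<star> n) (edges x l + b \<star> n) = B (edges x i) (edges x l)"
        using Wn[OF edge(2)[OF that(1)]] Wn[OF edge(2)[OF that(2)]] n(3) by (simp add: B_simps)
      then show ?thesis using edge(1)[OF that(1)] edge(1)[OF that(2)] by (simp add: a_def b_def)
    qed
    have "y \<in> nonsingular_simplices k E"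
      using x y(1) nonsingular_gram_cong[of k "edges y" "edges x"] Beq by (auto simp: nonsingular_simplices_def y_def)
    moreover have "gram k x = gram k y" unfolding gram_def using Beq by (intro restrict_ext) auto
    ultimately show "gram k x \<in> gram k ` nonsingular_simplices k E" by blast
  qed
  show ?thesis by (rule that[OF W XW size[unfolded N_def] gram])
qed

end

section \<open>Induction on the dimension\<close>

context form_space
begin

text \<open>The constants are parameters of the statement: inside the locale \<open>q\<close> is
  fixed, and uniformity in \<open>q\<close> shows only in their being given by expressions free of
  \<open>q\<close>.\<close>

definition many_grams :: "nat \<Rightarrow> nat \<Rightarrow> real \<Rightarrow> real \<Rightarrow> real \<Rightarrow> bool" where
  "many_grams d k b C c \<longleftrightarrow> (\<forall>U E. nd_space d U \<longrightarrow> E \<subseteq> U \<longrightarrow> C * real q powr b \<le> card E \<longrightarrow>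
    c * real q ^ (Suc k choose 2) \<le> card (gram k ` nonsingular_simplices k E))"

text \<open>The gap \<open>1 / 3\<close> between \<open>b\<close> and the dimension leaves a factor
  \<open>q powr (1 / 3)\<close> between the size required in \<open>W\<close> and the size of
  \<open>W\<close>. It absorbs \<open>4 * C\<close> unless \<open>q\<close> is bounded, and then
  \<open>E\<close> would exceed the space. Among the base cases the smallest gap is
  \<open>(k - 1) / (k + 1)\<close> at \<open>k = 2\<close>, which is \<open>1 / 3\<close>.\<close>

lemma many_grams_step:
  assumes base: "many_grams (Suc m) k b C c" and C: "C \<ge> 1" and b: "0 \<le> b" "b \<le> real (Suc m) - 1 / 3"
  shows "many_grams (Suc m + 2) k (b + 1) ((4 * C) ^ (3 * (Suc m + 2))) c"
  unfolding many_grams_def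
proof (intro allI impI)
  fix U E assume U: "nd_space (Suc m + 2) U" and E: "E \<subseteq> U"
    and large: "(4 * C) ^ (3 * (Suc m + 2)) * real q powr (b + 1) \<le> card E"
  define C1 where "C1 = (4 * C) ^ (3 * (Suc m + 2))"
  define N where "N = real (card E)"
  have fE: "finite E" using finite_subset[OF E nd_spaceD(2)[OF U]] .
  have U': "nd_space (Suc (Suc (Suc m))) U" using U by simp
  have q: "real q > 0" "real q \<ge> 1" using q_ge_3 by auto
  have C1: "4 * C \<le> C1"
  proof -
    have "(4 * C) ^ 1 \<le> C1" unfolding C1_def using C by (intro power_increasing) auto
    then show ?thesis by simp
  qed
  have qb: "real q powr (b + 1) = real q * real q powr b" using q by (simp add: powr_add)
  have qb1: "real q powr (b + 1) \<ge> 1" using q b by (intro ge_one_powr_ge_zero) auto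
  have large': "C1 * real q powr (b + 1) \<le> N" using large by (simp add: C1_def N_def)
  have C10: "C1 \<ge> 1" using C1 C by linarith
  have "C1 * 1 \<le> C1 * real q powr (b + 1)" using qb1 C10 by (intro mult_left_mono) auto
  then have C1N: "C1 \<le> N" using large' by simp
  then have ne: "E \<noteq> {}" using C10 by (auto simp: N_def)
  obtain W E' where W: "nd_space (Suc m) W" "E' \<subseteq> W"
    and size: "min (N / q) (real q ^ Suc m) \<le> 4 * card E'"
    and sub: "gram k ` nonsingular_simplices k E' \<subseteq> gram k ` nonsingular_simplices k E"
    using reduction[OF U' E ne] unfolding N_def by metis
  have "C * real q powr b \<le> card E'"
  proof -
    have l1: "4 * (C * real q powr b) \<le> N / q"
    proof -
      have "4 * C * (real q * real q powr b) \<le> C1 * (real q * real q powr b)"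
        using C1 by (rule mult_right_mono) simp
      then have "4 * C * (real q * real q powr b) \<le> N" using large' unfolding qb by linarith
      then show ?thesis using q by (subst pos_le_divide_eq) (auto simp: mult_ac)
    qed
    have l2: "4 * (C * real q powr b) \<le> real q ^ Suc m"
    proof (cases "4 * C \<le> real q powr (1 / 3)")
      case True
      have "4 * C * real q powr b \<le> real q powr (1 / 3) * real q powr b" using True by (rule mult_right_mono) simp
      also have "\<dots> = real q powr (1 / 3 + b)" by (simp add: powr_add)
      also have "\<dots> \<le> real q powr (real (Suc m))" using b q by (intro powr_mono) auto
      also have "\<dots> = real q ^ Suc m" using q by (intro powr_realpow)
      finally show ?thesis by (simp only: mult.assoc)
    next
      case False
      have "real q = (real q powr (1 / 3)) powr 3" using q by (simp add: powr_powr)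
      also have "\<dots> = (real q powr (1 / 3)) ^ 3" using q powr_realpow[of "real q powr (1 / 3)" 3] by simp
      also have "\<dots> < (4 * C) ^ 3" using False by (intro power_strict_mono) auto
      finally have "real q ^ (Suc m + 2) < ((4 * C) ^ 3) ^ (Suc m + 2)" using q by (intro power_strict_mono) auto
      also have "\<dots> = C1" by (simp only: C1_def power_mult)
      also have "\<dots> \<le> N" by (rule C1N)
      also have "\<dots> \<le> real q ^ (Suc m + 2)"
        using of_nat_mono[OF card_mono[OF nd_spaceD(2)[OF U] E]] nd_spaceD(3)[OF U] by (simp add: N_def)
      finally show ?thesis by simp
    qed
    show ?thesis using l1 l2 size by linarith
  qed
  then have "c * real q ^ (Suc k choose 2) \<le> card (gram k ` nonsingular_simplices k E')"
    using base W unfolding many_grams_def by blast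
  also have "\<dots> \<le> card (gram k ` nonsingular_simplices k E)"
    by (intro of_nat_mono card_mono sub) (simp add: finite_nonsingular_simplices[OF fE])
  finally show "c * real q ^ (Suc k choose 2) \<le> card (gram k ` nonsingular_simplices k E)" .
qed

lemma many_grams_iterate:
  assumes "many_grams d k b C c" "C \<ge> 1" "d \<ge> 1" "0 \<le> b" "b \<le> real d - 1 / 3"
  shows "many_grams (d + 2 * i) k (b + real i) (iterated_const C d i) c"
proof (induction i)
  case (Suc i)
  obtain m where m: "d + 2 * i = Suc m" using assms(3) by (cases "d + 2 * i") auto
  have "many_grams (Suc m + 2) k (b + real i + 1) ((4 * iterated_const C d i) ^ (3 * (Suc m + 2))) c"
  proof (rule many_grams_step)
    show "many_grams (Suc m) k (b + real i) (iterated_const C d i) c" using Suc m by simp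
    show "b + real i \<le> real (Suc m) - 1 / 3" using assms(5) unfolding m[symmetric] by simp
  qed (use iterated_const_ge_1[OF assms(2)] assms(4) in auto)
  moreover have "Suc m + 2 = d + 2 * Suc i" "b + real i + 1 = b + real (Suc i)" using m by auto
  moreover have "(4 * iterated_const C d i) ^ (3 * (Suc m + 2)) = iterated_const C d (Suc i)"
    by (simp only: iterated_const.simps m)
  ultimately show ?case by (simp only:)
qed (use assms in simp)

lemma many_grams_odd:
  assumes "2 \<le> k"
  shows "many_grams (Suc k) k (real k) 4 (pinned_const k (1 / 2 ^ k) (2 ^ k + 9))"
  unfolding many_grams_def
proof (intro allI impI)
  fix U E assume "nd_space (Suc k) U" "E \<subseteq> U" "4 * real q powr real k \<le> card E"
  then show "pinned_const k (1 / 2 ^ k) (2 ^ k + 9) * real q ^ (Suc k choose 2) \<le> card (gram k ` nonsingular_simplices k E)"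
    by (intro odd_base[OF _ _ assms]) (simp_all add: powr_realpow)
qed

lemma many_grams_even:
  assumes k: "2 \<le> k"
  shows "many_grams k k (real k - (real k - 1) / (real k + 1)) 4 (1 / (8 ^ k * (2 ^ Suc k + 4)))"
  unfolding many_grams_def
proof (intro allI impI)
  fix U E assume U: "nd_space k U" and E: "E \<subseteq> U"
    and large: "4 * real q powr (real k - (real k - 1) / (real k + 1)) \<le> card E"
  define b where "b = real k - (real k - 1) / (real k + 1)"
  define N where "N = real (card E)"
  have q: "real q > 0" "real q \<ge> 1" using q_ge_3 by auto
  have large': "4 * real q powr b \<le> N" using large by (simp add: b_def N_def)
  have b1: "real k - 1 \<le> b" using k by (simp add: b_def divide_le_eq)
  \<comment> \<open>Over a common denominator \<open>b\<close> is
    \<open>(k * k + 1) / (k + 1)\<close>, the exponent demanded by the second size condition of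
    \<open>even_base\<close>.\<close>
  have bk: "b * real (Suc k) = real (k * k + 1)" using k by (simp add: b_def field_simps)
  have "real q ^ k = real q powr (real k)" using q by (simp add: powr_realpow)
  also have "\<dots> \<le> real q powr (b + 1)" using b1 q by (intro powr_mono) auto
  also have "\<dots> = real q * real q powr b" using q by (simp add: powr_add)
  finally have "4 * real q ^ k \<le> real q * (4 * real q powr b)" by simp
  also have "\<dots> \<le> real q * N" using large' q by (intro mult_left_mono) auto
  finally have "real (4 * q ^ k) \<le> real (q * card E)" by (simp add: N_def)
  then have l1: "4 * q ^ k \<le> q * card E" by (simp only: of_nat_le_iff)
  have "real q ^ (k * k + 1) = real q powr (b * real (Suc k))" unfolding bk using q by (simp only: powr_realpow)
  also have "\<dots> = (real q powr b) ^ Suc k"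
    using q powr_realpow[of "real q powr b" "Suc k"] by (simp only: powr_powr[symmetric]) simp
  also have "\<dots> \<le> N ^ Suc k"
  proof (rule power_mono)
    have "real q powr b \<ge> 0" by simp
    then show "real q powr b \<le> N" using large' by linarith
  qed simp
  finally have l2: "real q ^ (k * k + 1) \<le> real (card E) ^ Suc k" by (simp only: N_def)
  show "1 / (8 ^ k * (2 ^ Suc k + 4)) * real q ^ (Suc k choose 2) \<le> card (gram k ` nonsingular_simplices k E)"
    using even_base[OF U E k l1 l2] by simp
qed

end

definition size_const :: "nat \<Rightarrow> nat \<Rightarrow> real" where
  "size_const d k = (if even (d - k) then iterated_const 4 k ((d - k) div 2)
     else iterated_const 4 (Suc k) ((d - k) div 2))"

definition count_const :: "nat \<Rightarrow> nat \<Rightarrow> real" where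
  "count_const d k = (if even (d - k) then 1 / (8 ^ k * (2 ^ Suc k + 4))
     else pinned_const k (1 / 2 ^ k) (2 ^ k + 9))"

lemma size_const_pos: "size_const d k > 0"
proof -
  have "0 < iterated_const 4 d i" for d i using iterated_const_ge_1[of 4 d i] by simp
  then show ?thesis unfolding size_const_def by simp
qed

lemma count_const_pos: "count_const d k > 0"
proof -
  have "(0::real) < 8 ^ k * (2 ^ Suc k + 4)" by (intro mult_pos_pos add_pos_pos) auto
  moreover have "0 < pinned_const k (1 / 2 ^ k) (2 ^ k + 9)" by (intro pinned_const_pos add_pos_pos) auto
  ultimately show ?thesis unfolding count_const_def by simp
qed

lemma (in form_space) many_grams_beta:
  assumes "2 \<le> k" "k \<le> d"
  shows "many_grams d k (beta d k) (size_const d k) (count_const d k)"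
proof (cases "even (d - k)")
  case True
  then obtain i where "d - k = 2 * i" by blast
  then have i: "d = k + 2 * i" "(d - k) div 2 = i" using assms(2) by auto
  let ?b = "real k - (real k - 1) / (real k + 1)"
  have "0 \<le> ?b" "?b \<le> real k - 1 / 3" using assms(1) by (simp_all add: field_simps)
  then have "many_grams (k + 2 * i) k (?b + real i) (iterated_const 4 k i) (1 / (8 ^ k * (2 ^ Suc k + 4)))"
    using assms(1) by (intro many_grams_iterate many_grams_even) auto
  moreover have "beta d k = ?b + real i" by (simp add: beta_def i)
  ultimately show ?thesis using True i by (simp add: size_const_def count_const_def)
next
  case False
  then obtain i where "d - k = 2 * i + 1" by (elim oddE)
  then have i: "d = Suc k + 2 * i" "(d - k) div 2 = i" using assms(2) by auto
  have "many_grams (Suc k + 2 * i) k (real k + real i) (iterated_const 4 (Suc k) i) (pinned_const k (1 / 2 ^ k) (2 ^ k + 9))"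
    using assms(1) by (intro many_grams_iterate many_grams_odd) auto
  moreover have "beta d k = real k + real i" by (simp add: beta_def i)
  ultimately show ?thesis using False i by (simp add: size_const_def count_const_def)
qed

section \<open>Gram determinants\<close>

text \<open>Bordering by a unit row and column moves the index set from \<open>{1..k}\<close> to \<open>{0..<Suc k}\<close>, the one
  used by \<open>det\<close>, without changing any permutation.\<close>

definition bordered :: "nat \<Rightarrow> (nat \<Rightarrow> nat \<Rightarrow> 'a::comm_ring_1) \<Rightarrow> 'a mat" where
  "bordered k A = mat (Suc k) (Suc k) (\<lambda>(i, j). if i = 0 \<or> j = 0 then (if i = j then 1 else 0) else A i j)"

lemma bordered_carrier [simp]: "bordered k A \<in> carrier_mat (Suc k) (Suc k)"
  by (simp add: bordered_def)

lemma det_bordered: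
  "det (bordered k A) = (\<Sum>p | p permutes {1..k}. of_int (sign p) * (\<Prod>i\<in>{1..k}. A i (p i)))"
proof -
  have ins: "{0..<Suc k} = insert 0 {1..k}" by auto
  have "det (bordered k A) = (\<Sum>p | p permutes {0..<Suc k}. of_int (sign p) * (\<Prod>i = 0..<Suc k. bordered k A $$ (i, p i)))"
    by (rule det_def'[OF bordered_carrier])
  also have "\<dots> = (\<Sum>p | p permutes {1..k}. of_int (sign p) * (\<Prod>i\<in>{1..k}. A i (p i)))"
  proof (rule sum.mono_neutral_cong_right)
    show "finite {p. p permutes {0..<Suc k}}" by (simp add: finite_permutations)
    show "{p. p permutes {1..k}} \<subseteq> {p. p permutes {0..<Suc k}}"
      by (rule subsetI, simp only: mem_Collect_eq, erule permutes_subset) auto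
    show "\<forall>p\<in>{p. p permutes {0..<Suc k}} - {p. p permutes {1..k}}.
        of_int (sign p) * (\<Prod>i = 0..<Suc k. bordered k A $$ (i, p i)) = 0"
    proof
      fix p assume p: "p \<in> {p. p permutes {0..<Suc k}} - {p. p permutes {1..k}}"
      have "p 0 \<noteq> 0"
      proof
        assume p0: "p 0 = 0"
        have "p permutes {0..<Suc k}" using p by simp
        then have "p permutes {1..k}"
        proof (rule permutes_superset)
          fix x assume "x \<in> {0..<Suc k} - {1..k}"
          then have "x = 0" by auto
          then show "p x = x" using p0 by simp
        qed
        then show False using p by blast
      qed
      moreover have "p 0 < Suc k" using p permutes_in_image[of p "{0..<Suc k}" 0] by simp
      ultimately have "bordered k A $$ (0, p 0) = 0" by (simp add: bordered_def)
      then have "(\<Prod>i = 0..<Suc k. bordered k A $$ (i, p i)) = 0" unfolding ins by simp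
      then show "of_int (sign p) * (\<Prod>i = 0..<Suc k. bordered k A $$ (i, p i)) = 0" by simp
    qed
    fix p assume "p \<in> {p. p permutes {1..k}}"
    then have p: "p permutes {1..k}" by simp
    have "p 0 = 0" using permutes_not_in[OF p] by simp
    then have p0: "bordered k A $$ (0, p 0) = 1" by (simp add: bordered_def)
    have "bordered k A $$ (i, p i) = A i (p i)" if "i \<in> {1..k}" for i
      using permutes_in_image[OF p, of i] that by (auto simp: bordered_def)
    then have "(\<Prod>i\<in>{1..k}. bordered k A $$ (i, p i)) = (\<Prod>i\<in>{1..k}. A i (p i))" by (rule prod.cong[OF refl])
    then have "(\<Prod>i = 0..<Suc k. bordered k A $$ (i, p i)) = (\<Prod>i\<in>{1..k}. A i (p i))"
      unfolding ins by (simp add: p0)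
    then show "of_int (sign p) * (\<Prod>i = 0..<Suc k. bordered k A $$ (i, p i)) = of_int (sign p) * (\<Prod>i\<in>{1..k}. A i (p i))"
      by simp
  qed
  finally show ?thesis .
qed

lemma bordered_mult:
  "bordered k A * bordered k H = bordered k (\<lambda>i j. \<Sum>l\<in>{1..k}. A i l * H l j)"
proof (rule eq_matI)
  have ins: "{0..<Suc k} = insert 0 {1..k}" by auto
  fix i j assume "i < dim_row (bordered k (\<lambda>i j. \<Sum>l\<in>{1..k}. A i l * H l j))"
    "j < dim_col (bordered k (\<lambda>i j. \<Sum>l\<in>{1..k}. A i l * H l j))"
  then have ij: "i < Suc k" "j < Suc k" by (simp_all add: bordered_def)
  have "(bordered k A * bordered k H) $$ (i, j) = (\<Sum>l\<in>{0..<Suc k}. bordered k A $$ (i, l) * bordered k H $$ (l, j))"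
    using ij by (simp add: bordered_def scalar_prod_def)
  also have "\<dots> = bordered k A $$ (i, 0) * bordered k H $$ (0, j) + (\<Sum>l\<in>{1..k}. bordered k A $$ (i, l) * bordered k H $$ (l, j))"
    unfolding ins by (rule sum.insert) auto
  also have "(\<Sum>l\<in>{1..k}. bordered k A $$ (i, l) * bordered k H $$ (l, j)) = (\<Sum>l\<in>{1..k}. if i = 0 \<or> j = 0 then 0 else A i l * H l j)"
    by (rule sum.cong[OF refl]) (use ij in \<open>auto simp: bordered_def\<close>)
  also have "bordered k A $$ (i, 0) * bordered k H $$ (0, j) + \<dots> = bordered k (\<lambda>i j. \<Sum>l\<in>{1..k}. A i l * H l j) $$ (i, j)"
    using ij by (auto simp: bordered_def)
  finally show "(bordered k A * bordered k H) $$ (i, j) = bordered k (\<lambda>i j. \<Sum>l\<in>{1..k}. A i l * H l j) $$ (i, j)" .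
qed (simp_all add: bordered_def)

text \<open>Padding the factor \<open>Y\<close> with zero columns to a square matrix
  \<open>P\<close> makes \<open>A\<close> the product of \<open>P\<close> and its transpose. Column
  \<open>k\<close> of \<open>P\<close> is zero because \<open>r < k\<close>, so its determinant
  vanishes.\<close>

lemma det_bordered_low_rank:
  assumes "r < k" "\<And>i j. i \<in> {1..k} \<Longrightarrow> j \<in> {1..k} \<Longrightarrow> A i j = (\<Sum>l<r. Y i l * Y j l)"
  shows "det (bordered k A) = 0"
proof -
  define P where "P i l = (if l \<le> r then Y i (l - 1) else 0)" for i l
  have "A i j = (\<Sum>l\<in>{1..k}. P i l * P j l)" if ij: "i \<in> {1..k}" "j \<in> {1..k}" for i j
  proof -
    have "A i j = (\<Sum>l<r. Y i l * Y j l)" by (rule assms(2)[OF ij])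
    also have "\<dots> = (\<Sum>l\<in>{1..r}. P i l * P j l)"
      by (rule sum.reindex_bij_witness[of _ "\<lambda>l. l - 1" Suc]) (auto simp: P_def)
    also have "\<dots> = (\<Sum>l\<in>{1..k}. P i l * P j l)"
      by (rule sum.mono_neutral_left) (use assms(1) in \<open>auto simp: P_def\<close>)
    finally show ?thesis .
  qed
  then have "bordered k A = bordered k (\<lambda>i j. \<Sum>l\<in>{1..k}. P i l * P j l)"
    by (intro eq_matI) (auto simp: bordered_def)
  also have "\<dots> = bordered k P * bordered k (\<lambda>l j. P j l)" by (rule bordered_mult[symmetric])
  finally have "det (bordered k A) = det (bordered k P) * det (bordered k (\<lambda>l j. P j l))"
    by (simp add: det_mult[of _ "Suc k"])
  moreover have "det (bordered k P) = 0"
    unfolding det_bordered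
  proof (rule sum.neutral, rule ballI)
    fix p assume "p \<in> {p. p permutes {1..k}}"
    then have p: "p permutes {1..k}" by simp
    have "k \<in> p ` {1..k}" using permutes_image[OF p] assms(1) by simp
    then obtain i where i: "i \<in> {1..k}" "p i = k" by auto
    then have "P i (p i) = 0" using assms(1) by (simp add: P_def)
    then have "(\<Prod>i\<in>{1..k}. P i (p i)) = 0" using i(1) by (intro prod_zero) auto
    then show "of_int (sign p) * (\<Prod>i\<in>{1..k}. P i (p i)) = 0" by simp
  qed
  ultimately show ?thesis by simp
qed

text \<open>Solving the Gram system for each column of \<open>e\<close> times the identity gives a
  matrix \<open>H\<close> that is inverse to the Gram matrix over \<open>K\<close>. Hence the
  product of the two determinants, multiplied by \<open>e\<close>, is \<open>e\<close>.\<close>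

lemma (in form_space) nonsingular_det:
  assumes v: "nonsingular k v" "\<And>i. i < k \<Longrightarrow> unital (v i)"
  shows "e * det (bordered k (\<lambda>i j. B (v (i - 1)) (v (j - 1)))) \<noteq> 0"
proof
  let ?A = "\<lambda>i j. B (v (i - 1)) (v (j - 1))"
  assume zero: "e * det (bordered k ?A) = 0"
  have "\<exists>c. (\<forall>i<k. B (v i) (lincomb k c v) = (if i = j then e else 0))" for j
    using gram_solve[OF v, of "\<lambda>i. if i = j then e else 0"] by (metis K_closed(1,2))
  then obtain c where c: "\<And>j i. i < k \<Longrightarrow> B (v i) (lincomb k (c j) v) = (if i = j then e else 0)" by metis
  define H where "H l j = c (j - 1) (l - 1)" for l j
  have AH: "(\<Sum>l\<in>{1..k}. ?A i l * H l j) = (if i = j then e else 0)" if "i \<in> {1..k}" "j \<in> {1..k}" for i j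
  proof -
    have "(\<Sum>l\<in>{1..k}. ?A i l * H l j) = (\<Sum>l<k. c (j - 1) l * B (v (i - 1)) (v l))"
      by (rule sum.reindex_bij_witness[of _ Suc "\<lambda>l. l - 1"]) (auto simp: H_def mult.commute)
    also have "\<dots> = B (v (i - 1)) (lincomb k (c (j - 1)) v)" by (simp add: B_lincomb)
    also have "\<dots> = (if i = j then e else 0)" using c[of "i - 1" "j - 1"] that by auto
    finally show ?thesis .
  qed
  let ?D = "\<lambda>i j :: nat. if i = j then e else 0"
  have "bordered k ?A * bordered k H = bordered k ?D"
    unfolding bordered_mult using AH by (intro eq_matI) (auto simp: bordered_def)
  then have eq: "det (bordered k ?A) * det (bordered k H) = det (bordered k ?D)"
    by (simp add: det_mult[of _ "Suc k", symmetric])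
  have "upper_triangular (bordered k ?D)" by (auto simp: upper_triangular_def bordered_def)
  then have d1: "det (bordered k ?D) = (\<Prod>i = 0..<Suc k. bordered k ?D $$ (i, i))"
    using det_upper_triangular[OF _ bordered_carrier, of k ?D] by (simp add: prod_list_diag_prod bordered_def)
  have d2: "e * (\<Prod>i = 0..<m. bordered k ?D $$ (i, i)) = e" if "m \<le> Suc k" for m
    using that
  proof (induction m)
    case (Suc m)
    have "e * bordered k ?D $$ (m, m) = e" using Suc.prems idem by (simp add: bordered_def)
    moreover have "e * (\<Prod>i = 0..<Suc m. bordered k ?D $$ (i, i)) = (e * bordered k ?D $$ (m, m)) * (\<Prod>i = 0..<m. bordered k ?D $$ (i, i))"
      by (simp only: prod.atLeast0_lessThan_Suc mult_ac)
    ultimately have "e * (\<Prod>i = 0..<Suc m. bordered k ?D $$ (i, i)) = e * (\<Prod>i = 0..<m. bordered k ?D $$ (i, i))"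
      by (simp only:)
    then show ?case using Suc by simp
  qed simp
  have "e * det (bordered k ?D) = e" unfolding d1 by (rule d2[OF order_refl])
  moreover have "e * det (bordered k ?D) = e * det (bordered k ?A) * det (bordered k H)"
    unfolding eq[symmetric] by (simp add: mult.assoc)
  ultimately show False using zero e_nz by simp
qed

section \<open>Transfer to a given field\<close>

text \<open>
  The product of all commutative rings with carrier in \<open>int\<close> is itself a commutative ring, now at the
  level of types, and a field \<open>F :: int ring\<close> sits inside it as the ideal generated by an idempotent.
  This lets the arguments above, stated with type classes, apply to \<open>F\<close>.
\<close>

typedef cring_prod = "{f :: int ring \<Rightarrow> int. \<forall>S. if cring S then f S \<in> carrier S else f S = 0}"
proof -
  have "\<zero>\<^bsub>S\<^esub> \<in> carrier S" if "cring S" for S :: "int ring" using that by (simp add: cring.cring_simprules)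
  then show ?thesis by (intro exI[of _ "\<lambda>S. if cring S then \<zero>\<^bsub>S\<^esub> else 0"]) simp
qed

abbreviation proj :: "cring_prod \<Rightarrow> int ring \<Rightarrow> int" where "proj \<equiv> Rep_cring_prod"

lemma proj_closed: "cring S \<Longrightarrow> proj x S \<in> carrier S"
  using Rep_cring_prod[of x] by (auto dest: spec[of _ S])

lemma cring_prod_eqI: "(\<And>S. cring S \<Longrightarrow> proj x S = proj y S) \<Longrightarrow> x = y"
proof (rule iffD1[OF Rep_cring_prod_inject], rule ext)
  fix S assume a: "\<And>S. cring S \<Longrightarrow> proj x S = proj y S"
  show "proj x S = proj y S"
    using a[of S] Rep_cring_prod[of x] Rep_cring_prod[of y] by (cases "cring S") (auto dest: spec[of _ S])
qed

definition mk_prod :: "(int ring \<Rightarrow> int) \<Rightarrow> cring_prod" where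
  "mk_prod f = Abs_cring_prod (\<lambda>S. if cring S then f S else 0)"

lemma proj_mk_prod:
  assumes "\<And>S. cring S \<Longrightarrow> f S \<in> carrier S" "cring S"
  shows "proj (mk_prod f) S = f S"
  unfolding mk_prod_def using assms by (subst Abs_cring_prod_inverse) auto

instantiation cring_prod :: comm_ring_1
begin

definition "0 = mk_prod (\<lambda>S. \<zero>\<^bsub>S\<^esub>)"
definition "1 = mk_prod (\<lambda>S. \<one>\<^bsub>S\<^esub>)"
definition "x + y = mk_prod (\<lambda>S. proj x S \<oplus>\<^bsub>S\<^esub> proj y S)"
definition "x * y = mk_prod (\<lambda>S. proj x S \<otimes>\<^bsub>S\<^esub> proj y S)"
definition "- x = mk_prod (\<lambda>S. \<ominus>\<^bsub>S\<^esub> proj x S)"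
definition "x - y = mk_prod (\<lambda>S. proj x S \<ominus>\<^bsub>S\<^esub> proj y S)"

lemma proj_ops:
  assumes "cring S"
  shows "proj 0 S = \<zero>\<^bsub>S\<^esub>" "proj 1 S = \<one>\<^bsub>S\<^esub>" "proj (x + y) S = proj x S \<oplus>\<^bsub>S\<^esub> proj y S"
    "proj (x * y) S = proj x S \<otimes>\<^bsub>S\<^esub> proj y S" "proj (- x) S = \<ominus>\<^bsub>S\<^esub> proj x S"
    "proj (x - y) S = proj x S \<ominus>\<^bsub>S\<^esub> proj y S"
  unfolding zero_cring_prod_def one_cring_prod_def plus_cring_prod_def times_cring_prod_def
    uminus_cring_prod_def minus_cring_prod_def
  by (rule proj_mk_prod; simp add: assms proj_closed cring.cring_simprules)+

instance
proof
  fix x y z :: cring_prod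
  have cl: "proj u S \<in> carrier S" if "cring S" for u S using proj_closed[OF that] .
  show "x * y * z = x * (y * z)" by (rule cring_prod_eqI) (simp add: proj_ops cl cring.cring_simprules(11))
  show "x * y = y * x" by (rule cring_prod_eqI) (simp add: proj_ops cl cring.cring_simprules(14))
  show "1 * x = x" by (rule cring_prod_eqI) (simp add: proj_ops cl cring.cring_simprules(12))
  show "x + y + z = x + (y + z)" by (rule cring_prod_eqI) (simp add: proj_ops cl cring.cring_simprules(7))
  show "x + y = y + x" by (rule cring_prod_eqI) (simp add: proj_ops cl cring.cring_simprules(10))
  show "0 + x = x" by (rule cring_prod_eqI) (simp add: proj_ops cl cring.cring_simprules(8))
  show "- x + x = 0" by (rule cring_prod_eqI) (simp add: proj_ops cl cring.cring_simprules(9))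
  show "x - y = x + - y" by (rule cring_prod_eqI) (simp add: proj_ops a_minus_def)
  show "(x + y) * z = x * z + y * z" by (rule cring_prod_eqI) (simp add: proj_ops cl cring.cring_simprules(13))
  show "(0 :: cring_prod) \<noteq> 1"
  proof
    assume "(0 :: cring_prod) = 1"
    then have "proj 0 int_ring = proj 1 int_ring" by simp
    then show False by (simp add: proj_ops int_is_cring)
  qed
qed

end

section \<open>The given quadratic space inside the product ring\<close>

locale finite_quadratic_space =
  fixes F :: "int ring" (structure) and d :: nat and Qf :: "(nat \<Rightarrow> int) \<Rightarrow> int"
  assumes field_F: "field F" and finite_F: "finite (carrier F)" and odd_F: "odd (order F)"
    and quadratic: "quadratic_form F (coord_space F d) Qf"
    and nondegenerate: "nondegenerate_form F (coord_space F d) Qf"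
begin

sublocale field F by (rule field_F)

abbreviation V where "V \<equiv> coord_space F d"
abbreviation pf where "pf \<equiv> polar_form F V Qf"

sublocale V: module F V by (rule coord_space_module) (rule is_cring)

text \<open>All components outside \<open>F\<close> are zero, so sums and products are respected
  while the unit of \<open>F\<close> goes to an idempotent instead of \<open>1\<close>.\<close>

definition emb :: "int \<Rightarrow> cring_prod" where "emb a = mk_prod (\<lambda>S. if S = F then a else \<zero>\<^bsub>S\<^esub>)"

lemma proj_emb: "a \<in> carrier F \<Longrightarrow> cring S \<Longrightarrow> proj (emb a) S = (if S = F then a else \<zero>\<^bsub>S\<^esub>)"
  unfolding emb_def by (rule proj_mk_prod) (auto simp: cring.cring_simprules)

lemma proj_emb_F [simp]: "a \<in> carrier F \<Longrightarrow> proj (emb a) F = a"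
  by (simp add: proj_emb is_cring)

lemma proj_F [simp]: "proj x F \<in> carrier F" "proj 0 F = \<zero>" "proj (x + y) F = proj x F \<oplus> proj y F"
  "proj (x * y) F = proj x F \<otimes> proj y F" "proj (x - y) F = proj x F \<ominus> proj y F"
  by (simp_all add: proj_ops proj_closed is_cring)

lemma emb_ops:
  assumes "a \<in> carrier F" "b \<in> carrier F"
  shows "emb (a \<oplus> b) = emb a + emb b" "emb (a \<otimes> b) = emb a * emb b" "emb (\<ominus> a) = - emb a"
  using assms
  by (auto intro!: cring_prod_eqI simp: proj_emb proj_ops cring.cring_simprules a_minus_def)

lemma emb_zero [simp]: "emb \<zero> = 0"
  by (rule cring_prod_eqI) (simp add: proj_emb proj_ops)

lemma mult_emb: "a \<in> carrier F \<Longrightarrow> x * emb a = emb (proj x F \<otimes> a)"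
  by (rule cring_prod_eqI) (auto simp: proj_emb proj_ops proj_closed cring.cring_simprules)

lemma emb_inj: "a \<in> carrier F \<Longrightarrow> b \<in> carrier F \<Longrightarrow> emb a = emb b \<longleftrightarrow> a = b"
  by (metis proj_emb_F)

abbreviation unit_F :: cring_prod where "unit_F \<equiv> emb \<one>"

lemma unit_mult: "unit_F * x = emb (proj x F)"
  using mult_emb[of \<one> x] by (simp add: mult.commute)

lemma fixed_iff: "unit_F * x = x \<longleftrightarrow> x \<in> emb ` carrier F"
proof
  assume "unit_F * x = x"
  then have "x = emb (proj x F)" by (simp add: unit_mult)
  then show "x \<in> emb ` carrier F" by (rule image_eqI) simp
qed (auto simp: unit_mult)

text \<open>If two were zero, an odd multiple of the unit would be the unit itself; but
  \<open>order F\<close> times the unit is zero by Lagrange's theorem, and \<open>order F\<close> is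
  odd.\<close>

lemma two_nz: "\<one> \<oplus> \<one> \<noteq> \<zero>"
proof
  assume two: "\<one> \<oplus> \<one> = \<zero>"
  obtain m where m: "order F = Suc (2 * m)" using odd_F by (auto elim: oddE)
  have o: "order (add_monoid F) = order F" by (simp add: order_def)
  have "\<one> [^]\<^bsub>add_monoid F\<^esub> (2 * n) = \<zero>" for n :: nat
    by (induction n) (simp_all add: nat_pow_def two a_assoc)
  then have "\<one> [^]\<^bsub>add_monoid F\<^esub> Suc (2 * m) = \<one>" by (simp add: nat_pow_def)
  moreover have "\<one> [^]\<^bsub>add_monoid F\<^esub> order (add_monoid F) = \<zero>"
    using group.pow_order_eq_1[OF add.group_axioms, of \<one>] finite_F by simp
  ultimately show False using m o by simp
qed

lemma idem_field_unit: "idem_field unit_F"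
proof
  show "unit_F * unit_F = unit_F" by (simp add: unit_mult)
  show "unit_F \<noteq> 0" using emb_inj[of \<one> \<zero>] by simp
  show "finite {x. unit_F * x = x}" unfolding fixed_iff using finite_F by simp
  show "\<exists>y. unit_F * y = y \<and> x * y = unit_F" if "unit_F * x = x" "x \<noteq> 0" for x
  proof -
    obtain a where a: "x = emb a" "a \<in> carrier F" using \<open>unit_F * x = x\<close> unfolding fixed_iff by blast
    have "a \<noteq> \<zero>" using that(2) unfolding a(1) by (rule contrapos_nn) simp
    then have u: "a \<in> Units F" unfolding field_Units using a(2) by blast
    have "inv a \<in> carrier F" "a \<otimes> inv a = \<one>" by (rule Units_inv_closed[OF u], rule Units_r_inv[OF u])
    then show ?thesis using a by (intro exI[of _ "emb (inv a)"]) (simp add: unit_mult emb_ops(2)[symmetric])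
  qed
  have u: "\<one> \<oplus> \<one> \<in> Units F" unfolding field_Units using two_nz by simp
  define h where "h = inv (\<one> \<oplus> \<one>)"
  have h: "h \<in> carrier F" "(\<one> \<oplus> \<one>) \<otimes> h = \<one>"
    unfolding h_def by (rule Units_inv_closed[OF u], rule Units_r_inv[OF u])
  have "h \<oplus> h = \<one>" using h by (simp add: l_distr)
  then show "\<exists>h. unit_F * h = h \<and> h + h = unit_F"
    using h(1) by (intro exI[of _ "emb h"]) (simp add: unit_mult emb_ops(1)[symmetric])
qed

definition descend :: "(nat \<Rightarrow> cring_prod) \<Rightarrow> nat \<Rightarrow> int" where "descend u = (\<lambda>i\<in>{..<d}. proj (u i) F)"
definition lift_vec :: "(nat \<Rightarrow> int) \<Rightarrow> nat \<Rightarrow> cring_prod" where "lift_vec v i = (if i < d then emb (v i) else 0)"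
definition vscale :: "cring_prod \<Rightarrow> (nat \<Rightarrow> cring_prod) \<Rightarrow> nat \<Rightarrow> cring_prod" where "vscale a u i = a * u i"
text \<open>Pulling the form back along \<open>descend\<close> makes it bilinear on all functions at
  once. Nondegeneracy holds on the image of \<open>lift_vec\<close>, which is the space
  \<open>U\<close> of the transfer.\<close>

definition Bf :: "(nat \<Rightarrow> cring_prod) \<Rightarrow> (nat \<Rightarrow> cring_prod) \<Rightarrow> cring_prod" where "Bf u v = emb (pf (descend u) (descend v))"

lemma carrier_V: "carrier V = {..<d} \<rightarrow>\<^sub>E carrier F" by (simp add: coord_space_def)

lemma descend_closed [simp]: "descend u \<in> carrier V" by (simp add: carrier_V descend_def)

lemma descend_add: "descend (u + v) = descend u \<oplus>\<^bsub>V\<^esub> descend v"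
  by (auto simp: descend_def coord_space_def fun_eq_iff)

lemma descend_scale: "descend (vscale a u) = proj a F \<odot>\<^bsub>V\<^esub> descend u"
  by (auto simp: descend_def coord_space_def fun_eq_iff vscale_def)

lemma descend_lift [simp]: "v \<in> carrier V \<Longrightarrow> descend (lift_vec v) = v"
  by (auto simp: descend_def lift_vec_def carrier_V PiE_iff extensional_def fun_eq_iff)

lemma descend_diff: "descend (u - v) = descend u \<ominus>\<^bsub>V\<^esub> descend v"
proof -
  have "descend u = descend (u - v) \<oplus>\<^bsub>V\<^esub> descend v" by (simp add: descend_add[symmetric])
  then show ?thesis by (simp add: V.minus_eq V.a_assoc V.r_neg)
qed

lemma pf_closed: "u \<in> carrier V \<Longrightarrow> v \<in> carrier V \<Longrightarrow> pf u v \<in> carrier F"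
  using quadratic by (auto simp: quadratic_form_def bilinear_form_def)

lemma pf_linear: "a \<in> carrier F \<Longrightarrow> u \<in> carrier V \<Longrightarrow> v \<in> carrier V \<Longrightarrow> w \<in> carrier V
    \<Longrightarrow> pf (a \<odot>\<^bsub>V\<^esub> u \<oplus>\<^bsub>V\<^esub> v) w = a \<otimes> pf u w \<oplus> pf v w"
  using quadratic by (auto simp: quadratic_form_def bilinear_form_def)

lemma pf_add: "u \<in> carrier V \<Longrightarrow> v \<in> carrier V \<Longrightarrow> w \<in> carrier V \<Longrightarrow> pf (u \<oplus>\<^bsub>V\<^esub> v) w = pf u w \<oplus> pf v w"
  using pf_linear[of \<one> u v w] pf_closed[of u w] by simp

lemma pf_zero: "w \<in> carrier V \<Longrightarrow> pf \<zero>\<^bsub>V\<^esub> w = \<zero>"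
  using pf_add[of "\<zero>\<^bsub>V\<^esub>" "\<zero>\<^bsub>V\<^esub>" w] pf_closed[of "\<zero>\<^bsub>V\<^esub>" w] by simp

lemma pf_scale: "a \<in> carrier F \<Longrightarrow> u \<in> carrier V \<Longrightarrow> w \<in> carrier V \<Longrightarrow> pf (a \<odot>\<^bsub>V\<^esub> u) w = a \<otimes> pf u w"
  using pf_linear[of a u "\<zero>\<^bsub>V\<^esub>" w] pf_zero[of w] pf_closed[of u w] by simp

lemma pf_commute: "u \<in> carrier V \<Longrightarrow> v \<in> carrier V \<Longrightarrow> pf u v = pf v u"
proof -
  assume uv: "u \<in> carrier V" "v \<in> carrier V"
  have Q: "Qf w \<in> carrier F" if "w \<in> carrier V" for w using quadratic that by (auto simp: quadratic_form_def)
  have "Qf (u \<oplus>\<^bsub>V\<^esub> v) \<in> carrier F" using Q uv by simp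
  then have "Qf (u \<oplus>\<^bsub>V\<^esub> v) \<ominus> Qf u \<ominus> Qf v = Qf (u \<oplus>\<^bsub>V\<^esub> v) \<ominus> Qf v \<ominus> Qf u"
    using Q[OF uv(1)] Q[OF uv(2)] by (simp add: minus_eq a_ac)
  then show ?thesis using V.a_comm[OF uv] by (simp add: polar_form_def)
qed

lemma form_space_V: "form_space unit_F vscale Bf"
proof (rule form_space.intro[OF idem_field_unit], unfold_locales)
  fix a b :: cring_prod and u v w :: "nat \<Rightarrow> cring_prod"
  show "vscale a (u + v) = vscale a u + vscale a v" by (auto simp: vscale_def distrib_left)
  show "vscale (a + b) u = vscale a u + vscale b u" by (auto simp: vscale_def distrib_right)
  show "vscale (a * b) u = vscale a (vscale b u)" by (auto simp: vscale_def mult.assoc)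
  show "vscale 1 u = u" by (auto simp: vscale_def)
  show "Bf (u + v) w = Bf u w + Bf v w"
    by (simp add: Bf_def descend_add pf_add emb_ops pf_closed)
  show "Bf (vscale a u) w = a * Bf u w"
    by (simp add: Bf_def descend_scale pf_scale pf_closed mult_emb)
  show "Bf u v = Bf v u" by (simp add: Bf_def pf_commute)
qed

lemma emb_sum:
  "finite I \<Longrightarrow> (\<And>i. i \<in> I \<Longrightarrow> f i \<in> carrier F) \<Longrightarrow> emb (\<Oplus>i\<in>I. f i) = (\<Sum>i\<in>I. emb (f i))"
proof (induction I rule: finite_induct)
  case (insert i I)
  then have c: "f i \<in> carrier F" "f \<in> I \<rightarrow> carrier F" by auto
  then have "emb (f i \<oplus> (\<Oplus>i\<in>I. f i)) = emb (f i) + emb (\<Oplus>i\<in>I. f i)" by (intro emb_ops) auto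
  then show ?case using insert c by (simp add: finsum_insert)
qed simp

text \<open>The factor \<open>unit_F\<close> accounts for the empty product, which is
  \<open>1\<close> in the ambient ring but \<open>unit_F\<close> as the image of the unit of
  \<open>F\<close>.\<close>

lemma emb_prod:
  "finite I \<Longrightarrow> (\<And>i. i \<in> I \<Longrightarrow> f i \<in> carrier F) \<Longrightarrow> emb (\<Otimes>i\<in>I. f i) = unit_F * (\<Prod>i\<in>I. emb (f i))"
proof (induction I rule: finite_induct)
  case (insert i I)
  then have c: "f i \<in> carrier F" "f \<in> I \<rightarrow> carrier F" by auto
  then have "emb (f i \<otimes> (\<Otimes>i\<in>I. f i)) = emb (f i) * emb (\<Otimes>i\<in>I. f i)" by (intro emb_ops) auto
  then show ?case using insert c by (simp add: finprod_insert mult.left_commute)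
qed simp

lemma emb_det_on:
  assumes "\<And>i j. i \<in> {1..k} \<Longrightarrow> j \<in> {1..k} \<Longrightarrow> A i j \<in> carrier F"
  shows "det_on F {1..k} A \<in> carrier F"
    "emb (det_on F {1..k} A) = unit_F * det (bordered k (\<lambda>i j. emb (A i j)))"
proof -
  let ?s = "\<lambda>p. if evenperm p then \<one> else \<ominus> \<one>"
  have c: "A i (p i) \<in> carrier F" if "p permutes {1..k}" "i \<in> {1..k}" for p i
    using assms permutes_in_image[OF that(1), of i] that(2) by blast
  have pc: "(\<Otimes>i\<in>{1..k}. A i (p i)) \<in> carrier F" if "p permutes {1..k}" for p
    using c[OF that] by (intro finprod_closed) auto
  have tc: "?s p \<otimes> (\<Otimes>i\<in>{1..k}. A i (p i)) \<in> carrier F" if "p permutes {1..k}" for p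
    using pc[OF that] by simp
  show "det_on F {1..k} A \<in> carrier F" unfolding det_on_def using tc by (intro finsum_closed) auto
  have "emb (det_on F {1..k} A) = (\<Sum>p | p permutes {1..k}. emb (?s p \<otimes> (\<Otimes>i\<in>{1..k}. A i (p i))))"
    unfolding det_on_def using tc by (intro emb_sum) (auto intro: finite_permutations)
  also have "\<dots> = (\<Sum>p | p permutes {1..k}. unit_F * (of_int (sign p) * (\<Prod>i\<in>{1..k}. emb (A i (p i)))))"
  proof (rule sum.cong[OF refl])
    fix p assume "p \<in> {p. p permutes {1..k}}"
    then have p: "p permutes {1..k}" by simp
    have "emb (?s p \<otimes> (\<Otimes>i\<in>{1..k}. A i (p i))) = emb (?s p) * emb (\<Otimes>i\<in>{1..k}. A i (p i))"
      using pc[OF p] by (intro emb_ops) auto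
    also have "emb (\<Otimes>i\<in>{1..k}. A i (p i)) = unit_F * (\<Prod>i\<in>{1..k}. emb (A i (p i)))"
      using c[OF p] by (intro emb_prod) auto
    also have "emb (?s p) = unit_F * of_int (sign p)" by (simp add: sign_def emb_ops(3)[of \<one> \<one>])
    also have "unit_F * of_int (sign p) * (unit_F * (\<Prod>i\<in>{1..k}. emb (A i (p i))))
        = (unit_F * unit_F) * (of_int (sign p) * (\<Prod>i\<in>{1..k}. emb (A i (p i))))" by (simp only: mult_ac)
    also have "unit_F * unit_F = unit_F" by (simp add: unit_mult)
    finally show "emb (?s p \<otimes> (\<Otimes>i\<in>{1..k}. A i (p i))) = unit_F * (of_int (sign p) * (\<Prod>i\<in>{1..k}. emb (A i (p i))))" .
  qed
  finally show "emb (det_on F {1..k} A) = unit_F * det (bordered k (\<lambda>i j. emb (A i j)))"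
    by (simp add: det_bordered sum_distrib_left)
qed

lemma congruent_polar:
  assumes xy: "(x, y) \<in> congruence_rel F V Qf k" and i: "i \<le> k" "j \<le> k"
  shows "pf (y i \<ominus>\<^bsub>V\<^esub> y 0) (y j \<ominus>\<^bsub>V\<^esub> y 0) = pf (x i \<ominus>\<^bsub>V\<^esub> x 0) (x j \<ominus>\<^bsub>V\<^esub> x 0)"
proof -
  obtain z \<theta> where z: "z \<in> carrier V" and t: "\<theta> \<in> orthogonal_maps F V Qf"
    and eq: "\<And>i. i \<le> k \<Longrightarrow> y i = z \<oplus>\<^bsub>V\<^esub> \<theta> (x i)"
    using xy by (auto simp: congruence_rel_def)
  have xc: "x i \<in> carrier V" if "i \<le> k" for i using xy that by (auto simp: congruence_rel_def simplices_def PiE_iff)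
  have tc: "\<theta> u \<in> carrier V" if "u \<in> carrier V" for u
    using t that by (auto simp: orthogonal_maps_def Bij_def bij_betw_def)
  have ta: "\<theta> (u \<oplus>\<^bsub>V\<^esub> v) = \<theta> u \<oplus>\<^bsub>V\<^esub> \<theta> v" if "u \<in> carrier V" "v \<in> carrier V" for u v
    using t that by (auto simp: orthogonal_maps_def)
  have tQ: "Qf (\<theta> u) = Qf u" if "u \<in> carrier V" for u using t that by (auto simp: orthogonal_maps_def)
  have td: "y i \<ominus>\<^bsub>V\<^esub> y 0 = \<theta> (x i \<ominus>\<^bsub>V\<^esub> x 0)" if i: "i \<le> k" for i
  proof -
    have xi: "x i \<in> carrier V" "x 0 \<in> carrier V" using xc i by auto
    define w where "w = x i \<ominus>\<^bsub>V\<^esub> x 0"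
    have w: "w \<in> carrier V" using xi by (simp add: w_def)
    have "x i = w \<oplus>\<^bsub>V\<^esub> x 0" using xi by (simp add: w_def V.minus_eq V.a_assoc V.l_neg)
    then have "\<theta> (x i) = \<theta> w \<oplus>\<^bsub>V\<^esub> \<theta> (x 0)" using ta[OF w xi(2)] by simp
    then have "y i = \<theta> w \<oplus>\<^bsub>V\<^esub> y 0"
      using eq[OF i] eq[of 0] z tc[OF w] tc[OF xi(2)] by (simp add: V.a_lcomm)
    moreover have "y 0 \<in> carrier V" using eq[of 0] z tc[OF xi(2)] by simp
    ultimately have "y i \<ominus>\<^bsub>V\<^esub> y 0 = \<theta> w" using tc[OF w] by (simp add: V.minus_eq V.a_assoc V.r_neg)
    then show ?thesis by (simp only: w_def)
  qed
  have "pf (\<theta> u) (\<theta> v) = pf u v" if "u \<in> carrier V" "v \<in> carrier V" for u v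
    using that tQ[of "u \<oplus>\<^bsub>V\<^esub> v"] tQ[of u] tQ[of v] by (simp add: polar_form_def ta[symmetric])
  then show ?thesis using td i xc by simp
qed

lemma congruence_refl:
  assumes "x \<in> simplices k (carrier V)"
  shows "(x, x) \<in> congruence_rel F V Qf k"
proof -
  have "(\<lambda>v\<in>carrier V. v) \<in> orthogonal_maps F V Qf"
    by (auto simp: orthogonal_maps_def Bij_def bij_betw_def inj_on_def)
  moreover have "x i = \<zero>\<^bsub>V\<^esub> \<oplus>\<^bsub>V\<^esub> (\<lambda>v\<in>carrier V. v) (x i)" if "i \<in> {0..k}" for i
  proof -
    have "x i \<in> carrier V" using assms that by (auto simp: simplices_def PiE_iff)
    then show ?thesis by simp
  qed
  ultimately show ?thesis using assms unfolding congruence_rel_def by blast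
qed

theorem congruence_class_count:
  assumes k: "2 \<le> k" "k \<le> d" and E: "E \<subseteq> carrier V"
    and large: "size_const d k * real (order F) powr beta d k \<le> card E"
  shows "count_const d k * real (order F) ^ (Suc k choose 2) \<le> card (nd_congruence_classes F V Qf k E)"
proof -
  interpret fs: form_space unit_F vscale Bf by (rule form_space_V)
  have KF: "fs.K = emb ` carrier F" by (auto simp: fs.K_def fixed_iff)
  have inj_emb: "inj_on emb (carrier F)" by (rule inj_onI) (simp add: emb_inj)
  have qF: "fs.q = order F" unfolding fs.q_def KF order_def by (rule card_image[OF inj_emb])
  define U where "U = lift_vec ` carrier V"
  have inj_lift: "inj_on lift_vec (carrier V)" by (rule inj_onI) (metis descend_lift)
  have U_iff: "u \<in> U \<longleftrightarrow> lift_vec (descend u) = u" for u by (auto simp: U_def image_iff) (metis descend_closed)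
  have lift_descend: "lift_vec (descend u) i = (if i < d then unit_F * u i else 0)" for u i by (simp add: lift_vec_def descend_def unit_mult)
  have U_mem: "u \<in> U \<longleftrightarrow> (\<forall>i. u i = (if i < d then unit_F * u i else 0))" for u
    unfolding U_iff by (auto simp: fun_eq_iff lift_descend)
  have unital: "fs.unital u" if "u \<in> U" for u
    unfolding fs.unital_def
  proof
    fix i
    have "u i = (if i < d then unit_F * u i else 0)" using that U_mem by blast
    then show "vscale unit_F u i = u i" by (cases "i < d") (simp_all add: vscale_def)
  qed
  have fV: "finite (carrier V)" unfolding carrier_V using finite_F by (intro finite_PiE) auto
  have ndU: "fs.nd_space d U" unfolding fs.nd_space_def fs.subsp_def
  proof (intro conjI ballI allI impI)
    show "0 \<in> U" unfolding U_mem by simp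
    show "u + v \<in> U" if "u \<in> U" "v \<in> U" for u v
      unfolding U_mem
    proof
      fix i
      have "u i = (if i < d then unit_F * u i else 0)" "v i = (if i < d then unit_F * v i else 0)"
        using that U_mem by blast+
      then show "(u + v) i = (if i < d then unit_F * (u + v) i else 0)" by (cases "i < d") (simp_all add: distrib_left)
    qed
    show "vscale a u \<in> U" if "u \<in> U" for a u
      unfolding U_mem
    proof
      fix i
      have "u i = (if i < d then unit_F * u i else 0)" using that U_mem by blast
      then show "vscale a u i = (if i < d then unit_F * vscale a u i else 0)"
        by (cases "i < d") (simp_all add: vscale_def mult.left_commute)
    qed
    show "fs.unital u" if "u \<in> U" for u by (rule unital[OF that])
    show "finite U" unfolding U_def using fV by simp
    have "card U = card (carrier V)" unfolding U_def by (rule card_image[OF inj_lift])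
    then show "card U = fs.q ^ d" by (simp add: carrier_V qF card_PiE order_def)
    fix u assume u: "u \<in> U" "\<forall>v\<in>U. Bf u v = 0"
    have "pf (descend u) v = \<zero>" if v: "v \<in> carrier V" for v
    proof -
      have "Bf u (lift_vec v) = 0" using u(2) v by (auto simp: U_def)
      then show ?thesis using emb_inj[of "pf (descend u) v" \<zero>] v by (simp add: Bf_def pf_closed)
    qed
    then have "descend u = \<zero>\<^bsub>V\<^esub>" using nondegenerate by (auto simp: nondegenerate_form_def)
    then have "lift_vec (descend u) = 0" by (auto simp: lift_vec_def coord_space_def fun_eq_iff)
    then show "u = 0" using u(1) U_iff by simp
  qed
  define E' where "E' = lift_vec ` E"
  have E'U: "E' \<subseteq> U" using E by (auto simp: E'_def U_def)
  have cE: "card E' = card E" unfolding E'_def by (rule card_image[OF inj_on_subset[OF inj_lift E]])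
  have fE: "finite E" using finite_subset[OF E fV] .
  have "count_const d k * real fs.q ^ (Suc k choose 2) \<le> card (fs.gram k ` fs.nonsingular_simplices k E')"
    using fs.many_grams_beta[OF k] ndU E'U large unfolding fs.many_grams_def cE[symmetric] qF by blast
  also have "real (card (fs.gram k ` fs.nonsingular_simplices k E')) \<le> real (card (nd_congruence_classes F V Qf k E))"
  proof -
    define X where "X x = (\<lambda>i\<in>{0..k}. descend (x i))" for x :: "nat \<Rightarrow> nat \<Rightarrow> cring_prod"
    \<comment> \<open>\<open>G x\<close> is the congruence class of the simplex over
      \<open>F\<close>. Since congruent simplices have equal edge products, \<open>gram\<close>
      factors through \<open>G\<close>, so there are at least as many classes as Gram
      matrices.\<close>
    define G where "G x = congruence_rel F V Qf k `` {X x}" for x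
    have Xs: "X x \<in> simplices k E" if x: "x \<in> fs.nonsingular_simplices k E'" for x
    proof -
      have "descend (x i) \<in> E" if "i \<in> {0..k}" for i
      proof -
        have "x i \<in> E'" using x that by (auto simp: fs.nonsingular_simplices_def PiE_iff)
        then show ?thesis using E by (auto simp: E'_def)
      qed
      then show ?thesis by (simp add: simplices_def X_def)
    qed
    have XV: "X x \<in> simplices k (carrier V)" for x by (simp add: simplices_def X_def)
    have Bedge: "Bf (fs.edges x i) (fs.edges x j) = emb (pf (X x (Suc i) \<ominus>\<^bsub>V\<^esub> X x 0) (X x (Suc j) \<ominus>\<^bsub>V\<^esub> X x 0))"
      if "i < k" "j < k" for x i j using that by (simp add: Bf_def fs.edges_def descend_diff X_def)
    have Xnd: "X x \<in> nd_simplices F V Qf k E" if x: "x \<in> fs.nonsingular_simplices k E'" for x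
    proof -
      have eU: "fs.unital (fs.edges x i)" if "i < k" for i
      proof -
        have "x (Suc i) \<in> E'" "x 0 \<in> E'" using x that by (auto simp: fs.nonsingular_simplices_def PiE_iff)
        then show ?thesis unfolding fs.edges_def using E'U unital by (intro fs.unital_simps) auto
      qed
      have ec: "edge_gram F V Qf (X x) i j \<in> carrier F" if "i \<in> {1..k}" "j \<in> {1..k}" for i j
        unfolding edge_gram_def using that by (intro pf_closed) (auto simp: X_def)
      have "bordered k (\<lambda>i j. Bf (fs.edges x (i - 1)) (fs.edges x (j - 1))) = bordered k (\<lambda>i j. emb (edge_gram F V Qf (X x) i j))"
      proof (rule eq_matI)
        fix i j assume "i < dim_row (bordered k (\<lambda>i j. emb (edge_gram F V Qf (X x) i j)))"
          "j < dim_col (bordered k (\<lambda>i j. emb (edge_gram F V Qf (X x) i j)))"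
        then show "bordered k (\<lambda>i j. Bf (fs.edges x (i - 1)) (fs.edges x (j - 1))) $$ (i, j) = bordered k (\<lambda>i j. emb (edge_gram F V Qf (X x) i j)) $$ (i, j)"
          using Bedge[of "i - 1" "j - 1" x] by (auto simp: bordered_def edge_gram_def)
      qed (simp_all add: bordered_def)
      then have "emb (det_on F {1..k} (edge_gram F V Qf (X x))) = unit_F * det (bordered k (\<lambda>i j. Bf (fs.edges x (i - 1)) (fs.edges x (j - 1))))"
        using emb_det_on(2)[of k, OF ec] by simp
      moreover have "unit_F * det (bordered k (\<lambda>i j. Bf (fs.edges x (i - 1)) (fs.edges x (j - 1)))) \<noteq> 0"
        using x eU by (intro fs.nonsingular_det) (auto simp: fs.nonsingular_simplices_def)
      ultimately have "det_on F {1..k} (edge_gram F V Qf (X x)) \<noteq> \<zero>" by auto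
      then show ?thesis using Xs[OF x] by (simp add: nd_simplices_def)
    qed
    have "finite (nd_simplices F V Qf k E)"
      by (rule finite_subset[of _ "{0..k} \<rightarrow>\<^sub>E E"]) (use fE in \<open>auto simp: nd_simplices_def simplices_def intro: finite_PiE\<close>)
    then have fin: "finite (nd_congruence_classes F V Qf k E)"
      by (simp add: nd_congruence_classes_def quotient_def)
    have gg: "fs.gram k x = fs.gram k y" if "x \<in> fs.nonsingular_simplices k E'" "y \<in> fs.nonsingular_simplices k E'" "G x = G y" for x y
    proof -
      have "X y \<in> G y" using congruence_refl[OF XV] by (simp add: G_def)
      then have "(X x, X y) \<in> congruence_rel F V Qf k" using that(3) by (auto simp: G_def)
      then have "Bf (fs.edges x i) (fs.edges x j) = Bf (fs.edges y i) (fs.edges y j)" if "i < k" "j < k" for i j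
        using Bedge[OF that, of x] Bedge[OF that, of y] congruent_polar[of "X x" "X y" k "Suc i" "Suc j"] that by simp
      then show ?thesis unfolding fs.gram_def by (intro restrict_ext) auto
    qed
    have fE': "finite E'" unfolding E'_def using fE by simp
    have "card (fs.gram k ` fs.nonsingular_simplices k E') \<le> card (G ` fs.nonsingular_simplices k E')"
      by (rule card_image_le_image[OF fs.finite_nonsingular_simplices[OF fE'] gg])
    also have "\<dots> \<le> card (nd_congruence_classes F V Qf k E)"
    proof (rule card_mono[OF fin])
      show "G ` fs.nonsingular_simplices k E' \<subseteq> nd_congruence_classes F V Qf k E"
        using Xnd by (auto simp: G_def nd_congruence_classes_def intro: quotientI)
    qed
    finally show ?thesis by simp
  qed
  finally show ?thesis unfolding qF .
qed

end

section \<open>Optimality of the exponent\<close>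

text \<open>
  A form whose first \<open>m\<close> coordinate vectors span a totally isotropic subspace \<open>W\<close>. Simplices in
  \<open>W\<^sup>\<bottom>\<close> have the Gram matrices of their projections to the \<open>d - 2 * m\<close> coordinates of \<open>W\<^sup>\<bottom> / W\<close>.
\<close>

locale split_form =
  fixes p d m :: nat
  assumes prime_p: "prime p" and odd_p: "odd p" and md: "2 * m \<le> d"
begin

abbreviation P :: "int ring" where "P \<equiv> residue_ring (int p)"

sublocale R: residues_prime p P
  by (unfold_locales) (rule prime_p)

abbreviation V where "V \<equiv> coord_space P d"

text \<open>The involution pairs coordinate \<open>i < m\<close> with \<open>m + i\<close> and fixes
  the coordinates from \<open>2 * m\<close> on. The resulting form is a sum of \<open>m\<close>
  hyperbolic planes and of \<open>d - 2 * m\<close> squares.\<close>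

definition \<sigma> :: "nat \<Rightarrow> nat" where
  "\<sigma> i = (if i < m then m + i else if i < 2 * m then i - m else i)"

lemma \<sigma>_less: "i < d \<Longrightarrow> \<sigma> i < d" using md by (auto simp: \<sigma>_def)
lemma \<sigma>_inv [simp]: "\<sigma> (\<sigma> i) = i" by (auto simp: \<sigma>_def)

text \<open>The bilinear form is kept over the integers and reduced modulo \<open>p\<close> only at
  the end, so symmetry and linearity are identities of integer sums.\<close>

definition T :: "(nat \<Rightarrow> int) \<Rightarrow> (nat \<Rightarrow> int) \<Rightarrow> int" where
  "T u v = (\<Sum>i<d. u i * v (\<sigma> i))"

definition Qs :: "(nat \<Rightarrow> int) \<Rightarrow> int" where "Qs u = T u u mod int p"

lemma T_commute: "T u v = T v u"
  unfolding T_def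
  by (rule sum.reindex_bij_witness[of _ \<sigma> \<sigma>]) (auto simp: \<sigma>_less mult.commute)

lemma T_cong:
  assumes "\<And>i. i < d \<Longrightarrow> [u i = u' i] (mod int p)" "\<And>i. i < d \<Longrightarrow> [v i = v' i] (mod int p)"
  shows "[T u v = T u' v'] (mod int p)"
  unfolding T_def by (rule cong_sum) (auto intro!: cong_mult assms \<sigma>_less)

lemma T_lincomb: "T (\<lambda>i. a * u i + v i) w = a * T u w + T v w"
  by (simp add: T_def sum.distrib sum_distrib_left distrib_right mult.assoc)

lemma carrier_P: "carrier P = {0..int p - 1}" by (rule R.res_carrier_eq)

lemma p_gt: "int p > 2"
  using prime_p odd_p prime_ge_2_nat[OF prime_p] by (cases "p = 2") auto

lemma coords: "u \<in> carrier V \<Longrightarrow> i < d \<Longrightarrow> 0 \<le> u i \<and> u i < int p"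
  by (force simp: coord_space_def PiE_iff carrier_P)

lemma lincomb_cong:
  assumes "i < d"
  shows "[(a \<odot>\<^bsub>V\<^esub> u \<oplus>\<^bsub>V\<^esub> v) i = a * u i + v i] (mod int p)"
  using assms by (simp add: coord_space_def R.res_add_eq R.res_mult_eq cong_def mod_simps)

lemma add_cong:
  assumes "i < d"
  shows "[(u \<oplus>\<^bsub>V\<^esub> v) i = u i + v i] (mod int p)"
  using assms by (simp add: coord_space_def R.res_add_eq cong_def)

lemma minus_P: "a \<in> carrier P \<Longrightarrow> b \<in> carrier P \<Longrightarrow> a \<ominus>\<^bsub>P\<^esub> b = (a - b) mod int p"
proof -
  assume ab: "a \<in> carrier P" "b \<in> carrier P"
  have c: "(a - b) mod int p \<in> carrier P" using p_gt by (simp add: carrier_P)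
  have "(a - b) mod int p \<oplus>\<^bsub>P\<^esub> b = a"
    using ab by (simp add: R.res_add_eq mod_simps carrier_P)
  then have "a \<ominus>\<^bsub>P\<^esub> b = (a - b) mod int p \<oplus>\<^bsub>P\<^esub> b \<ominus>\<^bsub>P\<^esub> b" by simp
  also have "\<dots> = (a - b) mod int p" using c ab(2) by (simp add: R.minus_eq R.a_assoc R.r_neg)
  finally show ?thesis .
qed

lemma Qs_closed: "Qs u \<in> carrier P" using p_gt by (simp add: Qs_def carrier_P)

lemma polar_Qs:
  assumes "u \<in> carrier V" "v \<in> carrier V"
  shows "polar_form P V Qs u v = T u v mod int p"
proof -
  have "[T (u \<oplus>\<^bsub>V\<^esub> v) (u \<oplus>\<^bsub>V\<^esub> v) = T (\<lambda>i. u i + v i) (\<lambda>i. u i + v i)] (mod int p)"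
    by (intro T_cong add_cong)
  also have "T (\<lambda>i. u i + v i) (\<lambda>i. u i + v i) = T u u + T v v + 2 * T u v"
    using T_commute[of v u] by (simp add: T_def sum.distrib algebra_simps)
  finally have "Qs (u \<oplus>\<^bsub>V\<^esub> v) = (T u u + T v v + 2 * T u v) mod int p" by (simp add: Qs_def cong_def)
  then have "Qs (u \<oplus>\<^bsub>V\<^esub> v) \<ominus>\<^bsub>P\<^esub> Qs u \<ominus>\<^bsub>P\<^esub> Qs v = (((T u u + T v v + 2 * T u v) - T u u) - T v v) mod int p"
    using minus_P Qs_closed p_gt by (simp add: carrier_P Qs_def mod_simps)
  also have "\<dots> = (2 * T u v) mod int p" by simp
  finally have diff: "Qs (u \<oplus>\<^bsub>V\<^esub> v) \<ominus>\<^bsub>P\<^esub> Qs u \<ominus>\<^bsub>P\<^esub> Qs v = (2 * T u v) mod int p" .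
  have two: "\<one>\<^bsub>P\<^esub> \<oplus>\<^bsub>P\<^esub> \<one>\<^bsub>P\<^esub> = 2" using p_gt by (simp add: R.res_add_eq R.res_one_eq)
  have "2 \<in> Units P" using p_gt by (simp add: R.field_Units carrier_P R.res_zero_eq)
  then have h: "inv\<^bsub>P\<^esub> 2 \<otimes>\<^bsub>P\<^esub> 2 = \<one>\<^bsub>P\<^esub>" by (rule R.Units_l_inv)
  then have h2: "[inv\<^bsub>P\<^esub> 2 * 2 = 1] (mod int p)" using p_gt by (simp add: R.res_mult_eq R.res_one_eq cong_def)
  have "polar_form P V Qs u v = (inv\<^bsub>P\<^esub> 2 * 2 * T u v) mod int p"
    unfolding polar_form_def two diff by (simp add: R.res_mult_eq mod_simps mult.assoc)
  also have "\<dots> = (1 * T u v) mod int p" using cong_mult[OF h2 cong_refl[of "T u v"]] by (simp only: cong_def)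
  finally show ?thesis by simp
qed

lemma order_P: "order P = p" by (simp add: order_def carrier_P)

lemma module_V: "module P V" by (rule coord_space_module) (rule R.is_cring)

lemma quadratic_space: "finite_quadratic_space P d Qs"
proof (rule finite_quadratic_space.intro)
  interpret V: module P V by (rule module_V)
  show "field P" by (rule R.is_field)
  show "finite (carrier P)" by (simp add: carrier_P)
  show "odd (order P)" using odd_p by (simp add: order_P)
  have Tmod: "T (a \<odot>\<^bsub>V\<^esub> u \<oplus>\<^bsub>V\<^esub> v) w mod int p = a \<otimes>\<^bsub>P\<^esub> (T u w mod int p) \<oplus>\<^bsub>P\<^esub> (T v w mod int p)" for a u v w
  proof -
    have "[T (a \<odot>\<^bsub>V\<^esub> u \<oplus>\<^bsub>V\<^esub> v) w = T (\<lambda>i. a * u i + v i) w] (mod int p)"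
      by (intro T_cong lincomb_cong cong_refl)
    then show ?thesis unfolding T_lincomb by (simp add: cong_def R.res_add_eq R.res_mult_eq mod_simps)
  qed
  have bil: "bilinear_form P V (polar_form P V Qs)"
    unfolding bilinear_form_def
  proof (intro conjI ballI)
    fix u v assume uv: "u \<in> carrier V" "v \<in> carrier V"
    show "polar_form P V Qs u v \<in> carrier P" unfolding polar_Qs[OF uv] using p_gt by (simp add: carrier_P)
    fix a w assume aw: "a \<in> carrier P" "w \<in> carrier V"
    have c: "a \<odot>\<^bsub>V\<^esub> u \<oplus>\<^bsub>V\<^esub> v \<in> carrier V" using uv aw by simp
    show "polar_form P V Qs (a \<odot>\<^bsub>V\<^esub> u \<oplus>\<^bsub>V\<^esub> v) w = a \<otimes>\<^bsub>P\<^esub> polar_form P V Qs u w \<oplus>\<^bsub>P\<^esub> polar_form P V Qs v w"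
      unfolding polar_Qs[OF c aw(2)] polar_Qs[OF uv(1) aw(2)] polar_Qs[OF uv(2) aw(2)] by (rule Tmod)
    show "polar_form P V Qs w (a \<odot>\<^bsub>V\<^esub> u \<oplus>\<^bsub>V\<^esub> v) = a \<otimes>\<^bsub>P\<^esub> polar_form P V Qs w u \<oplus>\<^bsub>P\<^esub> polar_form P V Qs w v"
      unfolding polar_Qs[OF aw(2) c] polar_Qs[OF aw(2) uv(1)] polar_Qs[OF aw(2) uv(2)] T_commute[of w] by (rule Tmod)
  qed
  have hom: "Qs (a \<odot>\<^bsub>V\<^esub> v) = a \<otimes>\<^bsub>P\<^esub> a \<otimes>\<^bsub>P\<^esub> Qs v" for a v
  proof -
    have c: "[(a \<odot>\<^bsub>V\<^esub> v) i = a * v i] (mod int p)" if "i < d" for i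
      using that by (simp add: coord_space_def R.res_mult_eq cong_def)
    have "[T (a \<odot>\<^bsub>V\<^esub> v) (a \<odot>\<^bsub>V\<^esub> v) = T (\<lambda>i. a * v i) (\<lambda>i. a * v i)] (mod int p)" by (intro T_cong c)
    moreover have "T (\<lambda>i. a * v i) (\<lambda>i. a * v i) = a * a * T v v" by (simp add: T_def sum_distrib_left mult_ac)
    ultimately show ?thesis by (simp add: Qs_def cong_def R.res_mult_eq mod_simps)
  qed
  show "quadratic_form P V Qs"
    unfolding quadratic_form_def using bil hom Qs_closed by blast
  show "nondegenerate_form P V Qs"
    unfolding nondegenerate_form_def
  proof (intro ballI impI)
    fix u assume u: "u \<in> carrier V" and z: "\<forall>v\<in>carrier V. polar_form P V Qs u v = \<zero>\<^bsub>P\<^esub>"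
    have "u i = 0" if i: "i < d" for i
    proof -
      \<comment> \<open>The coordinate vector at \<open>\<sigma> i\<close> is dual to the one at
        \<open>i\<close>, so pairing with it extracts \<open>u i\<close>.\<close>
      define v where "v = (\<lambda>l\<in>{..<d}. if l = \<sigma> i then 1 else 0 :: int)"
      have v: "v \<in> carrier V" using p_gt by (auto simp: v_def coord_space_def carrier_P)
      have "T u v = (\<Sum>l<d. if l = i then u l else 0)"
        unfolding T_def
      proof (rule sum.cong[OF refl])
        fix l assume "l \<in> {..<d}"
        then have "\<sigma> l < d" using \<sigma>_less by simp
        moreover have "\<sigma> l = \<sigma> i \<longleftrightarrow> l = i" using \<sigma>_inv by metis
        ultimately show "u l * v (\<sigma> l) = (if l = i then u l else 0)" by (simp add: v_def)
      qed
      then have "T u v = u i" using i by simp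
      moreover have "T u v mod int p = 0" using z v polar_Qs[OF u v] by (simp add: R.res_zero_eq)
      ultimately show ?thesis using coords[OF u i] by simp
    qed
    then have "u i = \<zero>\<^bsub>V\<^esub> i" for i
      using u by (auto simp: coord_space_def PiE_iff extensional_def R.res_zero_eq)
    then show "u = \<zero>\<^bsub>V\<^esub>" by (rule ext)
  qed
qed

text \<open>By the pairing \<open>\<sigma>\<close>, vanishing of the first \<open>m\<close>
  coordinates means orthogonality to the coordinate vectors \<open>m, ..., 2 * m - 1\<close>. The
  two halves play symmetric roles, and this second half also spans a totally isotropic
  subspace.\<close>

definition isotropic_perp :: "(nat \<Rightarrow> int) set" where
  "isotropic_perp = {u \<in> carrier V. \<forall>i<m. u i = 0}"

lemma card_isotropic_perp: "card isotropic_perp = p ^ (d - m)"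
proof -
  have eq: "isotropic_perp = (\<Pi>\<^sub>E i\<in>{..<d}. if i < m then {0} else {0..int p - 1})"
  proof (rule subset_antisym; rule subsetI)
    fix u assume u: "u \<in> isotropic_perp"
    show "u \<in> (\<Pi>\<^sub>E i\<in>{..<d}. if i < m then {0} else {0..int p - 1})"
    proof (rule PiE_I)
      fix i assume "i \<in> {..<d}"
      then have "0 \<le> u i \<and> u i < int p" using coords[of u i] u by (simp add: isotropic_perp_def)
      then show "u i \<in> (if i < m then {0} else {0..int p - 1})" using u by (simp add: isotropic_perp_def)
    next
      fix i assume "i \<notin> {..<d}"
      moreover have "u \<in> {..<d} \<rightarrow>\<^sub>E carrier P" using u by (simp add: isotropic_perp_def coord_space_def)
      ultimately show "u i = undefined" by (rule PiE_arb[rotated])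
    qed
  next
    fix u assume u: "u \<in> (\<Pi>\<^sub>E i\<in>{..<d}. if i < m then {0} else {0..int p - 1})"
    have c: "u i \<in> (if i < m then {0} else {0..int p - 1})" if "i < d" for i
      using PiE_mem[OF u] that by simp
    have "u \<in> {..<d} \<rightarrow>\<^sub>E carrier P"
    proof (rule PiE_I)
      fix i assume "i \<in> {..<d}"
      then show "u i \<in> carrier P" using c[of i] p_gt by (auto simp: carrier_P split: if_splits)
    qed (rule PiE_arb[OF u])
    moreover have "u i = 0" if "i < m" for i using c[of i] that md by simp
    ultimately show "u \<in> isotropic_perp" by (simp add: isotropic_perp_def coord_space_def)
  qed
  have "card isotropic_perp = (\<Prod>i<d. if i < m then 1 else p)"
    unfolding eq card_PiE[OF finite_lessThan] by (intro prod.cong refl) simp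
  also have "\<dots> = p ^ card ({..<d} \<inter> - {i. i < m})" by (simp add: prod.If_cases)
  also have "{..<d} \<inter> - {i. i < m} = {m..<d}" by auto
  finally show ?thesis by simp
qed

lemma finsum_P:
  "finite I \<Longrightarrow> (\<And>i. i \<in> I \<Longrightarrow> f i \<in> carrier P) \<Longrightarrow> (\<Oplus>\<^bsub>P\<^esub>i\<in>I. f i) = (\<Sum>i\<in>I. f i) mod int p"
proof (induction I rule: finite_induct)
  case (insert i I)
  then have "(\<Oplus>\<^bsub>P\<^esub>i\<in>insert i I. f i) = f i \<oplus>\<^bsub>P\<^esub> (\<Oplus>\<^bsub>P\<^esub>i\<in>I. f i)" by (intro R.finsum_insert) auto
  then show ?case using insert by (simp add: R.res_add_eq mod_simps)
qed (simp add: R.res_zero_eq)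

lemma diff_coord_zero:
  assumes "u \<in> carrier V" "v \<in> carrier V" "i < d" "u i = 0" "v i = 0"
  shows "(u \<ominus>\<^bsub>V\<^esub> v) i = 0"
proof -
  interpret V: module P V by (rule module_V)
  have w: "u \<ominus>\<^bsub>V\<^esub> v \<in> carrier V" using assms by simp
  have "(u \<ominus>\<^bsub>V\<^esub> v) \<oplus>\<^bsub>V\<^esub> v = u" using assms by (simp add: V.minus_eq V.a_assoc V.l_neg)
  then have "[u i = (u \<ominus>\<^bsub>V\<^esub> v) i + v i] (mod int p)" using add_cong[OF assms(3), of "u \<ominus>\<^bsub>V\<^esub> v" v] by simp
  then show ?thesis using assms(4,5) coords[OF w assms(3)] by (simp add: cong_def)
qed

lemma no_nondegenerate_simplices:
  assumes "d - 2 * m < k"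
  shows "nd_simplices P V Qs k isotropic_perp = {}"
proof -
  interpret Sp: finite_quadratic_space P d Qs by (rule quadratic_space)
  define r where "r = d - 2 * m"
  have "det_on P {1..k} (edge_gram P V Qs x) = \<zero>\<^bsub>P\<^esub>" if x: "x \<in> simplices k isotropic_perp" for x
  proof -
    define y where "y i = x i \<ominus>\<^bsub>V\<^esub> x 0" for i
    have xc: "x i \<in> carrier V" "\<And>l. l < m \<Longrightarrow> x i l = 0" if "i \<le> k" for i
      using x that by (auto simp: simplices_def isotropic_perp_def PiE_iff)
    have yc: "y i \<in> carrier V" if "i \<le> k" for i using xc that by (simp add: y_def)
    have y0: "y i l = 0" if "i \<le> k" "l < m" for i l
      unfolding y_def using xc(1)[of i] xc(1)[of 0] xc(2)[of i l] xc(2)[of 0 l] that md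
      by (intro diff_coord_zero) auto
    define Y where "Y i l = Sp.emb (y i (2 * m + l))" for i l
    have yl: "y i (2 * m + l) \<in> carrier P" if "i \<le> k" "l < r" for i l
      using yc[OF that(1)] that(2) by (auto simp: coord_space_def PiE_iff r_def)
    have gram: "edge_gram P V Qs x i j \<in> carrier P" "Sp.emb (edge_gram P V Qs x i j) = (\<Sum>l<r. Y i l * Y j l)"
      if ij: "i \<in> {1..k}" "j \<in> {1..k}" for i j
    proof -
      have i: "i \<le> k" "j \<le> k" using ij by auto
      have "T (y i) (y j) = (\<Sum>l\<in>{2 * m..<d}. y i l * y j (\<sigma> l))"
        unfolding T_def
      proof (rule sum.mono_neutral_right)
        show "\<forall>l\<in>{..<d} - {2 * m..<d}. y i l * y j (\<sigma> l) = 0"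
        proof
          fix l assume "l \<in> {..<d} - {2 * m..<d}"
          \<comment> \<open>Below \<open>2 * m\<close> every term pairs one coordinate from each
            half, and the one from the first half is zero. Only the \<open>r\<close> squares
            survive, so the Gram matrix factors through \<open>r < k\<close> columns.\<close>
          then have "l < m \<or> \<sigma> l < m" by (auto simp: \<sigma>_def)
          then show "y i l * y j (\<sigma> l) = 0" using y0[OF i(1)] y0[OF i(2)] by auto
        qed
      qed auto
      also have "\<dots> = (\<Sum>l<r. y i (2 * m + l) * y j (2 * m + l))"
        by (rule sum.reindex_bij_witness[of _ "\<lambda>l. 2 * m + l" "\<lambda>l. l - 2 * m"]) (auto simp: \<sigma>_def r_def)
      finally have "edge_gram P V Qs x i j = (\<Sum>l<r. y i (2 * m + l) * y j (2 * m + l)) mod int p"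
        using polar_Qs[OF yc[OF i(1)] yc[OF i(2)]] by (simp add: edge_gram_def y_def)
      also have "\<dots> = (\<Sum>l<r. y i (2 * m + l) \<otimes>\<^bsub>P\<^esub> y j (2 * m + l)) mod int p"
        by (simp add: R.res_mult_eq mod_sum_eq)
      also have "\<dots> = (\<Oplus>\<^bsub>P\<^esub>l\<in>{..<r}. y i (2 * m + l) \<otimes>\<^bsub>P\<^esub> y j (2 * m + l))"
        using yl i by (intro finsum_P[symmetric]) auto
      finally have eq: "edge_gram P V Qs x i j = (\<Oplus>\<^bsub>P\<^esub>l\<in>{..<r}. y i (2 * m + l) \<otimes>\<^bsub>P\<^esub> y j (2 * m + l))" .
      show "edge_gram P V Qs x i j \<in> carrier P" unfolding eq using yl i by (intro R.finsum_closed) auto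
      have "Sp.emb (edge_gram P V Qs x i j) = (\<Sum>l<r. Sp.emb (y i (2 * m + l) \<otimes>\<^bsub>P\<^esub> y j (2 * m + l)))"
        unfolding eq using yl i by (intro Sp.emb_sum) auto
      also have "\<dots> = (\<Sum>l<r. Y i l * Y j l)"
        unfolding Y_def using yl i by (intro sum.cong refl Sp.emb_ops(2)) auto
      finally show "Sp.emb (edge_gram P V Qs x i j) = (\<Sum>l<r. Y i l * Y j l)" .
    qed
    have "det (bordered k (\<lambda>i j. Sp.emb (edge_gram P V Qs x i j))) = 0"
      by (rule det_bordered_low_rank[of r]) (use assms gram(2) in \<open>auto simp: r_def\<close>)
    then have "Sp.emb (det_on P {1..k} (edge_gram P V Qs x)) = Sp.emb \<zero>\<^bsub>P\<^esub>"
      using Sp.emb_det_on(2)[of k, OF gram(1)] by simp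
    moreover have "det_on P {1..k} (edge_gram P V Qs x) \<in> carrier P"
      by (rule Sp.emb_det_on(1)) (rule gram(1))
    ultimately show ?thesis using Sp.emb_inj[OF _ R.zero_closed] by blast
  qed
  then show ?thesis by (auto simp: nd_simplices_def)
qed

end

lemma odd_prime_powr_ge:
  assumes "(0::real) < \<delta>"
  obtains p :: nat where "prime p" "odd p" "C \<le> real p powr \<delta>"
proof -
  define M where "M = nat \<lceil>max 1 C powr (1 / \<delta>)\<rceil>"
  obtain p where p: "prime p" "p > max 2 M" using bigger_prime by blast
  have "C \<le> (max 1 C powr (1 / \<delta>)) powr \<delta>" using assms by (simp add: powr_powr)
  also have "\<dots> \<le> real p powr \<delta>"
  proof (rule powr_mono2)
    have "max 1 C powr (1 / \<delta>) \<le> real M" by (simp add: M_def real_nat_ceiling_ge)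
    then show "max 1 C powr (1 / \<delta>) \<le> real p" using p(2) by simp
  qed (use assms in auto)
  finally have "C \<le> real p powr \<delta>" .
  moreover have "odd p" using p prime_odd_nat by simp
  ultimately show ?thesis using that p(1) by blast
qed

text \<open>With \<open>d - k = 2 * i + 1\<close> the subspace dimension is
  \<open>m = i + 1\<close>. Then \<open>d - 2 * m = k - 1\<close> forces all Gram determinants to
  vanish, while \<open>d - m = k + i\<close> is exactly \<open>beta d k\<close>. The prime is taken
  so large that \<open>C\<close> is at most \<open>p powr (beta d k - \<alpha>)\<close>.\<close>

lemma exponent_optimal:
  fixes C c :: real
  assumes k: "2 \<le> k" "k < d" and odd: "odd (d - k)" and \<alpha>: "\<alpha> < beta d k" and c: "c > 0"
  obtains p Q E where "prime p" "odd p" "field (residue_ring (int p))" "order (residue_ring (int p)) = p"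
    "quadratic_form (residue_ring (int p)) (coord_space (residue_ring (int p)) d) Q"
    "nondegenerate_form (residue_ring (int p)) (coord_space (residue_ring (int p)) d) Q"
    "E \<subseteq> carrier (coord_space (residue_ring (int p)) d)"
    "C * real p powr \<alpha> \<le> card E"
    "card (nd_congruence_classes (residue_ring (int p)) (coord_space (residue_ring (int p)) d) Q k E)
      < c * real p ^ ((k + 1) choose 2)"
proof -
  obtain p :: nat where p: "prime p" "odd p" "C \<le> real p powr (beta d k - \<alpha>)"
    using odd_prime_powr_ge[of "beta d k - \<alpha>" C] \<alpha> by auto
  obtain i where i: "d - k = 2 * i + 1" using odd by (elim oddE)
  interpret split_form p d "Suc i"
    by unfold_locales (use p i k in auto)
  interpret Sp: finite_quadratic_space P d Qs by (rule quadratic_space)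
  have d_eq: "d = k + 2 * i + 1" using i k by simp
  have "beta d k = real (k + i)" unfolding d_eq by (simp add: beta_def)
  moreover have "d - Suc i = k + i" using d_eq by simp
  ultimately have beta: "beta d k = real (d - Suc i)" by (simp only:)
  have p0: "real p > 0" using p(1) by (simp add: prime_gt_0_nat)
  have "C * real p powr \<alpha> \<le> real p powr (beta d k - \<alpha>) * real p powr \<alpha>" using p(3) by (rule mult_right_mono) simp
  also have "\<dots> = real p powr beta d k" by (simp add: powr_add[symmetric])
  also have "\<dots> = real p ^ (d - Suc i)" unfolding beta using p0 by (rule powr_realpow)
  also have "\<dots> = card isotropic_perp" by (simp add: card_isotropic_perp)
  finally have large: "C * real p powr \<alpha> \<le> card isotropic_perp" .
  have "nd_simplices P V Qs k isotropic_perp = {}" by (rule no_nondegenerate_simplices) (use i k in auto)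
  then have "nd_congruence_classes P V Qs k isotropic_perp = {}" by (simp add: nd_congruence_classes_def)
  then have few: "card (nd_congruence_classes P V Qs k isotropic_perp) < c * real p ^ ((k + 1) choose 2)"
    using c p0 by simp
  show ?thesis
  proof (rule that[OF p(1,2) R.is_field order_P Sp.quadratic Sp.nondegenerate _ large few])
    show "isotropic_perp \<subseteq> carrier V" by (auto simp: isotropic_perp_def)
  qed
qed

theorem theorem1p1:
  fixes d k :: nat
  assumes "3 \<le> d" and "2 \<le> k" and "k \<le> d - 1"
  shows
    "(\<exists>C>0. \<exists>c>0. \<forall>(q::nat) (F::int ring) Q E.
        primepow q \<and> odd q \<and> field F \<and> order F = q \<and>
        quadratic_form F (coord_space F d) Q \<and> nondegenerate_form F (coord_space F d) Q \<and>
        E \<subseteq> carrier (coord_space F d) \<and>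
        real (card E) \<ge> C * real q powr beta d k \<longrightarrow>
        real (card (nd_congruence_classes F (coord_space F d) Q k E))
          \<ge> c * real q ^ ((k + 1) choose 2))
     \<and>
     (odd (int d - int k) \<longrightarrow>
       (\<forall>\<alpha> < beta d k. \<not> (\<exists>C>0. \<exists>c>0. \<forall>(q::nat) (F::int ring) Q E.
          primepow q \<and> odd q \<and> field F \<and> order F = q \<and>
          quadratic_form F (coord_space F d) Q \<and> nondegenerate_form F (coord_space F d) Q \<and>
          E \<subseteq> carrier (coord_space F d) \<and>
          real (card E) \<ge> C * real q powr \<alpha> \<longrightarrow>
          real (card (nd_congruence_classes F (coord_space F d) Q k E))
            \<ge> c * real q ^ ((k + 1) choose 2))))"
proof (intro conjI impI allI notI)
  have kd: "2 \<le> k" "k \<le> d" "k < d" using assms by auto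
  show "\<exists>C>0. \<exists>c>0. \<forall>(q::nat) (F::int ring) Q E.
      primepow q \<and> odd q \<and> field F \<and> order F = q \<and>
      quadratic_form F (coord_space F d) Q \<and> nondegenerate_form F (coord_space F d) Q \<and>
      E \<subseteq> carrier (coord_space F d) \<and>
      real (card E) \<ge> C * real q powr beta d k \<longrightarrow>
      real (card (nd_congruence_classes F (coord_space F d) Q k E)) \<ge> c * real q ^ ((k + 1) choose 2)"
  proof (rule exI[of _ "size_const d k"], rule conjI[OF size_const_pos],
      rule exI[of _ "count_const d k"], rule conjI[OF count_const_pos], intro allI impI, elim conjE)
    fix q :: nat and F :: "int ring" and Q E
    assume F: "odd q" "field F" "order F = q" "quadratic_form F (coord_space F d) Q"
        "nondegenerate_form F (coord_space F d) Q"
      and E: "E \<subseteq> carrier (coord_space F d)" "size_const d k * real q powr beta d k \<le> real (card E)"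
    \<comment> \<open>An infinite carrier would have cardinality \<open>0\<close>, which is even;
      oddness of \<open>q\<close> therefore yields finiteness of the field.\<close>
    have "card (carrier F) \<noteq> 0"
    proof
      assume "card (carrier F) = 0"
      then show False using F(1) unfolding F(3)[symmetric] Coset.order_def by simp
    qed
    then have "finite (carrier F)" by (meson card.infinite)
    then have "finite_quadratic_space F d Q"
      using F by (simp only: finite_quadratic_space_def simp_thms)
    from finite_quadratic_space.congruence_class_count[OF this kd(1,2) E(1)] E(2)
    show "count_const d k * real q ^ ((k + 1) choose 2) \<le> real (card (nd_congruence_classes F (coord_space F d) Q k E))"
      unfolding F(3) by simp
  qed
  fix \<alpha> assume odd_diff: "odd (int d - int k)" and \<alpha>: "\<alpha> < beta d k"
  have "int d - int k = int (d - k)" using kd by simp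
  with odd_diff have "odd (int (d - k))" by (rule back_subst)
  then have odd: "odd (d - k)" by simp
  assume "\<exists>C>0. \<exists>c>0. \<forall>(q::nat) (F::int ring) Q E.
      primepow q \<and> odd q \<and> field F \<and> order F = q \<and>
      quadratic_form F (coord_space F d) Q \<and> nondegenerate_form F (coord_space F d) Q \<and>
      E \<subseteq> carrier (coord_space F d) \<and>
      real (card E) \<ge> C * real q powr \<alpha> \<longrightarrow>
      real (card (nd_congruence_classes F (coord_space F d) Q k E)) \<ge> c * real q ^ ((k + 1) choose 2)"
  then show False
  proof (elim exE conjE)
    fix C c :: real assume c: "c > 0" and all: "\<forall>(q::nat) (F::int ring) Q E.
      primepow q \<and> odd q \<and> field F \<and> order F = q \<and>
      quadratic_form F (coord_space F d) Q \<and> nondegenerate_form F (coord_space F d) Q \<and>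
      E \<subseteq> carrier (coord_space F d) \<and>
      real (card E) \<ge> C * real q powr \<alpha> \<longrightarrow>
      real (card (nd_congruence_classes F (coord_space F d) Q k E)) \<ge> c * real q ^ ((k + 1) choose 2)"
    show False
    proof (rule exponent_optimal[OF kd(1,3) odd \<alpha> c, of C])
      fix p Q E
      assume ex: "prime p" "odd p" "field (residue_ring (int p))" "order (residue_ring (int p)) = p"
        "quadratic_form (residue_ring (int p)) (coord_space (residue_ring (int p)) d) Q"
        "nondegenerate_form (residue_ring (int p)) (coord_space (residue_ring (int p)) d) Q"
        "E \<subseteq> carrier (coord_space (residue_ring (int p)) d)"
        "C * real p powr \<alpha> \<le> card E"
        "card (nd_congruence_classes (residue_ring (int p)) (coord_space (residue_ring (int p)) d) Q k E)
          < c * real p ^ ((k + 1) choose 2)"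
      have "primepow p" using ex(1) by (rule primepow_prime)
      from all[rule_format, OF conjI[OF this conjI[OF ex(2) conjI[OF ex(3) conjI[OF ex(4)
        conjI[OF ex(5) conjI[OF ex(6) conjI[OF ex(7,8)]]]]]]]] ex(9)
      show False by linarith
    qed
  qed
qed

end
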